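(* Let $1<p<\infty$. A function $F(\zeta)$ on $\Gamma$ belongs to $L^p(\Gamma,|\mathrm{d}\zeta|)$ if and only if it is the sum (a.e. on $\Gamma$) of functions $F_+(\zeta)$ and $F_-(\zeta)$ which are the non-tangential boundary limits of some $F_+(w)\in H^p(\Omega_+)$ and some $F_-(w)\in H^p(\Omega_-)$, respectively.
   Context: Fix $\sigma>0$. For $s>0$, $t\in\mathbb{R}$ let $D_{s,t}=\{u+\mathrm{i}v: |u|<s,\ v>t\}$ and $\Gamma_{s,t}=\partial D_{s,t}$. Put $\Omega_+=D_{\sigma,0}$, $\Omega_-=\mathbb{C}\setminus\overline{D_{\sigma,0}}$, $\Gamma=\Gamma_{\sigma,0}=\Gamma_1\cup\Gamma_2\cup\Gamma_3$ with $\Gamma_1=\{-\sigma+\mathrm{i}v: v>0\}$, $\Gamma_2=[-\sigma,\sigma]$, $\Gamma_3=\{\sigma+\mathrm{i}v: v>0\}$. $H^p(\Omega_+)$ is the set of $F$ analytic on $\Omega_+$ with $\sup_{0<s<\sigma,\,t>0}\int_{\Gamma_{s,t}}|F(w)|^p|\mathrm{d}w|<\infty$; $H^p(\Omega_-)$ is the set of $F$ analytic on $\Omega_-$ with $\sup_{s>\sigma,\,t<0}\int_{\Gamma_{s,t}}|F(w)|^p|\mathrm{d}w|<\infty$. Non-tangential limits: for $\alpha>0$ and $\zeta\in\Gamma\setminus\{\pm\sigma\}$ let $\Omega_{\alpha\pm}(\zeta)$ be $\zeta\pm\{x+\mathrm{i}y: x>0,|y|<\alpha x\}$ if $\zeta\in\Gamma_1$,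 $\zeta\pm\{x+\mathrm{i}y: y>0,|x|<\alpha y\}$ if $\zeta\in\Gamma_2\setminus\{\pm\sigma\}$, $\zeta\pm\{x+\mathrm{i}y: x<0,|y|<-\alpha x\}$ if $\zeta\in\Gamma_3$. A function $F$ on $\Omega_+$ (resp. $\Omega_-$) has non-tangential boundary limit $F(\zeta_0)$ at $\zeta_0$ if for all $\alpha>0$, $F(w)\to F(\zeta_0)$ as $w\to\zeta_0$ with $w\in\Omega_{\alpha+}(\zeta_0)\cap\Omega_+$ (resp. $w\in\Omega_{\alpha-}(\zeta_0)\cap\Omega_-$); boundary limit functions are understood a.e. on $\Gamma$ with respect to arc length. *)

theory Defs
  imports "HOL-Complex_Analysis.Complex_Analysis"
begin

definition D :: "real \<Rightarrow> real \<Rightarrow> complex set" where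
  "D s t = {w. \<bar>Re w\<bar> < s \<and> Im w > t}"

definition Gamma :: "real \<Rightarrow> real \<Rightarrow> complex set" where
  "Gamma s t = frontier (D s t)"

definition Omega_plus :: "real \<Rightarrow> complex set" where
  "Omega_plus \<sigma> = D \<sigma> 0"

definition Omega_minus :: "real \<Rightarrow> complex set" where
  "Omega_minus \<sigma> = - closure (D \<sigma> 0)"

definition Gamma1 :: "real \<Rightarrow> complex set" where
  "Gamma1 \<sigma> = {Complex (- \<sigma>) v | v. v > 0}"

definition Gamma2 :: "real \<Rightarrow> complex set" where
  "Gamma2 \<sigma> = {Complex u 0 | u. - \<sigma> \<le> u \<and> u \<le> \<sigma>}"

definition Gamma3 :: "real \<Rightarrow> complex set" where
  "Gamma3 \<sigma> = {Complex \<sigma> v | v. v > 0}"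

text \<open>
  Unit-speed parametrisation of \<open>Gamma s t\<close> by the whole real line: down the left side,
  along the bottom (for \<open>- s \<le> x \<le> s\<close>), up the right side.
\<close>

definition gpath :: "real \<Rightarrow> real \<Rightarrow> real \<Rightarrow> complex" where
  "gpath s t x =
     (if x < - s then Complex (- s) (t + (- x - s))
      else if x \<le> s then Complex x t
      else Complex s (t + (x - s)))"

text \<open>
  Arc length measure on \<open>Gamma s t\<close>, i.e. the image of one-dimensional Lebesgue measure under
  the unit-speed parametrisation. It is completed, so that measurability means Lebesgue
  measurability on the curve and is insensitive to changes on null sets.
\<close>

definition arc_length :: "real \<Rightarrow> real \<Rightarrow> complex measure" where
  "arc_length s t = completion (distr lborel (restrict_space borel (Gamma s t)) (gpath s t))"

definition Lp :: "real \<Rightarrow> 'a measure \<Rightarrow> ('a \<Rightarrow> complex) set" where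
  "Lp p M = {f. f \<in> borel_measurable M \<and> integrable M (\<lambda>x. norm (f x) powr p)}"

definition Hardy_plus :: "real \<Rightarrow> real \<Rightarrow> (complex \<Rightarrow> complex) set" where
  "Hardy_plus p \<sigma> = {F. F analytic_on Omega_plus \<sigma> \<and>
     (SUP (s, t) \<in> {0<..<\<sigma>} \<times> {0<..}.
        \<integral>\<^sup>+ w. ennreal (norm (F w) powr p) \<partial>arc_length s t) < \<infinity>}"

definition Hardy_minus :: "real \<Rightarrow> real \<Rightarrow> (complex \<Rightarrow> complex) set" where
  "Hardy_minus p \<sigma> = {F. F analytic_on Omega_minus \<sigma> \<and>
     (SUP (s, t) \<in> {\<sigma><..} \<times> {..<0}.
        \<integral>\<^sup>+ w. ennreal (norm (F w) powr p) \<partial>arc_length s t) < \<infinity>}"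

text \<open>
  Cone of directions pointing into \<open>Omega_plus \<sigma>\<close> at a boundary point other than the two
  corners. The value \<open>{}\<close> at the corners (and off the curve) is a dummy.
\<close>

definition inner_cone :: "real \<Rightarrow> real \<Rightarrow> complex \<Rightarrow> complex set" where
  "inner_cone \<sigma> \<alpha> \<zeta> =
     (if \<zeta> \<in> Gamma1 \<sigma> then {z. Re z > 0 \<and> \<bar>Im z\<bar> < \<alpha> * Re z}
      else if \<zeta> \<in> Gamma2 \<sigma> - {Complex (- \<sigma>) 0, Complex \<sigma> 0}
        then {z. Im z > 0 \<and> \<bar>Re z\<bar> < \<alpha> * Im z}
      else if \<zeta> \<in> Gamma3 \<sigma> then {z. Re z < 0 \<and> \<bar>Im z\<bar> < - \<alpha> * Re z}
      else {})"

definition cone_plus :: "real \<Rightarrow> real \<Rightarrow> complex \<Rightarrow> complex set" where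
  "cone_plus \<sigma> \<alpha> \<zeta> = (\<lambda>z. \<zeta> + z) ` inner_cone \<sigma> \<alpha> \<zeta>"

definition cone_minus :: "real \<Rightarrow> real \<Rightarrow> complex \<Rightarrow> complex set" where
  "cone_minus \<sigma> \<alpha> \<zeta> = (\<lambda>z. \<zeta> - z) ` inner_cone \<sigma> \<alpha> \<zeta>"

definition has_nt_limit_plus :: "real \<Rightarrow> (complex \<Rightarrow> complex) \<Rightarrow> complex \<Rightarrow> complex \<Rightarrow> bool" where
  "has_nt_limit_plus \<sigma> F \<zeta> L \<longleftrightarrow> \<zeta> \<in> Gamma \<sigma> 0 - {Complex (- \<sigma>) 0, Complex \<sigma> 0} \<and>
     (\<forall>\<alpha>>0. (F \<longlongrightarrow> L) (at \<zeta> within cone_plus \<sigma> \<alpha> \<zeta> \<inter> Omega_plus \<sigma>))"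

definition has_nt_limit_minus :: "real \<Rightarrow> (complex \<Rightarrow> complex) \<Rightarrow> complex \<Rightarrow> complex \<Rightarrow> bool" where
  "has_nt_limit_minus \<sigma> F \<zeta> L \<longleftrightarrow> \<zeta> \<in> Gamma \<sigma> 0 - {Complex (- \<sigma>) 0, Complex \<sigma> 0} \<and>
     (\<forall>\<alpha>>0. (F \<longlongrightarrow> L) (at \<zeta> within cone_minus \<sigma> \<alpha> \<zeta> \<inter> Omega_minus \<sigma>))"

definition nt_boundary_function_plus ::
    "real \<Rightarrow> (complex \<Rightarrow> complex) \<Rightarrow> (complex \<Rightarrow> complex) \<Rightarrow> bool" where
  "nt_boundary_function_plus \<sigma> F f \<longleftrightarrow> (AE \<zeta> in arc_length \<sigma> 0. has_nt_limit_plus \<sigma> F \<zeta> (f \<zeta>))"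

definition nt_boundary_function_minus ::
    "real \<Rightarrow> (complex \<Rightarrow> complex) \<Rightarrow> (complex \<Rightarrow> complex) \<Rightarrow> bool" where
  "nt_boundary_function_minus \<sigma> F f \<longleftrightarrow> (AE \<zeta> in arc_length \<sigma> 0. has_nt_limit_minus \<sigma> F \<zeta> (f \<zeta>))"

text \<open>The parametrisation is injective and has the topological boundary as its range.\<close>

lemma closure_D:
  assumes "0 < s"
  shows "closure (D s t) = {w. \<bar>Re w\<bar> \<le> s \<and> Im w \<ge> t}"
proof
  have "closed {w. \<bar>Re w\<bar> \<le> s \<and> Im w \<ge> t}"
    by (intro closed_Collect_conj closed_Collect_le continuous_intros)
  then show "closure (D s t) \<subseteq> {w. \<bar>Re w\<bar> \<le> s \<and> Im w \<ge> t}"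
    by (intro closure_minimal) (auto simp: D_def)
next
  show "{w. \<bar>Re w\<bar> \<le> s \<and> Im w \<ge> t} \<subseteq> closure (D s t)"
  proof
    fix w assume "w \<in> {w. \<bar>Re w\<bar> \<le> s \<and> Im w \<ge> t}"
    then have w: "\<bar>Re w\<bar> \<le> s" "Im w \<ge> t" by auto
    let ?f = "\<lambda>d. Complex ((1 - d) * Re w) (Im w + d)"
    have "((\<lambda>d. Complex ((1 - d) * Re w) (Im w + d)) \<longlongrightarrow> Complex ((1 - 0) * Re w) (Im w + 0))
        (at_right (0::real))"
      by (intro tendsto_intros)
    then have lim: "(?f \<longlongrightarrow> w) (at_right 0)" by simp
    have "eventually (\<lambda>d::real. d \<in> {0<..<1}) (at_right 0)"
      by (rule eventually_at_right_real) simp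
    then have "eventually (\<lambda>d. ?f d \<in> closure (D s t)) (at_right 0)"
    proof eventually_elim
      case (elim d)
      have "(1 - d) * \<bar>Re w\<bar> \<le> (1 - d) * s" using elim w by (intro mult_left_mono) auto
      also have "\<dots> < s" using elim assms by (simp add: algebra_simps)
      finally have "?f d \<in> D s t" using elim w by (simp add: D_def abs_mult)
      then show ?case using closure_subset by blast
    qed
    then show "w \<in> closure (D s t)"
      by (intro Lim_in_closed_set[OF _ _ _ lim]) auto
  qed
qed

lemma Gamma_eq:
  assumes "0 < s"
  shows "Gamma s t = {w. (\<bar>Re w\<bar> = s \<and> Im w \<ge> t) \<or> (\<bar>Re w\<bar> \<le> s \<and> Im w = t)}"
proof -
  have "open (D s t)"
    unfolding D_def by (intro open_Collect_conj open_Collect_less continuous_intros)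
  then show ?thesis
    unfolding Gamma_def frontier_def closure_D[OF assms] by (auto simp: interior_open D_def)
qed

lemma Gamma_Un:
  assumes "0 < \<sigma>"
  shows "Gamma \<sigma> 0 = Gamma1 \<sigma> \<union> Gamma2 \<sigma> \<union> Gamma3 \<sigma>"
  using assms unfolding Gamma_eq[OF assms] Gamma1_def Gamma2_def Gamma3_def
  by (auto simp: complex_eq_iff abs_if split: if_splits)

lemma range_gpath:
  assumes "0 < s"
  shows "range (gpath s t) = Gamma s t"
proof
  show "range (gpath s t) \<subseteq> Gamma s t"
    using assms by (auto simp: Gamma_eq gpath_def)
next
  show "Gamma s t \<subseteq> range (gpath s t)"
  proof
    fix w assume "w \<in> Gamma s t"
    then consider "Re w = - s" "Im w > t" | "\<bar>Re w\<bar> \<le> s" "Im w = t" | "Re w = s" "Im w > t"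
      using assms by (force simp: Gamma_eq abs_if split: if_splits)
    then show "w \<in> range (gpath s t)"
    proof cases
      case 1
      then have "w = gpath s t (t - s - Im w)" by (simp add: gpath_def complex_eq_iff)
      then show ?thesis by blast
    next
      case 2
      then have "w = gpath s t (Re w)" by (auto simp: gpath_def complex_eq_iff)
      then show ?thesis by blast
    next
      case 3
      then have "w = gpath s t (s + Im w - t)"
        using assms by (simp add: gpath_def complex_eq_iff)
      then show ?thesis by blast
    qed
  qed
qed

lemma inj_gpath:
  assumes "0 < s"
  shows "inj (gpath s t)"
  using assms by (auto simp: inj_def gpath_def complex_eq_iff split: if_splits)

text \<open>It is measurable, so that the image measure above is not a degenerate one.\<close>

lemma measurable_gpath:
  assumes "0 < s"
  shows "gpath s t \<in> lborel \<rightarrow>\<^sub>M restrict_space borel (Gamma s t)"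
proof -
  have "(\<lambda>x. complex_of_real (Re (gpath s t x)) + \<i> * complex_of_real (Im (gpath s t x)))
      \<in> borel_measurable borel"
    unfolding gpath_def by (simp add: if_distrib[of Re] if_distrib[of Im] cong: if_cong)
  then have "gpath s t \<in> borel_measurable borel"
    by (simp flip: complex_eq)
  then show ?thesis
    using range_gpath[OF assms] by (intro measurable_restrict_space2) auto
qed

lemma emeasure_arc_length:
  assumes "0 < s" "A \<in> sets borel" "A \<subseteq> Gamma s t"
  shows "emeasure (arc_length s t) A = emeasure lborel (gpath s t -` A)"
proof -
  have "A \<in> sets (restrict_space borel (Gamma s t))"
    using assms by (auto simp: sets_restrict_space)
  then show ?thesis
    using measurable_gpath[OF assms(1), of t]
    by (simp add: arc_length_def emeasure_distr)
qed

end

theory Submission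
  imports Defs "HOL-Probability.Sinc_Integral"
begin

text \<open>
  Cut the given function on the curve into the three pieces that live on the two vertical
  half-lines and on the bottom segment. Each piece sits on a straight line, and after a
  rotation this line is the real axis. So everything reduces to the Cauchy integral
  \<open>cauchy f z\<close>, that is 1/(2 pi i) times the integral of f(t)/(t - z), for f of
  class \<open>L\<^sup>p\<close> on the real axis. The sum S of the three Cauchy integrals,
  with signs given by the orientation (\<open>strip_cauchy\<close>), is analytic off the
  curve; S inside and -S outside are the two Hardy functions. Three facts about Cauchy
  integrals carry the proof.

  The first is the theorem of M. Riesz (\<open>riesz_cauchy\<close>): on the lines parallel
  to the real axis, the integrals of |cauchy f|^p are bounded by a constant times that of
  |f|^p. For 1 < p \<le> 2 and f \<ge> 0 the function G = 2 cauchy f has in the upper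
  half-plane the Poisson integral of f as its real part, which is positive; so G^p is
  holomorphic, decays like |z|^(-p), and has integral 0 over horizontal lines. The pointwise
  inequality |z|^p \<le> A (Re z)^p - B Re (z^p) in the right half-plane then bounds the
  integral of |G|^p by that of the p-th power of a Poisson integral. Duality gives p > 2.

  The second is the same bound on lines perpendicular to the real axis
  (\<open>cauchy_perp_bound\<close>). There the Cauchy kernel is homogeneous of degree -1,
  and a dilation reduces the bound to Minkowski's inequality. A curve \<open>Gamma s
  t\<close> consists of pieces of two vertical lines and one horizontal line, so the two
  bounds give the Hardy conditions.

  The third is that cauchy f has nontangential limits almost everywhere from both sides of
  the real axis, and that they differ by f (\<open>cauchy_boundary_values\<close>). By the
  first fact the functions x \<mapsto> cauchy f (x + i e) are Cauchy in
  \<open>L\<^sup>p\<close> as e tends to 0, because raising the height by d amounts to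
  replacing f by its Poisson integral at height d. Hence cauchy f is, in the upper
  half-plane, the Poisson integral of the \<open>L\<^sup>p\<close> limit, and Poisson
  integrals converge nontangentially at Lebesgue points. The difference of the two sides is
  the Poisson integral of f.

  At a point of one piece the other two Cauchy integrals are continuous, and what they
  contribute to the limits of S and -S cancels in the sum; the jump of the third one is the
  given function. Conversely, a boundary function is a pointwise limit of values on the
  curves \<open>Gamma s t\<close>, so Fatou's lemma bounds the integral of its p-th power
  (\<open>boundary_limit_lp\<close>).
\<close>

section \<open>Integral inequalities for p-th powers\<close>

text \<open>
  The p-th power of the \<open>L\<^sup>p\<close> norm, as an extended number, so that it can
  be estimated before it is known to be finite.
\<close>

definition lp_mass :: "real \<Rightarrow> (real \<Rightarrow> complex) \<Rightarrow> ennreal" where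
  "lp_mass p f = (\<integral>\<^sup>+x. ennreal (norm (f x) powr p) \<partial>lborel)"

definition lp_fun :: "real \<Rightarrow> (real \<Rightarrow> complex) \<Rightarrow> bool" where
  "lp_fun p f \<longleftrightarrow> f \<in> borel_measurable borel \<and> lp_mass p f < \<infinity>"

lemma lp_fun_measurable [measurable_dest]: "lp_fun p f \<Longrightarrow> f \<in> borel_measurable borel"
  by (simp add: lp_fun_def)

text \<open>
  Young's inequality for the exponents p and p/(p - 1), rearranged: the convex function
  \<open>t powr p\<close> lies above its tangents.
\<close>

lemma powr_ge_tangent:
  fixes a t p :: real
  assumes "1 < p" "0 \<le> a" "0 \<le> t"
  shows "a powr p + p * a powr (p - 1) * (t - a) \<le> t powr p"
proof (cases "a = 0")
  case True
  then show ?thesis using assms by simp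
next
  case False
  define q where "q = p / (p - 1)"
  have q: "q > 1" "1 / p + 1 / q = 1" using assms by (auto simp: q_def field_simps)
  have "t * a powr (p - 1) \<le> t powr p / p + (a powr (p - 1)) powr q / q"
    using Youngs_inequality[of p q t "a powr (p - 1)"] assms q by auto
  also have "(a powr (p - 1)) powr q = a powr p"
    using assms by (simp add: powr_powr q_def)
  also have "a powr p / q = a powr p * (p - 1) / p"
    using assms by (simp add: q_def)
  finally have "p * (t * a powr (p - 1)) \<le> t powr p + a powr p * (p - 1)"
    using assms by (simp add: field_simps)
  moreover have "a powr p = a powr (p - 1) * a"
    using powr_add[of a "p - 1" 1] assms False by simp
  ultimately show ?thesis by (simp add: algebra_simps)
qed

text \<open>
  Integrate the tangent inequality at the weighted mean of the norm of g. If the integral on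
  the left does not converge, its value is 0 by convention and the bound is trivial.
\<close>

lemma jensen_powr:
  fixes w :: "'a \<Rightarrow> real" and g :: "'a \<Rightarrow> complex"
  assumes p: "1 < p" and w [measurable]: "w \<in> borel_measurable M" and w0: "\<And>x. 0 \<le> w x"
    and iw: "integrable M w" and g [measurable]: "g \<in> borel_measurable M"
  shows "ennreal (norm (\<integral>x. of_real (w x) * g x \<partial>M) powr p)
    \<le> ennreal ((\<integral>x. w x \<partial>M) powr (p - 1)) *
      (\<integral>\<^sup>+x. ennreal (w x) * ennreal (norm (g x) powr p) \<partial>M)"
proof (cases "integrable M (\<lambda>x. of_real (w x) * g x)")
  case False
  then show ?thesis using p by (simp add: not_integrable_integral_eq)
next
  case int: True
  define W where "W = (\<integral>x. w x \<partial>M)"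
  have int1: "integrable M (\<lambda>x. w x * norm (g x))"
    using integrable_norm[OF int] w0 by (simp add: norm_mult)
  have W0: "W \<ge> 0" unfolding W_def using w0 by simp
  have nle: "norm (\<integral>x. of_real (w x) * g x \<partial>M) \<le> (\<integral>x. w x * norm (g x) \<partial>M)" (is "_ \<le> ?S")
    using integral_norm_bound[of M "\<lambda>x. of_real (w x) * g x"] w0 by (simp add: norm_mult)
  show ?thesis
  proof (cases "W = 0")
    case True
    then have "AE x in M. w x = 0"
      using integral_nonneg_eq_0_iff_AE[OF iw] w0 by (simp add: W_def)
    then have "?S = 0"
      by (intro integral_eq_zero_AE) auto
    then show ?thesis using nle p by simp
  next
    case False
    then have W: "W > 0" using W0 by simp
    show ?thesis
    proof (cases "integrable M (\<lambda>x. w x * norm (g x) powr p)")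
      case False
      have "(\<integral>\<^sup>+x. ennreal (w x * norm (g x) powr p) \<partial>M) = \<infinity>"
      proof (rule ccontr)
        assume "\<not> ?thesis"
        then have "integrable M (\<lambda>x. w x * norm (g x) powr p)"
          using w0 by (intro integrableI_nonneg) (auto simp: less_top)
        with False show False ..
      qed
      then show ?thesis using W w0 W_def by (simp add: ennreal_mult'' ennreal_mult_top)
    next
      case ip: True
      define a where "a = ?S / W"
      have S0: "?S \<ge> 0" using w0 by (intro integral_nonneg_AE) auto
      have a: "a \<ge> 0" unfolding a_def using S0 W by simp
      have "(\<integral>x. w x * (a powr p + p * a powr (p - 1) * (norm (g x) - a)) \<partial>M)
          \<le> (\<integral>x. w x * norm (g x) powr p \<partial>M)"
      proof (intro integral_mono mult_left_mono powr_ge_tangent p a w0)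
        have "integrable M (\<lambda>x. (a powr p - p * a powr (p - 1) * a) * w x + p * a powr (p - 1) * (w x * norm (g x)))"
          using iw int1 by (intro Bochner_Integration.integrable_add integrable_mult_right)
        then show "integrable M (\<lambda>x. w x * (a powr p + p * a powr (p - 1) * (norm (g x) - a)))"
          by (rule Bochner_Integration.integrable_cong[THEN iffD1, rotated -1]) (auto simp: algebra_simps)
      qed (use ip in auto)
      also have "(\<integral>x. w x * (a powr p + p * a powr (p - 1) * (norm (g x) - a)) \<partial>M)
        = (\<integral>x. (a powr p - p * a powr (p - 1) * a) * w x + p * a powr (p - 1) * (w x * norm (g x)) \<partial>M)"
        by (intro Bochner_Integration.integral_cong) (auto simp: algebra_simps)
      also have "\<dots> = (a powr p - p * a powr (p - 1) * a) * W + p * a powr (p - 1) * ?S"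
        using iw int1 by (subst Bochner_Integration.integral_add) (auto simp: W_def)
      also have "\<dots> = a powr p * W"
        using W by (simp add: a_def field_simps)
      finally have le: "a powr p * W \<le> (\<integral>x. w x * norm (g x) powr p \<partial>M)" .
      have "norm (\<integral>x. of_real (w x) * g x \<partial>M) powr p \<le> ?S powr p"
        using nle p by (intro powr_mono2) auto
      also have "?S = W * a" using W by (simp add: a_def)
      also have "(W * a) powr p = W powr (p - 1) * (a powr p * W)"
        using W a powr_add[of W "p - 1" 1] by (simp add: powr_mult)
      also have "\<dots> \<le> W powr (p - 1) * (\<integral>x. w x * norm (g x) powr p \<partial>M)"
        using le by (intro mult_left_mono) auto
      finally have "ennreal (norm (\<integral>x. of_real (w x) * g x \<partial>M) powr p) \<le>
          ennreal (W powr (p - 1) * (\<integral>x. w x * norm (g x) powr p \<partial>M))"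
        by (intro ennreal_leI)
      also have "\<dots> = ennreal (W powr (p - 1)) * (\<integral>\<^sup>+x. ennreal (w x * norm (g x) powr p) \<partial>M)"
        using w0 ip by (subst nn_integral_eq_integral) (auto simp: ennreal_mult'')
      finally show ?thesis using w0 by (simp add: ennreal_mult'' W_def)
    qed
  qed
qed

text \<open>
  An average of functions of y is bounded by the average of their \<open>L\<^sup>p\<close>
  norms. The Poisson integral, and the Cauchy integral on a line perpendicular to the real
  axis, become such averages after a dilation of the variable of integration.
\<close>

lemma minkowski_powr:
  fixes w :: "real \<Rightarrow> real" and G :: "real \<Rightarrow> real \<Rightarrow> complex"
  assumes p: "1 < p" and w [measurable]: "w \<in> borel_measurable borel" and w0: "\<And>x. 0 \<le> w x"
    and iw: "integrable lborel w"
    and G [measurable]: "(\<lambda>(y, u). G y u) \<in> borel_measurable (borel \<Otimes>\<^sub>M borel)"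
    and B: "\<And>u. w u \<noteq> 0 \<Longrightarrow> lp_mass p (\<lambda>y. G y u) \<le> B"
  shows "lp_mass p (\<lambda>y. \<integral>u. of_real (w u) * G y u \<partial>lborel)
    \<le> ennreal ((\<integral>u. w u \<partial>lborel) powr p) * B"
proof -
  let ?W = "\<integral>u. w u \<partial>lborel"
  have W0: "?W \<ge> 0" using w0 by simp
  have "lp_mass p (\<lambda>y. \<integral>u. of_real (w u) * G y u \<partial>lborel) \<le>
    (\<integral>\<^sup>+y. ennreal (?W powr (p - 1)) * (\<integral>\<^sup>+u. ennreal (w u) * ennreal (norm (G y u) powr p) \<partial>lborel) \<partial>lborel)"
    unfolding lp_mass_def
    using p w0 iw by (intro nn_integral_mono jensen_powr) auto
  also have "\<dots> = ennreal (?W powr (p - 1)) * (\<integral>\<^sup>+y. (\<integral>\<^sup>+u. ennreal (w u) * ennreal (norm (G y u) powr p) \<partial>lborel) \<partial>lborel)"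
    by (intro nn_integral_cmult) simp
  also have "(\<integral>\<^sup>+y. (\<integral>\<^sup>+u. ennreal (w u) * ennreal (norm (G y u) powr p) \<partial>lborel) \<partial>lborel) =
     (\<integral>\<^sup>+u. (\<integral>\<^sup>+y. ennreal (w u) * ennreal (norm (G y u) powr p) \<partial>lborel) \<partial>lborel)"
    by (rule lborel_pair.Fubini') simp
  also have "\<dots> = (\<integral>\<^sup>+u. ennreal (w u) * lp_mass p (\<lambda>y. G y u) \<partial>lborel)"
    unfolding lp_mass_def by (intro nn_integral_cong nn_integral_cmult) simp
  also have "\<dots> \<le> (\<integral>\<^sup>+u. ennreal (w u) * B \<partial>lborel)"
  proof (intro nn_integral_mono)
    fix u show "ennreal (w u) * lp_mass p (\<lambda>y. G y u) \<le> ennreal (w u) * B"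
      using B[of u] by (cases "w u = 0") (auto intro: mult_left_mono)
  qed
  also have "\<dots> = ennreal ?W * B"
    using w0 iw by (simp add: nn_integral_multc nn_integral_eq_integral)
  finally have "lp_mass p (\<lambda>y. \<integral>u. of_real (w u) * G y u \<partial>lborel) \<le> ennreal (?W powr (p - 1)) * (ennreal ?W * B)"
    by (simp add: mult_left_mono)
  also have "ennreal (?W powr (p - 1)) * (ennreal ?W * B) = ennreal (?W powr p) * B"
  proof (cases "?W = 0")
    case False
    then have "?W powr p = ?W powr (p - 1) * ?W"
      using W0 powr_add[of ?W "p - 1" 1] by simp
    then show ?thesis using W0 by (simp add: ennreal_mult'' mult.assoc)
  qed (use p in auto)
  finally show ?thesis .
qed

lemma lp_mass_affine:
  assumes [measurable]: "f \<in> borel_measurable borel" and "c \<noteq> 0"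
  shows "lp_mass p (\<lambda>x. f (t + c * x)) = ennreal (1 / \<bar>c\<bar>) * lp_mass p f"
proof -
  have "lp_mass p f = ennreal \<bar>c\<bar> * lp_mass p (\<lambda>x. f (t + c * x))"
    unfolding lp_mass_def using assms by (subst nn_integral_real_affine[where c = c and t = t]) auto
  then show ?thesis
    using assms by (simp flip: mult.assoc ennreal_mult'')
qed

lemma lp_fun_affine: "lp_fun p f \<Longrightarrow> c \<noteq> 0 \<Longrightarrow> lp_fun p (\<lambda>x. f (t + c * x))"
  by (auto simp: lp_fun_def lp_mass_affine ennreal_mult_less_top)

lemma lp_mass_mono: "(\<And>x. norm (f x) \<le> norm (g x)) \<Longrightarrow> 0 \<le> p \<Longrightarrow> lp_mass p f \<le> lp_mass p g"
  unfolding lp_mass_def by (intro nn_integral_mono ennreal_leI powr_mono2) auto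

lemma lp_fun_bound:
  "lp_fun p g \<Longrightarrow> f \<in> borel_measurable borel \<Longrightarrow> (\<And>x. norm (f x) \<le> norm (g x)) \<Longrightarrow> 0 \<le> p \<Longrightarrow> lp_fun p f"
  unfolding lp_fun_def using lp_mass_mono[of f g p] by (auto intro: le_less_trans)

lemma lp_integrable: "lp_fun p f \<Longrightarrow> integrable lborel (\<lambda>x. norm (f x) powr p)"
  by (auto simp: lp_fun_def lp_mass_def intro!: integrableI_nonneg)

lemma lp_integrable_mult:
  fixes g :: "real \<Rightarrow> complex"
  assumes "1 < p" "lp_fun p f" "lp_fun (p / (p - 1)) g"
  shows "integrable lborel (\<lambda>x. f x * g x)"
proof (rule Bochner_Integration.integrable_bound)
  let ?q = "p / (p - 1)"
  show "integrable lborel (\<lambda>x. norm (f x) powr p / p + norm (g x) powr ?q / ?q)"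
    using assms by (intro Bochner_Integration.integrable_add integrable_divide lp_integrable)
  show "AE x in lborel. norm (f x * g x) \<le> norm (norm (f x) powr p / p + norm (g x) powr ?q / ?q)"
  proof (intro AE_I2)
    fix x
    have "norm (f x * g x) \<le> norm (f x) powr p / p + norm (g x) powr ?q / ?q"
      unfolding norm_mult using assms by (intro Youngs_inequality) (auto simp: field_simps)
    then show "norm (f x * g x) \<le> norm (norm (f x) powr p / p + norm (g x) powr ?q / ?q)" by simp
  qed
  show "(\<lambda>x. f x * g x) \<in> borel_measurable lborel"
    using assms by (auto simp: lp_fun_def)
qed

lemma integrable_abs_half_line:
  fixes g :: "real \<Rightarrow> real"
  assumes "g \<in> borel_measurable borel" and "\<And>t. 0 \<le> g t"
    and "(\<integral>\<^sup>+t. ennreal (g t) * indicator {0..} t \<partial>lborel) < \<infinity>"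
  shows "integrable lborel (\<lambda>t. g \<bar>t\<bar>)"
proof (rule integrableI_nonneg)
  have [measurable]: "g \<in> borel_measurable borel" by fact
  show "(\<lambda>t. g \<bar>t\<bar>) \<in> borel_measurable lborel" by simp
  show "AE t in lborel. 0 \<le> g \<bar>t\<bar>" using assms by simp
  have "(\<integral>\<^sup>+t. ennreal (g \<bar>t\<bar>) \<partial>lborel) \<le>
      (\<integral>\<^sup>+t. (ennreal (g t) * indicator {0..} t + ennreal (g (0 + (-1) * t)) * indicator {0..} (0 + (-1) * t)) \<partial>lborel)"
    by (intro nn_integral_mono) (auto simp: indicator_def abs_if)
  also have "\<dots> = (\<integral>\<^sup>+t. ennreal (g t) * indicator {0..} t \<partial>lborel) + (\<integral>\<^sup>+t. ennreal (g (0 + (-1) * t)) * indicator {0..} (0 + (-1) * t) \<partial>lborel)"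
    by (intro nn_integral_add) simp_all
  also have "(\<integral>\<^sup>+t. ennreal (g (0 + (-1) * t)) * indicator {0..} (0 + (-1) * t) \<partial>lborel) = (\<integral>\<^sup>+t. ennreal (g t) * indicator {0..} t \<partial>lborel)"
    using nn_integral_real_affine[of "\<lambda>t. ennreal (g t) * indicator {0..} t" "-1" 0] by simp
  finally show "(\<integral>\<^sup>+t. ennreal (g \<bar>t\<bar>) \<partial>lborel) < \<infinity>"
    by (rule le_less_trans) (use assms(3) in simp)
qed

lemma nn_integral_decay:
  fixes a :: real
  assumes "a > 1"
  shows "(\<integral>\<^sup>+t. ennreal ((1 + \<bar>t\<bar>) powr (-a)) * indicator {0..} t \<partial>lborel) < \<infinity>"
proof -
  have "(\<integral>\<^sup>+t. ennreal ((1 + \<bar>t\<bar>) powr (-a)) * indicator {0..} t \<partial>lborel) =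
      (\<integral>\<^sup>+t. ennreal ((1 + t) powr (-a)) * indicator {0..} t \<partial>lborel)"
    by (intro nn_integral_cong) (auto simp: indicator_def)
  also have "\<dots> = ennreal (0 - (1 + 0) powr (1 - a) / (1 - a))"
  proof (rule nn_integral_FTC_atLeast)
    show "((\<lambda>t. (1 + t) powr (1 - a) / (1 - a)) has_real_derivative (1 + t) powr - a) (at t)" if "0 \<le> t" for t
      using that assms by (auto intro!: derivative_eq_intros)
    have "((\<lambda>t. (1 + t) powr (1 - a)) \<longlongrightarrow> 0) at_top"
      using assms by (intro tendsto_neg_powr filterlim_tendsto_add_at_top[OF tendsto_const] filterlim_ident) auto
    from tendsto_divide[OF this tendsto_const, of "1 - a"]
    show "((\<lambda>t. (1 + t) powr (1 - a) / (1 - a)) \<longlongrightarrow> 0) at_top" using assms by simp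
  qed auto
  finally show ?thesis by simp
qed

lemma integrable_decay:
  fixes a :: real
  assumes "a > 1"
  shows "integrable lborel (\<lambda>t. (1 + \<bar>t\<bar>) powr (-a))"
proof -
  have "integrable lborel (\<lambda>t. (1 + \<bar>\<bar>t\<bar>\<bar>) powr (-a))"
    by (rule integrable_abs_half_line[of "\<lambda>t. (1 + \<bar>t\<bar>) powr (-a)"])
       (use nn_integral_decay[OF assms] in auto)
  then show ?thesis by simp
qed

lemma lp_fun_decay: "1 < p \<Longrightarrow> lp_fun p (\<lambda>t. of_real (1 / (1 + \<bar>t\<bar>)))"
proof -
  assume p: "1 < p"
  have eq: "norm (complex_of_real (1 / (1 + \<bar>t\<bar>))) powr p = (1 + \<bar>t\<bar>) powr (-p)" for t :: real
    by (simp only: norm_of_real) (simp add: powr_minus powr_divide divide_inverse inverse_powr)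
  have "lp_mass p (\<lambda>t. of_real (1 / (1 + \<bar>t\<bar>))) = (\<integral>\<^sup>+t. ennreal ((1 + \<bar>t\<bar>) powr (-p)) \<partial>lborel)"
    unfolding lp_mass_def eq ..
  also have "\<dots> < \<infinity>" using integrable_decay[OF p]
    by (subst nn_integral_eq_integral) auto
  finally show ?thesis by (simp add: lp_fun_def)
qed

text \<open>
  The function 1/(1 + |t|) belongs to the dual exponent. The majorant |f t|/(1 + |t|)
  dominates every Cauchy integrand whose point z has positive distance from the support of
  f.
\<close>

lemma lp_integrable_div:
  assumes "1 < p" "lp_fun p f"
  shows "integrable lborel (\<lambda>t. norm (f t) / (1 + \<bar>t\<bar>))"
proof -
  have "integrable lborel (\<lambda>t. f t * of_real (1 / (1 + \<bar>t\<bar>)))"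
    using assms by (intro lp_integrable_mult lp_fun_decay) (auto simp: field_simps)
  from integrable_norm[OF this] show ?thesis
    by (simp add: norm_mult norm_divide flip: of_real_add)
qed

section \<open>Cauchy and Poisson integrals on the real line\<close>

text \<open>
  The Poisson kernel of the upper half-plane at height 1. The kernel at height y arises from
  it by dilation, and all Poisson integrals below are written with the dilated variable.
\<close>

definition pkern :: "real \<Rightarrow> real" where
  "pkern u = 1 / (pi * (1 + u\<^sup>2))"

lemma pkern_pos: "pkern u > 0"
  by (auto simp: pkern_def intro!: mult_pos_pos add_pos_nonneg)

lemma pkern_measurable [measurable]: "pkern \<in> borel_measurable borel"
  unfolding pkern_def[abs_def] by measurable

lemma integrable_pkern: "integrable lborel pkern" and integral_pkern: "(\<integral>u. pkern u \<partial>lborel) = 1"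
proof -
  have 1: "integrable lborel (\<lambda>x::real. inverse (1 + x\<^sup>2))"
    using integrable_inverse_1_plus_square by (simp add: set_integrable_def)
  have 2: "(\<integral>x. inverse (1 + x\<^sup>2) \<partial>lborel) = pi"
    using LBINT_inverse_1_plus_square by (simp add: interval_lebesgue_integral_def set_lebesgue_integral_def)
  have eq: "pkern = (\<lambda>x. inverse pi * inverse (1 + x\<^sup>2))"
    by (auto simp: pkern_def fun_eq_iff divide_inverse)
  show "integrable lborel pkern" unfolding eq using 1 by simp
  show "(\<integral>u. pkern u \<partial>lborel) = 1" unfolding eq using 2 by simp
qed

lemma nn_integral_pkern: "(\<integral>\<^sup>+u. ennreal (pkern u) \<partial>lborel) = 1"
  using integrable_pkern integral_pkern pkern_pos by (subst nn_integral_eq_integral) (auto intro: less_imp_le)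

text \<open>
  At a real point of the support of f the integral may diverge; the value there is
  meaningless and enters the estimates only on null sets.
\<close>

definition cauchy :: "(real \<Rightarrow> complex) \<Rightarrow> complex \<Rightarrow> complex" where
  "cauchy f z = 1 / (2 * of_real pi * \<i>) * (\<integral>t. f t / (of_real t - z) \<partial>lborel)"

definition poisson :: "real \<Rightarrow> (real \<Rightarrow> complex) \<Rightarrow> real \<Rightarrow> complex" where
  "poisson y f x = (\<integral>u. of_real (pkern u) * f (x + y * u) \<partial>lborel)"

text \<open>
  Where |t - z| is bounded away from 0 it is comparable to 1 + |t|, so that the Cauchy
  kernel is dominated by 1/(1 + |t|).
\<close>

lemma linear_growth:
  assumes "d > 0" "d \<le> cmod (of_real t - z)"
  shows "1 + \<bar>t\<bar> \<le> ((1 + cmod z) / d + 1) * cmod (of_real t - z)"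
proof -
  have "\<bar>t\<bar> = cmod (of_real t)" by simp
  also have "cmod (of_real t) \<le> cmod (of_real t - z) + cmod z"
    using norm_triangle_ineq[of "of_real t - z" z] by simp
  finally have "1 + \<bar>t\<bar> \<le> (1 + cmod z) * 1 + cmod (of_real t - z)" by simp
  also have "(1 + cmod z) * 1 \<le> (1 + cmod z) * (cmod (of_real t - z) / d)"
    using assms by (intro mult_left_mono) auto
  finally show ?thesis by (simp add: algebra_simps)
qed

lemma im_dist: "\<bar>Im z\<bar> \<le> cmod (of_real t - z)"
  using abs_Im_le_cmod[of "of_real t - z"] by simp

lemma cauchy_integrable:
  assumes "1 < p" "lp_fun p f" "d > 0" "\<And>t. f t \<noteq> 0 \<Longrightarrow> d \<le> cmod (of_real t - z)"
  shows "integrable lborel (\<lambda>t. f t / (of_real t - z))"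
proof (rule Bochner_Integration.integrable_bound)
  let ?C = "(1 + cmod z) / d + 1"
  show "integrable lborel (\<lambda>t. ?C * (norm (f t) / (1 + \<bar>t\<bar>)))"
    using lp_integrable_div[OF assms(1,2)] by (rule integrable_mult_right)
  have [measurable]: "f \<in> borel_measurable borel" using assms by (simp add: lp_fun_def)
  show "(\<lambda>t. f t / (of_real t - z)) \<in> borel_measurable lborel" by simp
  show "AE t in lborel. norm (f t / (of_real t - z)) \<le> norm (?C * (norm (f t) / (1 + \<bar>t\<bar>)))"
  proof (intro AE_I2)
    fix t
    have C: "?C \<ge> 0" using assms(3) by (simp add: add_nonneg_nonneg)
    show "norm (f t / (of_real t - z)) \<le> norm (?C * (norm (f t) / (1 + \<bar>t\<bar>)))"
    proof (cases "f t = 0")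
      case False
      from assms(4)[OF this] assms(3) have pos: "cmod (of_real t - z) > 0" by linarith
      have "(1 + \<bar>t\<bar>) \<le> ?C * cmod (of_real t - z)"
        using linear_growth[OF assms(3) assms(4)[OF False]] .
      then have "1 / cmod (of_real t - z) \<le> ?C / (1 + \<bar>t\<bar>)"
        using pos by (simp add: field_simps)
      then have "norm (f t) * (1 / cmod (of_real t - z)) \<le> norm (f t) * (?C / (1 + \<bar>t\<bar>))"
        by (intro mult_left_mono) auto
      then show ?thesis using C by (simp add: norm_divide norm_mult abs_mult field_simps)
    qed simp
  qed
qed

lemma cauchy_integrable_im:
  assumes "1 < p" "lp_fun p f" "Im z \<noteq> 0"
  shows "integrable lborel (\<lambda>t. f t / (of_real t - z))"
  using assms im_dist by (intro cauchy_integrable[where d = "\<bar>Im z\<bar>"]) auto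

text \<open>
  The difference quotients converge by dominated convergence, since the kernel is bounded
  near every point that has positive distance from the support.
\<close>

lemma cauchy_holomorphic:
  assumes p: "1 < p" and f: "lp_fun p f" and J: "closed J" "\<And>t. f t \<noteq> 0 \<Longrightarrow> t \<in> J"
  shows "cauchy f holomorphic_on - (of_real ` J)"
proof -
  have clo: "closed (complex_of_real ` J)"
    using J(1) by (intro closed_injective_linear_image) (auto simp: bounded_linear.linear bounded_linear_of_real inj_on_def)
  have [measurable]: "f \<in> borel_measurable borel" using f by (simp add: lp_fun_def)
  show ?thesis
  proof (cases "J = {}")
    case True
    then have "f = (\<lambda>_. 0)" using J(2) by auto
    then have "cauchy f = (\<lambda>_. 0)" by (simp add: cauchy_def fun_eq_iff)
    then show ?thesis by simp
  next
    case ne: False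
    show ?thesis
    proof (rule holomorphic_onI)
      fix z0 assume z0: "z0 \<in> - (complex_of_real ` J)"
      define d where "d = infdist z0 (complex_of_real ` J) / 2"
      have d: "d > 0" using z0 clo ne infdist_pos_not_in_closed[of "of_real ` J" z0] by (auto simp: d_def)
      have dist0: "2 * d \<le> cmod (of_real t - z0)" if "f t \<noteq> 0" for t
        using infdist_le[of "of_real t" "of_real ` J" z0] J(2)[OF that]
        by (simp add: d_def dist_norm norm_minus_commute)
      have dist1: "d \<le> cmod (of_real t - z)" if "f t \<noteq> 0" "z \<in> ball z0 d" for t z
      proof -
        have "cmod (of_real t - z0) \<le> cmod (of_real t - z) + cmod (z - z0)"
          using norm_triangle_ineq[of "of_real t - z" "z - z0"] by simp
        then show ?thesis using dist0[OF that(1)] that(2) by (simp add: dist_norm norm_minus_commute)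
      qed
      let ?D = "\<lambda>z. \<integral>t. f t / ((of_real t - z) * (of_real t - z0)) \<partial>lborel"
      let ?c = "1 / (2 * of_real pi * \<i>)"
      have int0: "integrable lborel (\<lambda>t. f t / (of_real t - z))" if "z \<in> ball z0 d" for z
        using p f d dist1[OF _ that] by (rule cauchy_integrable)
      have quot: "(cauchy f z - cauchy f z0) / (z - z0) = ?c * ?D z" if "z \<in> ball z0 d" "z \<noteq> z0" for z
      proof -
        have "cauchy f z - cauchy f z0 = ?c * (\<integral>t. f t / (of_real t - z) - f t / (of_real t - z0) \<partial>lborel)"
          unfolding cauchy_def using int0[OF that(1)] int0[of z0] d
          by (subst Bochner_Integration.integral_diff) (auto simp: algebra_simps)
        also have "(\<integral>t. f t / (of_real t - z) - f t / (of_real t - z0) \<partial>lborel) =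
            (\<integral>t. (z - z0) * (f t / ((of_real t - z) * (of_real t - z0))) \<partial>lborel)"
        proof (intro Bochner_Integration.integral_cong refl)
          fix t
          show "f t / (of_real t - z) - f t / (of_real t - z0) = (z - z0) * (f t / ((of_real t - z) * (of_real t - z0)))"
          proof (cases "f t = 0")
            case False
            have "of_real t - z \<noteq> 0" "of_real t - z0 \<noteq> 0"
              using dist0[OF False] dist1[OF False that(1)] d by auto
            then show ?thesis by (simp add: field_simps)
          qed simp
        qed
        also have "\<dots> = (z - z0) * ?D z" by (rule integral_mult_right_zero)
        finally show ?thesis using that by simp
      qed
      have "(?D \<longlongrightarrow> ?D z0) (at z0)"
      proof (unfold tendsto_at_iff_sequentially, intro allI impI)
        fix X :: "nat \<Rightarrow> complex" assume X: "\<forall>i. X i \<in> UNIV - {z0}" "X \<longlonglongrightarrow> z0"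
        have "eventually (\<lambda>n. X n \<in> ball z0 d) sequentially"
          using X(2) d by (simp add: tendsto_iff dist_commute)
        then obtain n0 where n0: "\<And>n. n \<ge> n0 \<Longrightarrow> X n \<in> ball z0 d"
          by (auto simp: eventually_sequentially)
        have "(\<lambda>n. ?D (X (n + n0))) \<longlonglongrightarrow> ?D z0"
        proof (rule integral_dominated_convergence[where w = "\<lambda>t. norm (f t / (of_real t - z0)) / d"])
          show "integrable lborel (\<lambda>t. norm (f t / (of_real t - z0)) / d)"
            using int0[of z0] d by (intro integrable_divide integrable_norm) auto
          show "AE t in lborel. (\<lambda>n. f t / ((of_real t - X (n + n0)) * (of_real t - z0))) \<longlonglongrightarrow> f t / ((of_real t - z0) * (of_real t - z0))"
          proof (intro AE_I2)
            fix t
            have Xn: "(\<lambda>n. X (n + n0)) \<longlonglongrightarrow> z0" using X(2) by (rule LIMSEQ_ignore_initial_segment)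
            show "(\<lambda>n. f t / ((of_real t - X (n + n0)) * (of_real t - z0))) \<longlonglongrightarrow> f t / ((of_real t - z0) * (of_real t - z0))"
            proof (cases "f t = 0")
              case False
              have "of_real t - z0 \<noteq> 0" using dist0[OF False] d by auto
              then show ?thesis by (intro tendsto_intros Xn) auto
            qed simp
          qed
          show "AE t in lborel. norm (f t / ((of_real t - X (n + n0)) * (of_real t - z0))) \<le> norm (f t / (of_real t - z0)) / d" for n
          proof (intro AE_I2)
            fix t
            show "norm (f t / ((of_real t - X (n + n0)) * (of_real t - z0))) \<le> norm (f t / (of_real t - z0)) / d"
            proof (cases "f t = 0")
              case False
              have "d \<le> cmod (of_real t - X (n + n0))" using dist1[OF False n0] by simp
              then have "norm (f t / (of_real t - z0)) / cmod (of_real t - X (n + n0)) \<le> norm (f t / (of_real t - z0)) / d"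
                using d by (intro divide_left_mono mult_pos_pos) auto
              then show ?thesis by (simp add: norm_divide norm_mult mult.commute)
            qed simp
          qed
        qed measurable
        then show "((\<lambda>z. ?D z) \<circ> X) \<longlonglongrightarrow> ?D z0"
          by (auto simp: o_def dest: LIMSEQ_offset)
      qed
      then have "((\<lambda>z. ?c * ?D z) \<longlongrightarrow> ?c * ?D z0) (at z0)" by (intro tendsto_intros)
      moreover have "eventually (\<lambda>z. ?c * ?D z = (cauchy f z - cauchy f z0) / (z - z0)) (at z0)"
        using eventually_at_ball[OF d, of z0 UNIV] quot
        by (auto simp: eventually_at_filter elim!: eventually_mono)
      ultimately have "((\<lambda>z. (cauchy f z - cauchy f z0) / (z - z0)) \<longlongrightarrow> ?c * ?D z0) (at z0)"
        by (rule Lim_transform_eventually)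
      then have "(cauchy f has_field_derivative ?c * ?D z0) (at z0)"
        by (simp add: has_field_derivative_iff)
      then show "cauchy f field_differentiable at z0 within - (complex_of_real ` J)"
        using field_differentiable_at_within field_differentiable_def by blast
    qed
  qed
qed

lemma cauchy_isCont_nonreal:
  assumes "1 < p" "lp_fun p f" "Im z \<noteq> 0"
  shows "isCont (cauchy f) z"
proof -
  have hol: "cauchy f holomorphic_on - (of_real ` UNIV)" using assms by (intro cauchy_holomorphic) auto
  have "closed (complex_of_real ` UNIV)"
    by (intro closed_injective_linear_image) (auto simp: bounded_linear.linear bounded_linear_of_real inj_on_def)
  moreover have "z \<in> - (of_real ` UNIV)" using assms by auto
  ultimately show ?thesis
    using holomorphic_on_imp_continuous_on[OF hol] by (simp add: continuous_on_eq_continuous_at open_Compl)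
qed

text \<open>
  Reflection in the real axis, which transfers results from the upper to the lower
  half-plane.
\<close>

lemma cauchy_cnj: "cnj (cauchy f z) = - cauchy (\<lambda>t. cnj (f t)) (cnj z)"
proof -
  have "cnj (cauchy f z) = - (1 / (2 * of_real pi * \<i>)) * cnj (\<integral>t. f t / (of_real t - z) \<partial>lborel)"
    by (simp add: cauchy_def)
  also have "cnj (\<integral>t. f t / (of_real t - z) \<partial>lborel) = (\<integral>t. cnj (f t) / (of_real t - cnj z) \<partial>lborel)"
    by (subst Bochner_Integration.integral_cnj[symmetric]) simp
  finally show ?thesis by (simp add: cauchy_def)
qed

text \<open>
  Substitute t = x + y u. The kernel becomes the Poisson kernel plus -i times its conjugate
  u pkern(u), and the point z has moved into the argument of f; the formula serves for
  horizontal lines (y fixed) and for vertical lines (x fixed) alike.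
\<close>

lemma cauchy_scaled:
  assumes "y \<noteq> 0"
  shows "cauchy f (Complex x y) =
    of_real (sgn y / 2) * (\<integral>u. of_real (pkern u) * (1 - \<i> * of_real u) * f (x + y * u) \<partial>lborel)"
proof -
  let ?z = "Complex x y"
  have "(\<integral>t. f t / (of_real t - ?z) \<partial>lborel) = \<bar>y\<bar> *\<^sub>R (\<integral>u. f (x + y * u) / (of_real (x + y * u) - ?z) \<partial>lborel)"
    by (rule lborel_integral_real_affine[OF assms])
  also have "\<dots> = (\<integral>u. of_real \<bar>y\<bar> * (f (x + y * u) / (of_real (x + y * u) - ?z)) \<partial>lborel)"
    by (simp only: scaleR_conv_of_real integral_mult_right_zero)
  finally have "cauchy f ?z = (\<integral>u. 1 / (2 * of_real pi * \<i>) * (of_real \<bar>y\<bar> * (f (x + y * u) / (of_real (x + y * u) - ?z))) \<partial>lborel)"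
    unfolding cauchy_def by (simp only: integral_mult_right_zero)
  also have "\<dots> = (\<integral>u. of_real (sgn y / 2) * (of_real (pkern u) * (1 - \<i> * of_real u) * f (x + y * u)) \<partial>lborel)"
  proof (intro Bochner_Integration.integral_cong refl)
    fix u
    have 1: "of_real (x + y * u) - ?z = of_real y * (of_real u - \<i>)"
      by (simp add: complex_eq_iff)
    have 2: "of_real \<bar>y\<bar> = complex_of_real (sgn y) * of_real y"
      by (simp add: abs_sgn[of y] flip: of_real_mult)
    have ne: "complex_of_real u - \<i> \<noteq> 0" "1 + (complex_of_real u)\<^sup>2 \<noteq> 0"
    proof -
      show "complex_of_real u - \<i> \<noteq> 0" by (simp add: complex_eq_iff)
      have "1 + u\<^sup>2 > 0" by (simp add: add_pos_nonneg)
      then have "1 + u\<^sup>2 \<noteq> 0" by simp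
      then have "complex_of_real (1 + u\<^sup>2) \<noteq> 0" by (simp only: of_real_eq_0_iff not_False_eq_True)
      then show "1 + (complex_of_real u)\<^sup>2 \<noteq> 0" by simp
    qed
    have 3: "1 / (complex_of_real u - \<i>) = \<i> * (1 - \<i> * of_real u) / (1 + (of_real u)\<^sup>2)"
      using ne by (simp add: field_simps power2_eq_square)
    have "1 / (2 * of_real pi * \<i>) * (of_real \<bar>y\<bar> * (f (x + y * u) / (of_real (x + y * u) - ?z)))
      = of_real (sgn y) * f (x + y * u) * (1 / (2 * of_real pi * \<i>)) * (1 / (complex_of_real u - \<i>))"
    proof -
      have "c * ((s * y') * (F / (y' * v))) = s * F * c * (1 / v)" if "y' \<noteq> 0" for c s y' F v :: complex
        using that by simp
      then show ?thesis unfolding 1 2 using assms by simp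
    qed
    also have "\<dots> = of_real (sgn y / 2) * (of_real (pkern u) * (1 - \<i> * of_real u) * f (x + y * u))"
    proof -
      have "s * F * (1 / (2 * P * \<i>)) * (\<i> * V / U) = s / 2 * (1 / (P * U) * V * F)" if "P \<noteq> 0" "U \<noteq> 0" for s F P V U :: complex
        using that by (simp add: field_simps)
      from this[of "of_real pi" "1 + (of_real u)\<^sup>2"] ne show ?thesis unfolding 3 pkern_def
        by (simp only: of_real_mult of_real_divide of_real_1 of_real_add of_real_power of_real_numeral of_real_eq_0_iff pi_neq_zero not_False_eq_True simp_thms)
    qed
    finally show "1 / (2 * of_real pi * \<i>) * (of_real \<bar>y\<bar> * (f (x + y * u) / (of_real (x + y * u) - ?z)))
      = of_real (sgn y / 2) * (of_real (pkern u) * (1 - \<i> * of_real u) * f (x + y * u))" .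
  qed
  also have "\<dots> = of_real (sgn y / 2) * (\<integral>u. of_real (pkern u) * (1 - \<i> * of_real u) * f (x + y * u) \<partial>lborel)"
    by (rule integral_mult_right_zero)
  finally show ?thesis .
qed

lemma pkern_eq_sqrt: "pkern u = 1 / (pi * (sqrt (1 + u\<^sup>2) * sqrt (1 + u\<^sup>2)))"
  by (simp add: pkern_def)

lemma pkern_factor_norm: "cmod (of_real (pkern u) * (1 - \<i> * of_real u)) = 1 / (pi * sqrt (1 + u\<^sup>2))"
proof -
  have s: "sqrt (1 + u\<^sup>2) > 0" by (simp add: add_pos_nonneg)
  have "cmod (1 - \<i> * of_real u) = sqrt (1 + u\<^sup>2)" by (simp add: cmod_def)
  then have "cmod (of_real (pkern u) * (1 - \<i> * of_real u)) = pkern u * sqrt (1 + u\<^sup>2)"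
    using pkern_pos[of u] by (simp add: norm_mult)
  also have "\<dots> = 1 / (pi * sqrt (1 + u\<^sup>2))"
  proof -
    have "1 / (pi * (s * s)) * s = 1 / (pi * s)" if "s > 0" for s :: real
      using that by (simp add: field_simps)
    from this[OF s] show ?thesis unfolding pkern_eq_sqrt .
  qed
  finally show ?thesis .
qed

lemma cauchy_scaled_integrable:
  assumes "1 < p" "lp_fun p f" "y \<noteq> 0"
  shows "integrable lborel (\<lambda>u. of_real (pkern u) * (1 - \<i> * of_real u) * f (x + y * u))"
proof -
  have [measurable]: "f \<in> borel_measurable borel" using assms by (simp add: lp_fun_def)
  have "lp_fun p (\<lambda>u. f (x + y * u))" using assms by (intro lp_fun_affine) auto
  then have "integrable lborel (\<lambda>u. f (x + y * u) / (of_real u - \<i>))"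
    using assms by (intro cauchy_integrable_im) auto
  from integrable_norm[OF this] have *: "integrable lborel (\<lambda>u. norm (f (x + y * u) / (of_real u - \<i>)))" .
  show ?thesis
  proof (rule Bochner_Integration.integrable_bound[OF *])
    show "AE u in lborel. norm (of_real (pkern u) * (1 - \<i> * of_real u) * f (x + y * u)) \<le> norm (norm (f (x + y * u) / (of_real u - \<i>)))"
    proof (intro AE_I2)
      fix u
      have s: "sqrt (1 + u\<^sup>2) > 0" by (simp add: add_pos_nonneg)
      have "1 / (pi * sqrt (1 + u\<^sup>2)) \<le> 1 / (1 * sqrt (1 + u\<^sup>2))"
        using s pi_gt3 by (intro divide_left_mono mult_right_mono mult_pos_pos) auto
      then have "norm (f (x + y * u)) * (1 / (pi * sqrt (1 + u\<^sup>2))) \<le> norm (f (x + y * u)) * (1 / (1 * sqrt (1 + u\<^sup>2)))"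
        by (intro mult_left_mono) auto
      moreover have "cmod (of_real u - \<i>) = sqrt (1 + u\<^sup>2)" by (simp add: cmod_def add.commute)
      ultimately show "norm (of_real (pkern u) * (1 - \<i> * of_real u) * f (x + y * u)) \<le> norm (norm (f (x + y * u) / (of_real u - \<i>)))"
        by (subst norm_mult, subst pkern_factor_norm) (simp add: norm_divide mult.commute)
    qed
  qed measurable
qed

lemma poisson_integrable:
  assumes "1 < p" "lp_fun p f" "y \<noteq> 0"
  shows "integrable lborel (\<lambda>u. of_real (pkern u) * f (x + y * u))"
proof -
  have [measurable]: "f \<in> borel_measurable borel" using assms by (simp add: lp_fun_def)
  show ?thesis
  proof (rule Bochner_Integration.integrable_bound[OF cauchy_scaled_integrable[OF assms, of x]])
    show "AE u in lborel. norm (of_real (pkern u) * f (x + y * u)) \<le> norm (of_real (pkern u) * (1 - \<i> * of_real u) * f (x + y * u))"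
    proof (intro AE_I2)
      fix u
      have "1 \<le> cmod (1 - \<i> * of_real u)" by (simp add: cmod_def)
      then have "cmod (of_real (pkern u) * f (x + y * u)) * 1 \<le> cmod (of_real (pkern u) * f (x + y * u)) * cmod (1 - \<i> * of_real u)"
        by (intro mult_left_mono) auto
      then show "norm (of_real (pkern u) * f (x + y * u)) \<le> norm (of_real (pkern u) * (1 - \<i> * of_real u) * f (x + y * u))"
        by (simp add: norm_mult mult_ac)
    qed
  qed measurable
qed

text \<open>
  Between conjugate points the conjugate kernels cancel and the Poisson kernels add.
\<close>

lemma cauchy_jump:
  assumes "1 < p" "lp_fun p f" "y > 0"
  shows "cauchy f (Complex x y) - cauchy f (Complex x (- y)) = poisson y f x"
proof -
  let ?g = "\<lambda>s u. of_real (pkern u) * (1 - \<i> * of_real u) * f (x + s * u)"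
  have "(\<integral>u. ?g (-y) u \<partial>lborel) = (\<integral>u. ?g (-y) (0 + (-1) * u) \<partial>lborel)"
    using lborel_integral_real_affine[of "-1" "?g (-y)" 0] by simp
  then have "cauchy f (Complex x (-y)) = - 1/2 * (\<integral>u. of_real (pkern u) * (1 + \<i> * of_real u) * f (x + y * u) \<partial>lborel)"
    using assms cauchy_scaled[of "-y" f x] by (simp add: pkern_def)
  moreover have "cauchy f (Complex x y) = 1/2 * (\<integral>u. ?g y u \<partial>lborel)"
    using assms cauchy_scaled[of y f x] by simp
  moreover have "integrable lborel (\<lambda>u. of_real (pkern u) * (1 + \<i> * of_real u) * f (x + y * u))"
  proof -
    have "integrable lborel (\<lambda>u. ?g (-y) (0 + (-1) * u))"
      using assms by (intro lborel_integrable_real_affine cauchy_scaled_integrable) auto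
    then show ?thesis by (simp add: pkern_def)
  qed
  ultimately have "cauchy f (Complex x y) - cauchy f (Complex x (- y)) =
    1/2 * (\<integral>u. ?g y u + of_real (pkern u) * (1 + \<i> * of_real u) * f (x + y * u) \<partial>lborel)"
    using cauchy_scaled_integrable[of p f y x] assms by (subst Bochner_Integration.integral_add) (auto simp: algebra_simps)
  also have "\<dots> = 1/2 * (\<integral>u. 2 * (of_real (pkern u) * f (x + y * u)) \<partial>lborel)"
    by (simp add: algebra_simps)
  also have "\<dots> = poisson y f x" by (simp add: poisson_def)
  finally show ?thesis .
qed

lemma poisson_contraction:
  assumes "1 < p" "lp_fun p f"
  shows "lp_mass p (poisson y f) \<le> lp_mass p f"
proof -
  have [measurable]: "f \<in> borel_measurable borel" using assms by (simp add: lp_fun_def)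
  have "lp_mass p (\<lambda>x. \<integral>u. of_real (pkern u) * f (x + y * u) \<partial>lborel) \<le> ennreal ((\<integral>u. pkern u \<partial>lborel) powr p) * lp_mass p f"
  proof (rule minkowski_powr)
    fix u
    show "lp_mass p (\<lambda>x. f (x + y * u)) \<le> lp_mass p f"
      using lp_mass_affine[of f 1 p "y * u"] by (simp add: add.commute)
  qed (use assms pkern_pos integrable_pkern in \<open>auto intro: less_imp_le\<close>)
  then show ?thesis using integral_pkern by (simp add: poisson_def[abs_def])
qed

lemma poisson_measurable [measurable]:
  assumes [measurable]: "f \<in> borel_measurable borel"
  shows "poisson y f \<in> borel_measurable borel"
  unfolding poisson_def[abs_def] by measurable

lemma poisson_lp_fun: "1 < p \<Longrightarrow> lp_fun p f \<Longrightarrow> lp_fun p (poisson y f)"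
  using poisson_contraction[of p f y] by (auto simp: lp_fun_def)

text \<open>
  Near 0 the condition a < 1 makes the weight integrable, and at infinity it decays like
  |u|^(-1-a).
\<close>

lemma integrable_perp_weight:
  fixes a :: real
  assumes "0 < a" "a < 1"
  shows "integrable lborel (\<lambda>u. \<bar>u\<bar> powr (-a) / sqrt (1 + u\<^sup>2))"
proof -
  let ?g = "\<lambda>u. u powr (-a) / sqrt (1 + u\<^sup>2)"
  have "integrable lborel (\<lambda>u. ?g \<bar>u\<bar>)"
  proof (rule integrable_abs_half_line[of ?g])
    have bound: "ennreal (?g t) * indicator {0..} t \<le>
        ennreal (t powr (-a)) * indicator {0..1} t
        + ennreal (2 powr (1 + a)) * (ennreal ((1 + \<bar>t\<bar>) powr (-(1 + a))) * indicator {0..} t)" for t :: real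
    proof (cases "t \<le> 1")
      case True
      have "sqrt (1 + t\<^sup>2) \<ge> 1" by simp
      then have "t powr (-a) / sqrt (1 + t\<^sup>2) \<le> t powr (-a) / 1"
        by (intro divide_left_mono) (auto simp: add_pos_nonneg)
      then have "ennreal (?g t) \<le> ennreal (t powr (-a))" by (intro ennreal_leI) simp
      then show ?thesis using True by (auto simp: indicator_def intro: add_increasing2)
    next
      case False
      then have t: "t > 1" by simp
      have "t \<le> sqrt (1 + t\<^sup>2)" by (rule real_le_rsqrt) simp
      then have "t powr (-a) / sqrt (1 + t\<^sup>2) \<le> t powr (-a) / t"
        using t by (intro divide_left_mono mult_pos_pos) (auto simp: add_pos_nonneg)
      also have "\<dots> = t powr (- (1 + a))"
      proof -
        have "t powr (- (1 + a)) = t powr (- a - 1)" by (rule arg_cong[where f = "\<lambda>x. t powr x"]) linarith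
        also have "\<dots> = t powr (-a) / t powr 1" by (rule powr_diff)
        finally show ?thesis using t by simp
      qed
      also have "\<dots> \<le> ((1 + t) / 2) powr (- (1 + a))"
        using t assms by (intro powr_mono2') auto
      also have "\<dots> = 2 powr (1 + a) * (1 + t) powr (- (1 + a))"
      proof -
        have "((1 + t) / 2) powr (- b) = 2 powr b * (1 + t) powr (- b)" for b
          using t powr_divide[of "1 + t" 2 "-b"] by (simp add: powr_minus_divide)
        then show ?thesis .
      qed
      finally have "ennreal (?g t) \<le> ennreal (2 powr (1 + a) * (1 + t) powr (- (1 + a)))"
        by (intro ennreal_leI)
      then show ?thesis using t by (simp add: ennreal_mult'')
    qed
    have 1: "(\<integral>\<^sup>+t. ennreal (t powr (-a)) * indicator {0..1} t \<partial>lborel) < \<infinity>"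
      using nn_integral_has_integral_lebesgue'[OF _ has_integral_powr_from_0[of "-a" 1]] assms by simp
    have 2: "(\<integral>\<^sup>+t. ennreal ((1 + \<bar>t\<bar>) powr (-(1 + a))) * indicator {0..} t \<partial>lborel) < \<infinity>"
      using assms by (intro nn_integral_decay) auto
    have "(\<integral>\<^sup>+t. ennreal (?g t) * indicator {0..} t \<partial>lborel) \<le>
      (\<integral>\<^sup>+t. (ennreal (t powr (-a)) * indicator {0..1} t
        + ennreal (2 powr (1 + a)) * (ennreal ((1 + \<bar>t\<bar>) powr (-(1 + a))) * indicator {0..} t)) \<partial>lborel)"
      by (intro nn_integral_mono bound)
    also have "\<dots> = (\<integral>\<^sup>+t. ennreal (t powr (-a)) * indicator {0..1} t \<partial>lborel)
        + ennreal (2 powr (1 + a)) * (\<integral>\<^sup>+t. ennreal ((1 + \<bar>t\<bar>) powr (-(1 + a))) * indicator {0..} t \<partial>lborel)"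
      by (subst nn_integral_add; simp add: nn_integral_cmult)
    also have "\<dots> < \<infinity>" using 1 2 by (simp add: ennreal_mult_less_top)
    finally show "(\<integral>\<^sup>+t. ennreal (?g t) * indicator {0..} t \<partial>lborel) < \<infinity>" .
  qed auto
  then show ?thesis by simp
qed

text \<open>
  On a vertical line the function y \<mapsto> f(x + y u) has 1/|u| times the p-th power mass
  of f, and the scaled Cauchy kernel has modulus 1/(pi sqrt(1 + u^2)). Minkowski's
  inequality applies with the weight |u|^(-1/p)/sqrt(1 + u^2); the remaining factor
  |u|^(1/p) compensates the dilation.
\<close>

lemma cauchy_perp_bound:
  assumes p: "1 < p"
  shows "\<exists>A\<ge>0. \<forall>f x. lp_fun p f \<longrightarrow> lp_mass p (\<lambda>y. cauchy f (Complex x y)) \<le> ennreal A * lp_mass p f"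
proof -
  define w where "w = (\<lambda>u::real. \<bar>u\<bar> powr (-(1/p)) / sqrt (1 + u\<^sup>2))"
  have [measurable]: "w \<in> borel_measurable borel" unfolding w_def by measurable
  have w0: "w u \<ge> 0" for u by (simp add: w_def)
  have iw: "integrable lborel w" unfolding w_def using p by (intro integrable_perp_weight) auto
  show ?thesis
  proof (intro exI[of _ "(\<integral>u. w u \<partial>lborel) powr p"] conjI allI impI)
    fix f x assume f: "lp_fun p f"
    then have [measurable]: "f \<in> borel_measurable borel" by (simp add: lp_fun_def)
    define G where "G = (\<lambda>y u. of_real (sgn y / (2 * pi) * \<bar>u\<bar> powr (1/p)) * ((1 - \<i> * of_real u) / of_real (sqrt (1 + u\<^sup>2))) * f (x + y * u))"
    have cmG: "cmod (G y u) \<le> cmod (of_real (\<bar>u\<bar> powr (1/p)) * f (x + u * y))" for y u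
    proof -
      have "cmod (1 - \<i> * of_real u) = sqrt (1 + u\<^sup>2)" by (simp add: cmod_def)
      moreover have "sqrt (1 + u\<^sup>2) > 0" by (simp add: add_pos_nonneg)
      ultimately have 1: "cmod ((1 - \<i> * of_real u) / of_real (sqrt (1 + u\<^sup>2))) = 1"
        by (simp add: norm_divide)
      have "cmod (of_real (sgn y / (2 * pi))) \<le> 1"
        using pi_gt3 by (auto simp: sgn_if norm_divide)
      then have "cmod (of_real (sgn y / (2 * pi))) * (\<bar>u\<bar> powr (1/p) * cmod (f (x + y * u))) \<le> 1 * (\<bar>u\<bar> powr (1/p) * cmod (f (x + y * u)))"
        by (intro mult_right_mono) auto
      then show ?thesis unfolding G_def norm_mult 1 by (simp add: norm_mult norm_divide mult_ac)
    qed
    have eq: "cauchy f (Complex x y) = (\<integral>u. of_real (w u) * G y u \<partial>lborel)" if "y \<noteq> 0" for y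
    proof -
      have "cauchy f (Complex x y) = (\<integral>u. of_real (sgn y / 2) * (of_real (pkern u) * (1 - \<i> * of_real u) * f (x + y * u)) \<partial>lborel)"
        by (simp only: cauchy_scaled[OF that, of f x] integral_mult_right_zero)
      also have "\<dots> = (\<integral>u. of_real (w u) * G y u \<partial>lborel)"
      proof (rule integral_cong_AE)
        have "AE u in lborel. u \<noteq> (0::real)" by (rule AE_lborel_singleton)
        then show "AE u in lborel. of_real (sgn y / 2) * (of_real (pkern u) * (1 - \<i> * of_real u) * f (x + y * u)) = of_real (w u) * G y u"
        proof (eventually_elim)
          case (elim u)
          have "\<bar>u\<bar> powr (-(1/p)) * \<bar>u\<bar> powr (1/p) = 1" using elim by (simp flip: powr_add)
          moreover have "sqrt (1 + u\<^sup>2) > 0" by (simp add: add_pos_nonneg)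
          moreover have "1 / (pi * (s * s)) = b / s * a / pi / s" if "b * a = 1" "s > 0" for a b s :: real
            using that by (simp add: field_simps)
          ultimately have k: "pkern u = (\<bar>u\<bar> powr (-(1/p)) / sqrt (1 + u\<^sup>2)) * (\<bar>u\<bar> powr (1/p)) / pi / sqrt (1 + u\<^sup>2)"
            unfolding pkern_eq_sqrt by blast
          show ?case unfolding w_def G_def k
            by (simp only: of_real_mult of_real_divide) (simp add: field_simps)
        qed
      qed (unfold G_def, measurable)
      finally show ?thesis .
    qed
    have "lp_mass p (\<lambda>y. cauchy f (Complex x y)) = lp_mass p (\<lambda>y. \<integral>u. of_real (w u) * G y u \<partial>lborel)"
      unfolding lp_mass_def
    proof (rule nn_integral_cong_AE)
      have "AE y in lborel. y \<noteq> (0::real)" by (rule AE_lborel_singleton)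
      then show "AE y in lborel. ennreal (cmod (cauchy f (Complex x y)) powr p) = ennreal (cmod (\<integral>u. of_real (w u) * G y u \<partial>lborel) powr p)"
        by eventually_elim (simp add: eq)
    qed
    also have "\<dots> \<le> ennreal ((\<integral>u. w u \<partial>lborel) powr p) * lp_mass p f"
    proof (rule minkowski_powr[OF p _ w0 iw])
      show "(\<lambda>(y, u). G y u) \<in> borel_measurable (borel \<Otimes>\<^sub>M borel)"
        unfolding G_def by measurable
      fix u assume "w u \<noteq> 0"
      then have u: "u \<noteq> 0" by (auto simp: w_def)
      have "lp_mass p (\<lambda>y. G y u) \<le> lp_mass p (\<lambda>y. of_real (\<bar>u\<bar> powr (1/p)) * f (x + u * y))"
        using p by (intro lp_mass_mono cmG) auto
      also have "\<dots> = (\<integral>\<^sup>+y. ennreal \<bar>u\<bar> * ennreal (norm (f (x + u * y)) powr p) \<partial>lborel)"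
        unfolding lp_mass_def using p u
        by (intro nn_integral_cong) (simp add: norm_mult powr_mult powr_powr flip: ennreal_mult'')
      also have "\<dots> = ennreal \<bar>u\<bar> * lp_mass p (\<lambda>y. f (x + u * y))"
        unfolding lp_mass_def by (intro nn_integral_cmult) simp
      also have "\<dots> = lp_mass p f"
        using u by (subst lp_mass_affine) (simp_all flip: mult.assoc ennreal_mult'')
      finally show "lp_mass p (\<lambda>y. G y u) \<le> lp_mass p f" .
    qed simp
    finally show "lp_mass p (\<lambda>y. cauchy f (Complex x y)) \<le> ennreal ((\<integral>u. w u \<partial>lborel) powr p) * lp_mass p f" .
  qed simp
qed

section \<open>Poisson means of Cauchy integrals\<close>

text \<open>
  Cauchy's theorem on the upper half-disc of radius R: the arc has length pi R, and on it
  the integrand is at most K/R^a.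
\<close>

lemma semicircle_vanishing:
  fixes G :: "complex \<Rightarrow> complex"
  assumes c: "c > 0" and hol: "G holomorphic_on {z. Im z > - c}" and a: "a > 1"
    and bnd: "\<And>z. 0 \<le> Im z \<Longrightarrow> r \<le> cmod z \<Longrightarrow> cmod (G z) \<le> K / cmod z powr a"
  shows "((\<lambda>R. integral {-R..R} (\<lambda>x. G (of_real x))) \<longlongrightarrow> 0) at_top"
proof (rule Lim_null_comparison)
  have "((\<lambda>R. K * pi * R powr (1 - a)) \<longlongrightarrow> K * pi * 0) at_top"
    using a by (intro tendsto_intros tendsto_neg_powr filterlim_ident) auto
  then show "((\<lambda>R. K * pi * R powr (1 - a)) \<longlongrightarrow> 0) at_top" by simp
  show "eventually (\<lambda>R. norm (integral {-R..R} (\<lambda>x. G (of_real x))) \<le> K * pi * R powr (1 - a)) at_top"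
    using eventually_ge_at_top[of "max r 1"]
  proof eventually_elim
    case (elim R)
    then have R: "R \<ge> r" "R \<ge> 1" by auto
    define l where "l = linepath (complex_of_real (-R)) (complex_of_real R)"
    define g where "g = part_circlepath 0 R 0 pi"
    have on_g: "cmod w = R \<and> Im w \<ge> 0" if "w \<in> path_image g" for w
    proof -
      from that obtain x where x: "0 \<le> x" "x \<le> pi" "w = of_real R * exp (\<i> * of_real x)"
        using R by (auto simp: g_def path_image_part_circlepath)
      have "Im w = R * sin x" "cmod w = R" using R by (simp_all add: x(3) norm_mult Im_exp)
      then show ?thesis using x R sin_ge_zero by auto
    qed
    have on_l: "Im w = 0" if "w \<in> path_image l" for w
      using that by (auto simp: l_def closed_segment_def)
    let ?S = "{z. Im z > - c}"
    have ends: "pathstart l = of_real (-R)" "pathfinish l = of_real R" "pathstart g = of_real R" "pathfinish g = of_real (-R)"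
      by (simp_all add: l_def g_def exp_pi_i)
    have vl: "valid_path l" and vg: "valid_path g" by (simp_all add: l_def g_def)
    have sub: "path_image l \<subseteq> ?S" "path_image g \<subseteq> ?S" using on_l on_g c by (force simp: subset_iff)+
    have "(G has_contour_integral 0) (l +++ g)"
    proof (rule Cauchy_theorem_convex_simple[OF hol])
      show "convex ?S" by (rule convex_halfspace_Im_gt)
      show "path_image (l +++ g) \<subseteq> ?S" using sub ends by (subst path_image_join) auto
    qed (use vl vg ends in \<open>auto intro!: valid_path_join\<close>)
    moreover have open_S: "open ?S" by (rule open_halfspace_Im_gt)
    have il: "G contour_integrable_on l" and ig: "G contour_integrable_on g"
      using contour_integrable_holomorphic_simple[OF hol open_S] vl vg sub by auto
    ultimately have "contour_integral l G + contour_integral g G = 0"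
      using contour_integral_join[OF il ig vl vg] contour_integral_unique by metis
    then have "norm (contour_integral l G) = norm (contour_integral g G)"
      by (metis add.inverse_inverse add_eq_0_iff norm_minus_cancel)
    moreover have "contour_integral l G = integral {-R..R} (\<lambda>x. G (of_real x))"
      unfolding l_def using R contour_integral_linepath_Reals_eq[of "of_real (-R)" "of_real R" G] by simp
    moreover have "norm (contour_integral g G) \<le> (K / R powr a) * R * \<bar>pi - 0\<bar>"
      unfolding g_def
    proof (rule contour_integral_bound_part_circlepath)
      have "0 \<le> cmod (G (\<i> * of_real R))" by simp
      also have "\<dots> \<le> K / R powr a" using bnd[of "\<i> * of_real R"] R by (simp add: norm_mult)
      finally show "0 \<le> K / R powr a" .
      show "norm (G z) \<le> K / R powr a" if "z \<in> path_image (part_circlepath 0 R 0 pi)" for z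
        using bnd[of z] on_g[of z] that R by (simp add: g_def)
    qed (use R ig in \<open>auto simp: g_def\<close>)
    moreover have "(K / R powr a) * R * \<bar>pi - 0\<bar> = K * pi * R powr (1 - a)"
      using R by (simp add: powr_diff)
    ultimately show ?case by (simp only:)
  qed
qed

text \<open>
  Contour integrals over segments are gauge integrals, while the transforms are Lebesgue
  integrals over the whole line; dominated convergence links the two.
\<close>

lemma integral_eq_symmetric_limit:
  fixes g :: "real \<Rightarrow> complex"
  assumes g: "integrable lborel g" and lim: "((\<lambda>R. integral {-R..R} g) \<longlongrightarrow> L) at_top"
  shows "(\<integral>x. g x \<partial>lborel) = L"
proof -
  have "((\<lambda>R. \<integral>x. indicator {-R..R} x *\<^sub>R g x \<partial>lborel) \<longlongrightarrow> (\<integral>x. g x \<partial>lborel)) at_top"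
  proof (rule integral_dominated_convergence_at_top[where w = "\<lambda>x. norm (g x)"])
    show "AE x in lborel. ((\<lambda>R. indicator {-R..R} x *\<^sub>R g x) \<longlongrightarrow> g x) at_top"
    proof (intro AE_I2 tendsto_eventually)
      fix x :: real
      show "eventually (\<lambda>R. indicator {-R..R} x *\<^sub>R g x = g x) at_top"
        using eventually_ge_at_top[of "\<bar>x\<bar>"] by eventually_elim (auto simp: indicator_def)
    qed
    show "eventually (\<lambda>R. AE x in lborel. norm (indicator {-R..R} x *\<^sub>R g x) \<le> norm (g x)) at_top"
      by (intro always_eventually allI AE_I2) (auto simp: indicator_def)
  qed (use g in auto)
  moreover have "(\<integral>x. indicator {-R..R} x *\<^sub>R g x \<partial>lborel) = integral {-R..R} g" for R :: real
  proof -
    have "set_integrable lborel {-R..R} g" unfolding set_integrable_def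
      using g by (intro integrable_mult_indicator) auto
    from set_borel_integral_eq_integral(2)[OF this] show ?thesis by (simp add: set_lebesgue_integral_def)
  qed
  ultimately show ?thesis using lim tendsto_unique[OF trivial_limit_at_top_linorder] by auto
qed

lemma pkern_factor: "complex_of_real (pkern u) * (of_real u - \<i>) = 1 / (of_real pi * (of_real u + \<i>))"
proof -
  have ne: "complex_of_real u + \<i> \<noteq> 0" "complex_of_real u - \<i> \<noteq> 0" by (auto simp: complex_eq_iff)
  have "complex_of_real (1 + u\<^sup>2) = (of_real u + \<i>) * (of_real u - \<i>)"
    by (simp add: algebra_simps power2_eq_square)
  then have "complex_of_real (pkern u) = 1 / (of_real pi * ((of_real u + \<i>) * (of_real u - \<i>)))"
    unfolding pkern_def by simp
  then show ?thesis using ne by simp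
qed

text \<open>
  The function z \<mapsto> 1/(w - d z) is holomorphic and bounded in the upper half-plane,
  and its Poisson integral must be its value at i. After subtraction of this value the pole
  of the Poisson kernel at i cancels, and the remaining function decays like |z|^(-2), so
  that its integral over the real axis vanishes.
\<close>

lemma poisson_cauchy_kernel:
  assumes w: "Im w < 0" and d: "d > 0"
  shows "integrable lborel (\<lambda>u. of_real (pkern u) / (w - of_real (d * u)))"
    and "(\<integral>u. of_real (pkern u) / (w - of_real (d * u)) \<partial>lborel) = 1 / (w - \<i> * of_real d)"
proof -
  have far: "- Im w \<le> cmod (w - of_real (d * u))" for u
    using abs_Im_le_cmod[of "w - of_real (d * u)"] w by simp
  show int: "integrable lborel (\<lambda>u. of_real (pkern u) / (w - of_real (d * u)))"
  proof (rule Bochner_Integration.integrable_bound)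
    show "integrable lborel (\<lambda>u. pkern u / (- Im w))" using integrable_pkern by simp
    show "AE u in lborel. norm (complex_of_real (pkern u) / (w - of_real (d * u))) \<le> norm (pkern u / (- Im w))"
    proof (intro AE_I2)
      fix u
      have "pkern u / cmod (w - of_real (d * u)) \<le> pkern u / (- Im w)"
        using far[of u] w pkern_pos[of u] by (intro divide_left_mono mult_pos_pos) auto
      then show "norm (complex_of_real (pkern u) / (w - of_real (d * u))) \<le> norm (pkern u / (- Im w))"
        using w pkern_pos[of u] by (simp add: norm_divide abs_divide)
    qed
  qed measurable
  let ?G = "\<lambda>z. 1 / ((z + \<i>) * (w - of_real d * z))"
  define c where "c = min 1 (- Im w / d)"
  have wd: "cmod (w - \<i> * of_real d) > 0"
  proof -
    have "\<bar>Im w - d\<bar> \<le> cmod (w - \<i> * of_real d)"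
      using abs_Im_le_cmod[of "w - \<i> * of_real d"] by simp
    then show ?thesis using w d by linarith
  qed
  then have wd0: "w - \<i> * of_real d \<noteq> 0" by auto
  have key: "of_real (pkern u) / (w - of_real (d * u)) - of_real (pkern u) * (1 / (w - \<i> * of_real d))
      = of_real d / (of_real pi * (w - \<i> * of_real d)) * ?G (of_real u)" for u
  proof -
    have ne: "w - of_real d * of_real u \<noteq> 0" using far[of u] w by (auto simp: complex_eq_iff)
    have ne': "complex_of_real u + \<i> \<noteq> 0" by (auto simp: complex_eq_iff)
    have "1 / (w - of_real d * of_real u) - 1 / (w - \<i> * of_real d) =
       of_real d * (of_real u - \<i>) / ((w - of_real d * of_real u) * (w - \<i> * of_real d))"
      using ne wd0 by (simp add: diff_frac_eq algebra_simps)
    then have "of_real (pkern u) * (1 / (w - of_real d * of_real u) - 1 / (w - \<i> * of_real d)) =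
       of_real d * (of_real (pkern u) * (of_real u - \<i>)) / ((w - of_real d * of_real u) * (w - \<i> * of_real d))"
      by (simp add: mult_ac)
    then show ?thesis unfolding pkern_factor by (simp add: algebra_simps)
  qed
  have intd: "integrable lborel (\<lambda>u. of_real (pkern u) / (w - of_real (d * u)) - of_real (pkern u) * (1 / (w - \<i> * of_real d)))"
    using int integrable_pkern by (intro Bochner_Integration.integrable_diff integrable_mult_left) auto
  have dpi: "of_real d / (of_real pi * (w - \<i> * of_real d)) \<noteq> 0" using d wd0 by simp
  have intG: "integrable lborel (\<lambda>u. ?G (of_real u))"
  proof -
    let ?a = "of_real d / (of_real pi * (w - \<i> * of_real d))"
    have "integrable lborel (\<lambda>u. inverse ?a * (?a * ?G (of_real u)))"
      using intd unfolding key by (rule integrable_mult_right)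
    moreover have "inverse ?a * (?a * v) = v" for v
      by (simp only: mult.assoc[symmetric] left_inverse[OF dpi] mult_1)
    ultimately show ?thesis by (simp only:)
  qed
  have "((\<lambda>R. integral {-R..R} (\<lambda>x. ?G (of_real x))) \<longlongrightarrow> 0) at_top"
  proof (rule semicircle_vanishing[where c = c and a = 2 and K = "2 / d" and r = "max 1 (2 * cmod w / d)"])
    show "c > 0" using divide_neg_pos[OF w d] by (simp add: c_def)
    have nz: "z + \<i> \<noteq> 0 \<and> w - of_real d * z \<noteq> 0" if "Im z > - c" for z
    proof -
      have "c \<le> 1" "c \<le> - Im w / d" by (simp_all add: c_def)
      then have "Im z > -1" "Im w / d < Im z" using that by simp_all
      then have "Im z > -1" "d * Im z > Im w" using d by (simp_all add: field_simps)
      then show ?thesis by (auto simp: complex_eq_iff)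
    qed
    show "?G holomorphic_on {z. - c < Im z}"
      using nz by (intro holomorphic_intros) auto
    fix z assume z: "0 \<le> Im z" "max 1 (2 * cmod w / d) \<le> cmod z"
    have z0: "cmod z > 0" using z(2) by linarith
    have 1: "cmod z \<le> cmod (z + \<i>)"
      using z by (simp add: cmod_def power2_eq_square algebra_simps)
    have "2 * cmod w \<le> d * cmod z" using z(2) d by (simp add: field_simps)
    then have 2: "d * cmod z / 2 \<le> cmod (w - of_real d * z)"
      using norm_triangle_ineq2[of "of_real d * z" w] d by (simp add: norm_mult norm_minus_commute)
    have le12: "cmod z * (d * cmod z / 2) \<le> cmod (z + \<i>) * cmod (w - of_real d * z)"
      using 1 2 z0 d by (intro mult_mono) auto
    have "1 / (cmod (z + \<i>) * cmod (w - of_real d * z)) \<le> 1 / (cmod z * (d * cmod z / 2))"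
    proof -
      have "0 < cmod (z + \<i>)" "0 < cmod (w - of_real d * z)"
        using 1 2 z0 mult_pos_pos[OF d z0] by linarith+
      then show ?thesis using z0 d le12 by (intro divide_left_mono mult_pos_pos) auto
    qed
    also have "\<dots> = 2 / d / cmod z powr 2" using z0 by (simp add: power2_eq_square mult_ac)
    finally show "cmod (?G z) \<le> 2 / d / cmod z powr 2" by (simp add: norm_divide norm_mult)
  qed auto
  then have G0: "(\<integral>u. ?G (of_real u) \<partial>lborel) = 0"
    by (rule integral_eq_symmetric_limit[OF intG])
  have "(\<integral>u. of_real (pkern u) / (w - of_real (d * u)) - of_real (pkern u) * (1 / (w - \<i> * of_real d)) \<partial>lborel) = 0"
    unfolding key using G0 by (simp only: integral_mult_right_zero mult_zero_right)
  moreover have "(\<integral>u. of_real (pkern u) * (1 / (w - \<i> * of_real d)) \<partial>lborel) = 1 / (w - \<i> * of_real d)"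
    using integral_pkern by (simp only: integral_mult_left_zero integral_complex_of_real) simp
  ultimately show "(\<integral>u. of_real (pkern u) / (w - of_real (d * u)) \<partial>lborel) = 1 / (w - \<i> * of_real d)"
    using int integrable_pkern by (subst (asm) Bochner_Integration.integral_diff) (auto intro!: integrable_divide)
qed

lemma lp_mass_cmult: "f \<in> borel_measurable borel \<Longrightarrow> lp_mass p (\<lambda>x. c * f x) = ennreal (cmod c powr p) * lp_mass p f"
  unfolding lp_mass_def by (simp add: norm_mult powr_mult ennreal_mult'' nn_integral_cmult)

lemma lp_fun_cmult: "lp_fun p f \<Longrightarrow> lp_fun p (\<lambda>x. c * f x)"
  by (auto simp: lp_fun_def lp_mass_cmult ennreal_mult_less_top)

lemma lp_fun_cauchy_kernel:
  assumes "1 < q" "Im z \<noteq> 0"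
  shows "lp_fun q (\<lambda>s. 1 / (of_real s - z))"
proof (rule lp_fun_bound)
  let ?C = "(1 + cmod z) / \<bar>Im z\<bar> + 1"
  show "lp_fun q (\<lambda>t. of_real ?C * of_real (1 / (1 + \<bar>t\<bar>)))"
    using assms by (intro lp_fun_cmult lp_fun_decay)
  fix s
  have C: "?C \<ge> 0" by (simp add: add_nonneg_nonneg)
  have pos: "cmod (of_real s - z) > 0" using im_dist[of z s] assms by linarith
  have "1 + \<bar>s\<bar> \<le> ?C * cmod (of_real s - z)"
    using assms im_dist[of z s] by (intro linear_growth) auto
  then have "1 / cmod (of_real s - z) \<le> ?C / (1 + \<bar>s\<bar>)" using pos by (simp add: field_simps)
  also have "\<dots> = norm (complex_of_real ?C * of_real (1 / (1 + \<bar>s\<bar>)))"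
    unfolding norm_mult norm_of_real using C by (simp only: abs_of_nonneg abs_divide) simp
  finally show "norm (1 / (of_real s - z)) \<le> norm (complex_of_real ?C * of_real (1 / (1 + \<bar>s\<bar>)))"
    by (simp add: norm_divide)
qed (use assms in auto)

text \<open>
  Young's inequality: along a horizontal line the kernel only gets translated, which leaves
  its norm in the dual exponent unchanged. The uniform bound is what makes Fubini's theorem
  applicable to iterated Cauchy and Poisson integrals.
\<close>

lemma cauchy_abs_bound:
  assumes p: "1 < p" and f: "lp_fun p f" and y: "y \<noteq> 0"
  shows "\<exists>B. \<forall>x. (\<integral>t. norm (f t / (of_real t - Complex x y)) \<partial>lborel) \<le> B"
proof -
  let ?q = "p / (p - 1)"
  have q: "?q > 1" using p by (simp add: field_simps)
  let ?k = "\<lambda>s. 1 / (complex_of_real s - \<i> * of_real y)"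
  have k: "lp_fun ?q ?k" using q y by (intro lp_fun_cauchy_kernel) auto
  have eq: "of_real t - Complex x y = of_real (- x + 1 * t) - \<i> * of_real y" for t x
    by (simp add: complex_eq_iff)
  show ?thesis
  proof (intro exI allI)
    fix x
    have ik: "integrable lborel (\<lambda>t. norm (?k (-x + 1 * t)) powr ?q)"
      using lp_integrable[OF lp_fun_affine[OF k, of 1 "-x"]] by simp
    have "(\<integral>t. norm (f t / (of_real t - Complex x y)) \<partial>lborel) \<le>
      (\<integral>t. norm (f t) powr p / p + norm (?k (-x + 1 * t)) powr ?q / ?q \<partial>lborel)"
    proof (rule integral_mono)
      show "integrable lborel (\<lambda>t. norm (f t / (of_real t - Complex x y)))"
        using p f y by (intro integrable_norm cauchy_integrable_im) auto
      show "integrable lborel (\<lambda>t. norm (f t) powr p / p + norm (?k (-x + 1 * t)) powr ?q / ?q)"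
        using lp_integrable[OF f] ik by (intro Bochner_Integration.integrable_add integrable_divide)
      fix t
      have "norm (f t) * norm (?k (-x + 1 * t)) \<le> norm (f t) powr p / p + norm (?k (-x + 1 * t)) powr ?q / ?q"
        using p q by (intro Youngs_inequality) (auto simp: field_simps)
      then show "norm (f t / (of_real t - Complex x y)) \<le> norm (f t) powr p / p + norm (?k (-x + 1 * t)) powr ?q / ?q"
        unfolding eq by (simp add: norm_divide)
    qed
    also have "\<dots> = (\<integral>t. norm (f t) powr p / p \<partial>lborel) + (\<integral>t. norm (?k (-x + 1 * t)) powr ?q / ?q \<partial>lborel)"
      using lp_integrable[OF f] ik by (intro Bochner_Integration.integral_add integrable_divide)
    also have "(\<integral>t. norm (?k (-x + 1 * t)) powr ?q / ?q \<partial>lborel) = (\<integral>t. norm (?k t) powr ?q / ?q \<partial>lborel)"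
      using lborel_integral_real_affine[of 1 "\<lambda>t. norm (?k t) powr ?q / ?q" "-x", symmetric] by simp
    finally show "(\<integral>t. norm (f t / (of_real t - Complex x y)) \<partial>lborel) \<le>
      (\<integral>t. norm (f t) powr p / p \<partial>lborel) + (\<integral>t. norm (?k t) powr ?q / ?q \<partial>lborel)" .
  qed
qed

lemma cauchy_measurable_line:
  assumes [measurable]: "f \<in> borel_measurable borel"
  shows "(\<lambda>x. cauchy f (Complex x y)) \<in> borel_measurable borel"
    and "(\<lambda>y. cauchy f (Complex x y)) \<in> borel_measurable borel"
proof -
  have eq: "Complex x y = of_real x + \<i> * of_real y" for x y by (simp add: complex_eq_iff)
  show "(\<lambda>x. cauchy f (Complex x y)) \<in> borel_measurable borel"
    unfolding cauchy_def eq by measurable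
  show "(\<lambda>y. cauchy f (Complex x y)) \<in> borel_measurable borel"
    unfolding cauchy_def eq by measurable
qed

text \<open>
  Averaging with the Poisson kernel at height d raises the point by d, whether the average
  is taken of the Cauchy integral or of its density. Both identities are Fubini's theorem
  and the kernel identity \<open>poisson_cauchy_kernel\<close>.
\<close>

lemma cauchy_average:
  assumes p: "1 < p" and f: "lp_fun p f" and y: "y > 0" and d: "d > 0"
  shows "(\<integral>u. of_real (pkern u) * cauchy f (Complex (x + d * u) y) \<partial>lborel) = cauchy f (Complex x (y + d))"
    and "cauchy (poisson d f) (Complex x y) = cauchy f (Complex x (y + d))"
proof -
  have [measurable]: "f \<in> borel_measurable borel" using f by (simp add: lp_fun_def)
  obtain B where B: "\<And>x. (\<integral>t. norm (f t / (of_real t - Complex x y)) \<partial>lborel) \<le> B"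
    using cauchy_abs_bound[OF p f, of y] y by auto
  let ?c = "1 / (2 * of_real pi * \<i>)"
  let ?h = "\<lambda>u t. of_real (pkern u) * (f t / (of_real t - Complex (x + d * u) y))"
  let ?h' = "\<lambda>u t. of_real (pkern u) * f (t + d * u) / (of_real t - Complex x y)"
  have Ceq: "Complex (x + d * u) y = of_real x + of_real d * of_real u + \<i> * of_real y" for u by (simp add: complex_eq_iff)
  have int1: "integrable lborel (\<lambda>t. f t / (of_real t - Complex x y))" for x
    using p f y by (intro cauchy_integrable_im) auto
  have cm: "(\<lambda>u. pkern u * (\<integral>t. norm (f t / (of_real t - Complex (x + d * u) y)) \<partial>lborel)) \<in> borel_measurable borel"
    unfolding Ceq by measurable
  have intB: "integrable lborel (\<lambda>u. pkern u * (\<integral>t. norm (f t / (of_real t - Complex (x + d * u) y)) \<partial>lborel))"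
  proof (rule Bochner_Integration.integrable_bound)
    show "integrable lborel (\<lambda>u. pkern u * B)" using integrable_pkern by simp
    show "AE u in lborel. norm (pkern u * (\<integral>t. norm (f t / (of_real t - Complex (x + d * u) y)) \<partial>lborel)) \<le> norm (pkern u * B)"
    proof (intro AE_I2)
      fix u
      have "0 \<le> (\<integral>t. norm (f t / (of_real t - Complex (x + d * u) y)) \<partial>lborel)" by simp
      then show "norm (pkern u * (\<integral>t. norm (f t / (of_real t - Complex (x + d * u) y)) \<partial>lborel)) \<le> norm (pkern u * B)"
        using B[of "x + d * u"] pkern_pos[of u] by (simp add: abs_mult mult_left_mono)
    qed
  qed (use cm in simp)
  have I1: "integrable (lborel \<Otimes>\<^sub>M lborel) (case_prod ?h)"
  proof (rule lborel_pair.Fubini_integrable)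
    show "case_prod ?h \<in> borel_measurable (lborel \<Otimes>\<^sub>M lborel)" unfolding Ceq by measurable
    have "(\<integral>t. norm (case_prod ?h (u, t)) \<partial>lborel) = pkern u * (\<integral>t. norm (f t / (of_real t - Complex (x + d * u) y)) \<partial>lborel)" for u
      unfolding prod.case norm_mult norm_of_real using pkern_pos[of u] by (simp only: integral_mult_right_zero abs_of_pos)
    then show "integrable lborel (\<lambda>u. \<integral>t. norm (case_prod ?h (u, t)) \<partial>lborel)"
      using intB by (simp only:)
    show "AE u in lborel. integrable lborel (\<lambda>t. case_prod ?h (u, t))"
      by (simp del: times_divide_eq_right) (intro AE_I2 integrable_mult_right int1)
  qed
  have "(\<integral>u. of_real (pkern u) * cauchy f (Complex (x + d * u) y) \<partial>lborel) = (\<integral>u. ?c * (\<integral>t. ?h u t \<partial>lborel) \<partial>lborel)"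
    unfolding cauchy_def
    by (intro Bochner_Integration.integral_cong refl) (simp only: integral_mult_right_zero mult.left_commute)
  also have "\<dots> = ?c * (\<integral>u. (\<integral>t. ?h u t \<partial>lborel) \<partial>lborel)" by (rule integral_mult_right_zero)
  also have "(\<integral>u. (\<integral>t. ?h u t \<partial>lborel) \<partial>lborel) = (\<integral>t. (\<integral>u. ?h u t \<partial>lborel) \<partial>lborel)"
    by (rule lborel_pair.Fubini_integral[symmetric, OF I1])
  also have "\<dots> = (\<integral>t. f t / (of_real t - Complex x (y + d)) \<partial>lborel)"
  proof (intro Bochner_Integration.integral_cong refl)
    fix t
    have "?h u t = f t * (of_real (pkern u) / ((of_real t - Complex x y) - of_real (d * u)))" for u
    proof -
      have "of_real t - Complex (x + d * u) y = (of_real t - Complex x y) - of_real (d * u)"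
        by (simp add: complex_eq_iff)
      then show ?thesis by (simp only:) (simp add: mult.commute)
    qed
    then have "(\<integral>u. ?h u t \<partial>lborel) = f t * (1 / (of_real t - Complex x y - \<i> * of_real d))"
      using poisson_cauchy_kernel(2)[of "of_real t - Complex x y" d] y d
      by (simp only: integral_mult_right_zero) simp
    also have "of_real t - Complex x y - \<i> * of_real d = of_real t - Complex x (y + d)"
      by (simp add: complex_eq_iff)
    finally show "(\<integral>u. ?h u t \<partial>lborel) = f t / (of_real t - Complex x (y + d))" by simp
  qed
  finally show one: "(\<integral>u. of_real (pkern u) * cauchy f (Complex (x + d * u) y) \<partial>lborel) = cauchy f (Complex x (y + d))"
    by (simp add: cauchy_def)
  have eq: "of_real (d * u + t) - Complex (x + d * u) y = of_real t - Complex x y" for t u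
    by (simp add: complex_eq_iff)
  \<comment> \<open>translation moves the shift by d u from the density to the point\<close>
  have sh: "(\<integral>t. norm (f (t + d * u) / (of_real t - Complex x y)) \<partial>lborel) = (\<integral>t. norm (f t / (of_real t - Complex (x + d * u) y)) \<partial>lborel)" for u
    using lborel_integral_real_affine[of 1 "\<lambda>t. norm (f t / (of_real t - Complex (x + d * u) y))" "d * u"]
    by (simp only: abs_one scaleR_one mult_1 eq) (simp only: add.commute)
  have sh': "(\<integral>t. f (t + d * u) / (of_real t - Complex x y) \<partial>lborel) = (\<integral>t. f t / (of_real t - Complex (x + d * u) y) \<partial>lborel)" for u
    using lborel_integral_real_affine[of 1 "\<lambda>t. f t / (of_real t - Complex (x + d * u) y)" "d * u"]
    by (simp only: abs_one scaleR_one mult_1 eq) (simp only: add.commute)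
  have int2: "integrable lborel (\<lambda>t. f (t + d * u) / (of_real t - Complex x y))" for u
    using p y lp_fun_affine[OF f, of 1 "d * u"] by (intro cauchy_integrable_im[of p]) (auto simp: add.commute)
  have I2: "integrable (lborel \<Otimes>\<^sub>M lborel) (case_prod ?h')"
  proof (rule lborel_pair.Fubini_integrable)
    show "case_prod ?h' \<in> borel_measurable (lborel \<Otimes>\<^sub>M lborel)" by measurable
    have "(\<lambda>u. \<integral>t. norm (case_prod ?h' (u, t)) \<partial>lborel) = (\<lambda>u. pkern u * (\<integral>t. norm (f t / (of_real t - Complex (x + d * u) y)) \<partial>lborel))"
    proof
      fix u
      have "(\<integral>t. norm (case_prod ?h' (u, t)) \<partial>lborel) = (\<integral>t. pkern u * norm (f (t + d * u) / (of_real t - Complex x y)) \<partial>lborel)"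
        using pkern_pos[of u] by (simp add: norm_mult norm_divide)
      also have "\<dots> = pkern u * (\<integral>t. norm (f (t + d * u) / (of_real t - Complex x y)) \<partial>lborel)"
        by (rule integral_mult_right_zero)
      finally show "(\<integral>t. norm (case_prod ?h' (u, t)) \<partial>lborel) = pkern u * (\<integral>t. norm (f t / (of_real t - Complex (x + d * u) y)) \<partial>lborel)"
        by (simp only: sh)
    qed
    then show "integrable lborel (\<lambda>u. \<integral>t. norm (case_prod ?h' (u, t)) \<partial>lborel)"
      using intB by simp
    show "AE u in lborel. integrable lborel (\<lambda>t. case_prod ?h' (u, t))"
      using integrable_mult_right[OF int2] by simp
  qed
  have "cauchy (poisson d f) (Complex x y) = ?c * (\<integral>t. (\<integral>u. of_real (pkern u) * f (t + d * u) \<partial>lborel) / (of_real t - Complex x y) \<partial>lborel)"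
    by (simp add: cauchy_def poisson_def)
  also have "(\<integral>t. (\<integral>u. of_real (pkern u) * f (t + d * u) \<partial>lborel) / (of_real t - Complex x y) \<partial>lborel) = (\<integral>t. (\<integral>u. ?h' u t \<partial>lborel) \<partial>lborel)"
    by simp
  also have "\<dots> = (\<integral>u. (\<integral>t. ?h' u t \<partial>lborel) \<partial>lborel)"
    by (rule lborel_pair.Fubini_integral[OF I2])
  also have "\<dots> = (\<integral>u. of_real (pkern u) * (\<integral>t. f t / (of_real t - Complex (x + d * u) y) \<partial>lborel) \<partial>lborel)"
    by (simp only: sh'[symmetric] integral_mult_right_zero[symmetric] times_divide_eq_right)
  finally have "cauchy (poisson d f) (Complex x y) = (\<integral>u. ?c * (of_real (pkern u) * (\<integral>t. f t / (of_real t - Complex (x + d * u) y) \<partial>lborel)) \<partial>lborel)"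
    by (simp only: integral_mult_right_zero)
  also have "\<dots> = (\<integral>u. of_real (pkern u) * cauchy f (Complex (x + d * u) y) \<partial>lborel)"
    unfolding cauchy_def
    by (intro Bochner_Integration.integral_cong refl) (simp only: mult.left_commute)
  finally show "cauchy (poisson d f) (Complex x y) = cauchy f (Complex x (y + d))" using one by simp
qed

section \<open>The theorem of Marcel Riesz\<close>

text \<open>
  In polar coordinates the claim is 1 \<le> A cos(t)^p - B cos(p t) for |t| < pi/2. Since
  pi/2 < p pi/2 \<le> pi, cos(p t) is negative near the two ends, where the second term
  suffices; on the rest of the interval cos t is bounded below and the first term suffices.
\<close>

lemma right_half_plane_inequality:
  fixes p :: real
  assumes p: "1 < p" "p \<le> 2"
  shows "\<exists>A\<ge>0. \<exists>B\<ge>0. \<forall>z. 0 < Re z \<longrightarrow>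
    cmod z powr p \<le> A * Re z powr p - B * Re (z powr of_real p)"
proof -
  \<comment> \<open>midway between the zero pi/(2 p) of cos(p t) and the end point pi/2\<close>
  define \<theta>0 where "\<theta>0 = (pi / (2 * p) + pi / 2) / 2"
  have t0: "pi / (2 * p) < \<theta>0" "\<theta>0 < pi / 2" "\<theta>0 > 0"
    using p pi_gt_zero by (auto simp: \<theta>0_def field_simps add_pos_pos)
  have pt0: "pi / 2 < p * \<theta>0" using t0(1) p by (simp add: field_simps)
  have pt1: "p * (pi / 2) \<le> pi" using p mult_right_mono[of p 2 "pi / 2"] by simp
  have pt2: "p * \<theta>0 \<le> pi" using mult_left_mono[of \<theta>0 "pi / 2" p] t0 p pt1 by linarith
  define c where "c = - cos (p * \<theta>0)"
  have c: "c > 0" using cos_monotone_0_pi[of "pi / 2" "p * \<theta>0"] pt0 pt2 pi_gt_zero by (simp add: c_def)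
  define e where "e = cos \<theta>0"
  have e: "e > 0" using t0 cos_gt_zero_pi[of \<theta>0] by (simp add: e_def)
  define B where "B = 1 / c"
  define A where "A = (1 + B) / e powr p"
  have B: "B \<ge> 0" using c by (simp add: B_def)
  have A: "A \<ge> 0" using B e by (simp add: A_def)
  have angle: "1 \<le> A * cos t powr p - B * cos (p * t)" if t: "\<bar>t\<bar> < pi / 2" for t
  proof -
    have even: "cos t = cos \<bar>t\<bar>" "cos (p * t) = cos (p * \<bar>t\<bar>)"
      by (auto simp: abs_if)
    have c0: "cos t > 0" using t by (intro cos_gt_zero_pi) auto
    show ?thesis
    proof (cases "\<theta>0 \<le> \<bar>t\<bar>")
      case True
      have "p * \<bar>t\<bar> \<le> pi" using mult_left_mono[of "\<bar>t\<bar>" "pi / 2" p] t p pt1 by linarith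
      moreover have "p * \<theta>0 \<le> p * \<bar>t\<bar>" using True p by simp
      ultimately have "cos (p * \<bar>t\<bar>) \<le> - c"
        unfolding c_def using t0 p by (simp add: cos_monotone_0_pi_le)
      then have "B * cos (p * t) \<le> B * (- c)" unfolding even using B by (intro mult_left_mono)
      also have "\<dots> = -1" using c by (simp add: B_def)
      finally show ?thesis using A c0 by (smt (verit) mult_nonneg_nonneg powr_ge_zero)
    next
      case False
      then have "e \<le> cos t" unfolding even(1) e_def using t0 by (intro cos_monotone_0_pi_le) auto
      then have "e powr p \<le> cos t powr p" using e p by (intro powr_mono2) auto
      then have "A * e powr p \<le> A * cos t powr p" using A by (intro mult_left_mono)
      moreover have "A * e powr p = 1 + B" using e by (simp add: A_def)
      moreover have "B * cos (p * t) \<le> B * 1" using B by (intro mult_left_mono) auto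
      ultimately show ?thesis by linarith
    qed
  qed
  have "cmod z powr p \<le> A * Re z powr p - B * Re (z powr of_real p)" if z: "0 < Re z" for z
  proof -
    from z have z0: "z \<noteq> 0" by auto
    define t where "t = Im (Ln z)"
    have t: "\<bar>t\<bar> < pi / 2" using Re_Ln_pos_lt[OF z0] z by (simp add: t_def)
    have ReLn: "Re (Ln z) = ln (cmod z)" using z0 by simp
    have rz: "Re z = cmod z * cos t"
    proof -
      have "Re z = Re (exp (Ln z))" using z0 by simp
      also have "\<dots> = exp (Re (Ln z)) * cos t" by (simp only: Re_exp t_def)
      finally show ?thesis using z0 by (simp add: ReLn)
    qed
    have rp: "Re (z powr of_real p) = cmod z powr p * cos (p * t)"
      using z0 by (simp add: powr_def Re_exp ReLn t_def)
    have c0: "cos t > 0" using t by (intro cos_gt_zero_pi) auto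
    have "cmod z powr p * 1 \<le> cmod z powr p * (A * cos t powr p - B * cos (p * t))"
      by (intro mult_left_mono angle t) auto
    also have "\<dots> = A * (cmod z * cos t) powr p - B * (cmod z powr p * cos (p * t))"
      using c0 by (simp add: powr_mult algebra_simps)
    finally show "cmod z powr p \<le> A * Re z powr p - B * Re (z powr of_real p)"
      using rz rp by simp
  qed
  then show ?thesis using A B by blast
qed

lemma lp_mass_fatou:
  assumes p: "0 < p" and [measurable]: "\<And>n. g n \<in> borel_measurable borel"
    and lim: "AE x in lborel. (\<lambda>n. g n x) \<longlonglongrightarrow> h x"
  shows "lp_mass p h \<le> liminf (\<lambda>n. lp_mass p (g n))"
proof -
  have "lp_mass p h = (\<integral>\<^sup>+x. liminf (\<lambda>n. ennreal (norm (g n x) powr p)) \<partial>lborel)"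
    unfolding lp_mass_def
  proof (rule nn_integral_cong_AE)
    show "AE x in lborel. ennreal (norm (h x) powr p) = liminf (\<lambda>n. ennreal (norm (g n x) powr p))"
      using lim
    proof eventually_elim
      case (elim x)
      have "(\<lambda>n. norm (g n x) powr p) \<longlonglongrightarrow> norm (h x) powr p"
        by (rule tendsto_powr') (use elim p in \<open>auto intro: tendsto_norm\<close>)
      then have "(\<lambda>n. ennreal (norm (g n x) powr p)) \<longlonglongrightarrow> ennreal (norm (h x) powr p)"
        by (rule tendsto_ennrealI)
      then show ?case by (intro lim_imp_Liminf[symmetric]) auto
    qed
  qed
  also have "\<dots> \<le> liminf (\<lambda>n. lp_mass p (g n))"
    unfolding lp_mass_def by (intro nn_integral_liminf) auto
  finally show ?thesis .
qed

lemma lp_mass_fatou_bound: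
  assumes "0 < p" "\<And>n. g n \<in> borel_measurable borel"
    "AE x in lborel. (\<lambda>n. g n x) \<longlonglongrightarrow> h x" "\<And>n. lp_mass p (g n) \<le> C"
  shows "lp_mass p h \<le> C"
proof -
  have "liminf (\<lambda>n. lp_mass p (g n)) \<le> liminf (\<lambda>n::nat. C)"
    using assms(4) by (intro Liminf_mono always_eventually) auto
  also have "\<dots> = C" by (simp add: Liminf_const)
  finally show ?thesis using lp_mass_fatou[OF assms(1-3)] by (rule order.trans[rotated])
qed

lemma cauchy_cmult: "cauchy (\<lambda>t. c * f t) z = c * cauchy f z"
proof -
  have "(\<integral>t. c * f t / (of_real t - z) \<partial>lborel) = c * (\<integral>t. f t / (of_real t - z) \<partial>lborel)"
    by (simp only: times_divide_eq_right[symmetric] integral_mult_right_zero)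
  then show ?thesis by (simp add: cauchy_def)
qed

lemma cauchy_add:
  assumes "1 < p" "lp_fun p f" "lp_fun p g" "Im z \<noteq> 0"
  shows "cauchy (\<lambda>t. f t + g t) z = cauchy f z + cauchy g z"
  using cauchy_integrable_im[OF assms(1,2,4)] cauchy_integrable_im[OF assms(1,3,4)]
  by (simp add: cauchy_def add_divide_distrib distrib_left)

lemma powr_add_bound:
  fixes a b p :: real
  assumes "0 \<le> a" "0 \<le> b" "0 \<le> p"
  shows "(a + b) powr p \<le> 2 powr p * (a powr p + b powr p)"
proof -
  have "(a + b) powr p \<le> (2 * max a b) powr p" using assms by (intro powr_mono2) auto
  also have "\<dots> = 2 powr p * max a b powr p" using assms by (simp add: powr_mult)
  also have "\<dots> \<le> 2 powr p * (a powr p + b powr p)"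
    by (intro mult_left_mono) (auto simp: max_def)
  finally show ?thesis .
qed

lemma lp_mass_add:
  assumes [measurable]: "f \<in> borel_measurable borel" "g \<in> borel_measurable borel" and p: "0 \<le> p"
  shows "lp_mass p (\<lambda>x. f x + g x) \<le> ennreal (2 powr p) * (lp_mass p f + lp_mass p g)"
proof -
  have "lp_mass p (\<lambda>x. f x + g x) \<le> (\<integral>\<^sup>+x. ennreal (2 powr p) * (ennreal (norm (f x) powr p) + ennreal (norm (g x) powr p)) \<partial>lborel)"
    unfolding lp_mass_def
  proof (intro nn_integral_mono)
    fix x
    have "norm (f x + g x) powr p \<le> (norm (f x) + norm (g x)) powr p"
      using p by (intro powr_mono2 norm_triangle_ineq) auto
    also have "\<dots> \<le> 2 powr p * (norm (f x) powr p + norm (g x) powr p)"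
      using p by (intro powr_add_bound) auto
    finally show "ennreal (norm (f x + g x) powr p) \<le> ennreal (2 powr p) * (ennreal (norm (f x) powr p) + ennreal (norm (g x) powr p))"
      by (simp add: ennreal_leI flip: ennreal_plus ennreal_mult'')
  qed
  also have "\<dots> = ennreal (2 powr p) * (lp_mass p f + lp_mass p g)"
    unfolding lp_mass_def by (simp add: nn_integral_cmult nn_integral_add)
  finally show ?thesis .
qed

lemma lp_fun_add: "0 \<le> p \<Longrightarrow> lp_fun p f \<Longrightarrow> lp_fun p g \<Longrightarrow> lp_fun p (\<lambda>x. f x + g x)"
  using lp_mass_add[of f g p] by (auto simp: lp_fun_def ennreal_mult_less_top intro: le_less_trans)

lemma lp_fun_bounded_support:
  assumes [measurable]: "f \<in> borel_measurable borel" and b: "\<And>t. norm (f t) \<le> b" and s: "\<And>t. b' < \<bar>t\<bar> \<Longrightarrow> f t = 0"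
    and p: "0 < p"
  shows "lp_fun p f"
proof -
  have "lp_mass p f \<le> (\<integral>\<^sup>+x. ennreal (b powr p) * indicator {-b'..b'} x \<partial>lborel)"
    unfolding lp_mass_def
  proof (intro nn_integral_mono)
    fix x
    show "ennreal (norm (f x) powr p) \<le> ennreal (b powr p) * indicator {-b'..b'} x"
    proof (cases "\<bar>x\<bar> \<le> b'")
      case True
      have "norm (f x) powr p \<le> b powr p" using b p by (intro powr_mono2) auto
      then show ?thesis using True by (auto simp: indicator_def abs_le_iff intro: ennreal_leI)
    next
      case False
      then show ?thesis using s[of x] p by simp
    qed
  qed
  also have "\<dots> < \<infinity>" by (simp add: nn_integral_cmult emeasure_lborel_Icc_eq ennreal_mult_less_top)
  finally show ?thesis by (simp add: lp_fun_def)
qed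

lemma cauchy_continuous_line:
  assumes "1 < p" "lp_fun p f" "y \<noteq> 0"
  shows "continuous_on S (\<lambda>x. cauchy f (Complex x y))"
proof (intro continuous_at_imp_continuous_on ballI)
  fix x
  have "isCont (\<lambda>x. Complex x y) x" by (auto simp: Complex_eq intro!: continuous_intros)
  then show "isCont (\<lambda>x. cauchy f (Complex x y)) x"
    by (rule isCont_o2) (use assms in \<open>auto intro: cauchy_isCont_nonreal\<close>)
qed

text \<open>
  Exhausts the line by the intervals [-n, n]; the bounds on them may have an error that
  disappears only in the limit.
\<close>

lemma lp_mass_le_truncations:
  assumes p: "0 < p" and f [measurable]: "f \<in> borel_measurable borel"
    and b: "\<And>n::nat. (\<integral>\<^sup>+x. ennreal (norm (f x) powr p) * indicator {-real n..real n} x \<partial>lborel) \<le> b n"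
    and lim: "b \<longlonglongrightarrow> c"
  shows "lp_mass p f \<le> c"
proof -
  define h where "h = (\<lambda>n x. indicator {-real n..real n} x * f x)"
  have [measurable]: "h n \<in> borel_measurable borel" for n unfolding h_def by measurable
  have "lp_mass p f \<le> liminf (\<lambda>n. lp_mass p (h n))"
  proof (rule lp_mass_fatou)
    show "AE x in lborel. (\<lambda>n. h n x) \<longlonglongrightarrow> f x"
    proof (intro AE_I2 tendsto_eventually)
      fix x :: real
      obtain N :: nat where N: "\<bar>x\<bar> \<le> N" using real_arch_simple by blast
      show "eventually (\<lambda>n. h n x = f x) sequentially"
        using eventually_ge_at_top[of N]
      proof eventually_elim
        case (elim n)
        then have "\<bar>x\<bar> \<le> real n" using N by linarith
        then show ?case by (simp add: h_def abs_le_iff minus_le_iff)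
      qed
    qed
  qed (use p in auto)
  also have "\<dots> \<le> liminf b"
  proof (intro Liminf_mono always_eventually allI)
    fix n
    have "lp_mass p (h n) = (\<integral>\<^sup>+x. ennreal (norm (f x) powr p) * indicator {-real n..real n} x \<partial>lborel)"
      unfolding lp_mass_def h_def using p by (intro nn_integral_cong) (auto simp: indicator_def)
    then show "lp_mass p (h n) \<le> b n" using b by simp
  qed
  also have "\<dots> = c" using lim by (intro lim_imp_Liminf) auto
  finally show ?thesis .
qed

text \<open>
  The heart of the theorem of Riesz. The real part of F = 2 cauchy f is the Poisson integral
  of f \<ge> 0 and is therefore positive, unless f vanishes almost everywhere. So F^p is
  holomorphic, and its integral over [-R, R] tends to 0. Integration of the pointwise
  inequality leaves the p-th power of the Poisson integral, which is a contraction.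
\<close>

lemma riesz_bounded_positive:
  fixes g :: "real \<Rightarrow> real"
  assumes p: "1 < p" and A: "A \<ge> 0" and B: "B \<ge> 0"
    and ineq: "\<And>z. 0 < Re z \<Longrightarrow> cmod z powr p \<le> A * Re z powr p - B * Re (z powr of_real p)"
    and g [measurable]: "g \<in> borel_measurable borel" and g0: "\<And>t. 0 \<le> g t"
    and gb: "\<And>t. g t \<le> b" and gs: "\<And>t. b < \<bar>t\<bar> \<Longrightarrow> g t = 0" and y: "y > 0"
  shows "lp_mass p (\<lambda>x. 2 * cauchy (\<lambda>t. of_real (g t)) (Complex x y)) \<le> ennreal A * lp_mass p (\<lambda>t. of_real (g t))"
proof -
  define f where "f = (\<lambda>t. complex_of_real (g t))"
  have f: "lp_fun q f" if "0 < q" for q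
    unfolding f_def using g0 gb gs that by (intro lp_fun_bounded_support[where b = b and b' = b]) auto
  have fp: "lp_fun p f" using f p by simp
  define F where "F = (\<lambda>z. 2 * cauchy f z)"
  define U where "U = (\<lambda>x s. \<integral>u. pkern u * g (x + s * u) \<partial>lborel)"
  have poisson_U: "poisson s f x = of_real (U x s)" for x s
    unfolding poisson_def U_def f_def by (simp flip: of_real_mult)
  have ReF: "Re (F (Complex x s)) = U x s" if "s > 0" for x s
  proof -
    have "F (Complex x s) = (\<integral>u. of_real (pkern u) * (1 - \<i> * of_real u) * f (x + s * u) \<partial>lborel)"
    proof -
      have "cauchy f (Complex x s) = 1 / 2 * (\<integral>u. of_real (pkern u) * (1 - \<i> * of_real u) * f (x + s * u) \<partial>lborel)"
        using cauchy_scaled[of s f x] that by simp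
      then show ?thesis unfolding F_def by (simp only:) simp
    qed
    also have "Re \<dots> = (\<integral>u. Re (of_real (pkern u) * (1 - \<i> * of_real u) * f (x + s * u)) \<partial>lborel)"
      using cauchy_scaled_integrable[OF p fp, of s x] that by (intro integral_Re[symmetric]) auto
    also have "\<dots> = U x s" unfolding U_def f_def by simp
    finally show ?thesis .
  qed
  show ?thesis
  proof (cases "AE t in lborel. g t = 0")
    case True
    have "cauchy f z = 0" for z
    proof -
      have "(\<integral>t. f t / (of_real t - z) \<partial>lborel) = 0"
        using True by (intro integral_eq_zero_AE) (auto simp: f_def)
      then show ?thesis by (simp add: cauchy_def)
    qed
    then show ?thesis using p by (simp add: f_def[symmetric] lp_mass_def)
  next
    case False
    have Upos: "U x s > 0" if s: "s > 0" for x s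
    proof (rule ccontr)
      assume "\<not> U x s > 0"
      moreover have "U x s \<ge> 0" unfolding U_def using g0 pkern_pos by (intro integral_nonneg_AE) (auto simp: less_imp_le)
      ultimately have "U x s = 0" by simp
      moreover have "integrable lborel (\<lambda>u. pkern u * g (x + s * u))"
      proof -
        have "integrable lborel (\<lambda>u. complex_of_real (pkern u * g (x + s * u)))"
          using poisson_integrable[OF p fp, of s x] s by (simp add: f_def)
        then show ?thesis by (simp only: complex_of_real_integrable_eq)
      qed
      ultimately have "AE u in lborel. pkern u * g (x + s * u) = 0"
        unfolding U_def using g0 pkern_pos by (subst (asm) integral_nonneg_eq_0_iff_AE) (auto simp: less_imp_le)
      then have "AE u in lborel. g (x + s * u) = 0"
      proof eventually_elim
        case (elim u) then show ?case using pkern_pos[of u] by auto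
      qed
      then have "(\<integral>\<^sup>+u. ennreal (g (x + s * u)) \<partial>lborel) = 0"
        by (subst nn_integral_0_iff_AE) (auto simp: ennreal_eq_0_iff)
      then have "(\<integral>\<^sup>+u. ennreal (g u) \<partial>lborel) = 0"
        using nn_integral_real_affine[of "\<lambda>u. ennreal (g u)" s x] s by simp
      then have "AE u in lborel. g u = 0"
        using g0 by (subst (asm) nn_integral_0_iff_AE) (auto simp: ennreal_eq_0_iff intro: antisym elim!: eventually_mono)
      then show False using False by simp
    qed
    define I where "I = (\<integral>t. norm (f t) \<partial>lborel)"
    have If: "integrable lborel (\<lambda>t. norm (f t))"
      using lp_integrable[OF f[of 1]] by simp
    have I0: "I \<ge> 0" unfolding I_def by simp
    have b0: "b \<ge> 0" using g0[of 0] gb[of 0] by linarith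
    have Fbound: "cmod (F z) \<le> (2 * I / pi) / cmod z" if z: "Im z > 0" "2 * b + 1 \<le> cmod z" for z
    proof -
      have z0: "cmod z > 0" using z(2) b0 by linarith
      have "cmod (\<integral>t. f t / (of_real t - z) \<partial>lborel) \<le> (\<integral>t. norm (f t / (of_real t - z)) \<partial>lborel)"
        by (rule integral_norm_bound)
      also have "\<dots> \<le> (\<integral>t. (2 / cmod z) * norm (f t) \<partial>lborel)"
      proof (intro integral_mono)
        show "integrable lborel (\<lambda>t. norm (f t / (of_real t - z)))"
          using cauchy_integrable_im[OF p fp] z by (intro integrable_norm) auto
        show "integrable lborel (\<lambda>t. (2 / cmod z) * norm (f t))" using If by simp
        fix t
        show "norm (f t / (of_real t - z)) \<le> (2 / cmod z) * norm (f t)"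
        proof (cases "\<bar>t\<bar> \<le> b")
          case True
          have "cmod z \<le> cmod (of_real t - z) + \<bar>t\<bar>"
            using norm_triangle_ineq2[of z "of_real t"] by (simp add: norm_minus_commute)
          then have "cmod z / 2 \<le> cmod (of_real t - z)" using True z by linarith
          then have "norm (f t) / cmod (of_real t - z) \<le> norm (f t) / (cmod z / 2)"
            using z0 by (intro divide_left_mono mult_pos_pos) auto
          then show ?thesis by (simp add: norm_divide mult.commute)
        next
          case False
          then show ?thesis using gs[of t] by (simp add: f_def)
        qed
      qed
      also have "\<dots> = (2 / cmod z) * I" unfolding I_def by (rule integral_mult_right_zero)
      finally have "cmod (\<integral>t. f t / (of_real t - z) \<partial>lborel) / pi \<le> (2 / cmod z) * I / pi"
        by (intro divide_right_mono) auto
      moreover have "cmod (F z) = cmod (\<integral>t. f t / (of_real t - z) \<partial>lborel) / pi"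
        by (simp add: F_def cauchy_def norm_mult norm_divide)
      ultimately show ?thesis by (simp add: mult_ac)
    qed
    define G where "G = (\<lambda>z. F (z + \<i> * of_real y) powr of_real p)"
    have Fshift: "Re (F (z + \<i> * of_real y)) > 0" if "Im z > - y" for z
    proof -
      have "z + \<i> * of_real y = Complex (Re z) (Im z + y)" by (simp add: complex_eq_iff)
      then show ?thesis using ReF[of "Im z + y" "Re z"] Upos[of "Im z + y" "Re z"] that by simp
    qed
    have holG: "G holomorphic_on {z. Im z > - y}"
      unfolding G_def
    proof (intro holomorphic_intros)
      have "cauchy f holomorphic_on - (of_real ` UNIV)"
        using p fp by (intro cauchy_holomorphic) auto
      then have "cauchy f holomorphic_on (\<lambda>z. z + \<i> * of_real y) ` {z. Im z > - y}"
        by (rule holomorphic_on_subset) (auto simp: complex_eq_iff)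
      then have "(cauchy f \<circ> (\<lambda>z. z + \<i> * of_real y)) holomorphic_on {z. Im z > - y}"
        by (intro holomorphic_on_compose holomorphic_intros)
      then show "(\<lambda>z. F (z + \<i> * of_real y)) holomorphic_on {z. Im z > - y}"
        unfolding F_def o_def by (intro holomorphic_intros)
      show "F (z + \<i> * of_real y) \<notin> \<real>\<^sub>\<le>\<^sub>0" if "z \<in> {z. Im z > - y}" for z
        using Fshift[of z] that by (auto simp: complex_nonpos_Reals_iff)
    qed
    have limG: "((\<lambda>R. integral {-R..R} (\<lambda>x. G (of_real x))) \<longlongrightarrow> 0) at_top"
    proof (rule semicircle_vanishing[OF y holG p(1)])
      fix z assume z: "0 \<le> Im z" "2 * b + 1 \<le> cmod z"
      have z0: "cmod z > 0" using z(2) b0 by linarith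
      have le: "cmod z \<le> cmod (z + \<i> * of_real y)"
        using z y by (auto simp: cmod_def power2_eq_square algebra_simps)
      have "cmod (F (z + \<i> * of_real y)) \<le> (2 * I / pi) / cmod (z + \<i> * of_real y)"
        using z y le by (intro Fbound) auto
      also have "\<dots> \<le> (2 * I / pi) / cmod z"
        using le z0 I0 by (intro divide_left_mono mult_pos_pos) auto
      finally have "cmod (F (z + \<i> * of_real y)) powr p \<le> ((2 * I / pi) / cmod z) powr p"
        using p by (intro powr_mono2) auto
      also have "\<dots> = (2 * I / pi) powr p / cmod z powr p"
        using I0 powr_divide[of "2 * I / pi" "cmod z" p] by simp
      finally show "cmod (G z) \<le> (2 * I / pi) powr p / cmod z powr p"
        unfolding G_def by (simp add: norm_powr_real_powr')
    qed
    have contF: "continuous_on S (\<lambda>x. F (Complex x y))" for S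
      unfolding F_def using cauchy_continuous_line[OF p fp, of y] y by (intro continuous_intros) auto
    have Gx: "G (of_real x) = F (Complex x y) powr of_real p" for x
      by (simp add: G_def Complex_eq mult.commute)
    have contG: "continuous_on S (\<lambda>x. G (of_real x))" for S
    proof -
      have "continuous_on (of_real ` S) G"
        by (rule continuous_on_subset[OF holomorphic_on_imp_continuous_on[OF holG]]) (use y in auto)
      then show ?thesis
        using continuous_on_compose[of S of_real G] by (auto simp: o_def intro: continuous_intros)
    qed
    define M where "M = enn2real (lp_mass p f)"
    have M: "lp_mass p f = ennreal M" using fp by (simp add: M_def lp_fun_def)
    have Fm [measurable]: "(\<lambda>x. F (Complex x y)) \<in> borel_measurable borel"
      by (rule borel_measurable_continuous_onI[OF contF])
    have Um: "(\<lambda>x. U x y) \<in> borel_measurable borel" unfolding U_def by measurable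
    have contU: "continuous_on S (\<lambda>x. U x y)" for S
    proof -
      have "(\<lambda>x. U x y) = (\<lambda>x. Re (F (Complex x y)))" using ReF y by auto
      moreover have "continuous_on S (\<lambda>x. Re (F (Complex x y)))"
        by (intro continuous_intros contF)
      ultimately show ?thesis by (simp only:)
    qed
    \<comment> \<open>over a finite interval every term is integrable; the error from the integral of F^p tends to 0 as R grows\<close>
    have part: "(\<integral>\<^sup>+x. ennreal (norm (F (Complex x y)) powr p) * indicator {-R..R} x \<partial>lborel) \<le>
       ennreal (A * M + B * norm (integral {-R..R} (\<lambda>x. G (of_real x))))" for R
    proof -
      have c1: "continuous_on {-R..R} (\<lambda>x. norm (F (Complex x y)) powr p)"
        using p by (intro continuous_on_powr' continuous_intros contF) auto
      have c2: "continuous_on {-R..R} (\<lambda>x. U x y powr p)"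
        using p Upos[OF y] by (intro continuous_on_powr' continuous_intros contU) (auto simp: less_imp_le)
      have iG: "(\<lambda>x. G (of_real x)) integrable_on {-R..R}"
        using contG by (intro integrable_continuous_real)
      have iRG: "(\<lambda>x. Re (G (of_real x))) integrable_on {-R..R}"
        using contG by (intro integrable_continuous_real continuous_intros)
      have i2: "(\<lambda>x. U x y powr p) integrable_on {-R..R}"
        using c2 by (rule integrable_continuous_real)
      have "integral {-R..R} (\<lambda>x. norm (F (Complex x y)) powr p) \<le>
          integral {-R..R} (\<lambda>x. A * U x y powr p - B * Re (G (of_real x)))"
      proof (rule integral_le)
        show "(\<lambda>x. norm (F (Complex x y)) powr p) integrable_on {-R..R}"
          using c1 by (rule integrable_continuous_real)
        show "(\<lambda>x. A * U x y powr p - B * Re (G (of_real x))) integrable_on {-R..R}"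
          using i2 iRG by (intro integrable_diff integrable_on_mult_right)
        show "norm (F (Complex x y)) powr p \<le> A * U x y powr p - B * Re (G (of_real x))" for x
          using ineq[of "F (Complex x y)"] ReF[OF y] Upos[OF y] unfolding Gx by simp
      qed
      also have "\<dots> = A * integral {-R..R} (\<lambda>x. U x y powr p) - B * integral {-R..R} (\<lambda>x. Re (G (of_real x)))"
        using i2 iRG by (simp add: Henstock_Kurzweil_Integration.integral_diff integrable_on_mult_right)
      also have "integral {-R..R} (\<lambda>x. Re (G (of_real x))) = Re (integral {-R..R} (\<lambda>x. G (of_real x)))"
        using iG by (rule integral_linear[OF _ bounded_linear_Re, unfolded o_def])
      also have "A * integral {-R..R} (\<lambda>x. U x y powr p) - B * Re (integral {-R..R} (\<lambda>x. G (of_real x)))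
        \<le> A * M + B * norm (integral {-R..R} (\<lambda>x. G (of_real x)))"
      proof -
        have "ennreal (integral {-R..R} (\<lambda>x. U x y powr p)) = (\<integral>\<^sup>+x. ennreal (U x y powr p) * indicator {-R..R} x \<partial>lborel)"
          using nn_integral_has_integral_lebesgue'[OF _ integrable_integral[OF i2]] by simp
        also have "\<dots> \<le> lp_mass p (poisson y f)"
          unfolding lp_mass_def poisson_U using Upos[OF y]
          by (intro nn_integral_mono) (auto simp: indicator_def less_imp_le)
        also have "\<dots> \<le> ennreal M" using poisson_contraction[OF p fp, of y] M by simp
        finally have "integral {-R..R} (\<lambda>x. U x y powr p) \<le> M" by (simp add: M_def)
        then have "A * integral {-R..R} (\<lambda>x. U x y powr p) \<le> A * M" using A by (intro mult_left_mono)
        moreover have "- B * Re (integral {-R..R} (\<lambda>x. G (of_real x))) \<le> B * norm (integral {-R..R} (\<lambda>x. G (of_real x)))"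
          using B abs_Re_le_cmod[of "integral {-R..R} (\<lambda>x. G (of_real x))"]
          by (metis abs_ge_minus_self minus_mult_commute mult_left_mono order_trans)
        ultimately show ?thesis by simp
      qed
      finally have "ennreal (integral {-R..R} (\<lambda>x. norm (F (Complex x y)) powr p)) \<le>
          ennreal (A * M + B * norm (integral {-R..R} (\<lambda>x. G (of_real x))))" by (rule ennreal_leI)
      then show ?thesis
        using nn_integral_has_integral_lebesgue'[OF _ integrable_integral[OF integrable_continuous_real[OF c1]]] by simp
    qed
    have "lp_mass p (\<lambda>x. F (Complex x y)) \<le> ennreal (A * M)"
    proof (rule lp_mass_le_truncations[OF _ Fm part])
      have "(\<lambda>n. integral {-real n..real n} (\<lambda>x. G (of_real x))) \<longlonglongrightarrow> 0"
        by (rule filterlim_compose[OF limG filterlim_real_sequentially])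
      then have "(\<lambda>n. A * M + B * norm (integral {-real n..real n} (\<lambda>x. G (of_real x)))) \<longlonglongrightarrow> A * M + B * norm (0::complex)"
        by (intro tendsto_intros)
      then show "(\<lambda>n. ennreal (A * M + B * norm (integral {-real n..real n} (\<lambda>x. G (of_real x))))) \<longlonglongrightarrow> ennreal (A * M)"
        by (intro tendsto_ennrealI) simp
    qed (use p in simp)
    also have "\<dots> = ennreal A * lp_mass p f"
      using A by (simp add: M ennreal_mult')
    finally show ?thesis unfolding F_def f_def .
  qed
qed

lemma cauchy_tendsto:
  assumes p: "1 < p" and f: "lp_fun p f" and g: "\<And>n. g n \<in> borel_measurable borel"
    and le: "\<And>n t. norm (g n t) \<le> norm (f t)" and lim: "\<And>t. (\<lambda>n. g n t) \<longlonglongrightarrow> f t" and z: "Im z \<noteq> 0"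
  shows "(\<lambda>n. cauchy (g n) z) \<longlonglongrightarrow> cauchy f z"
proof -
  have [measurable]: "f \<in> borel_measurable borel" "g n \<in> borel_measurable borel" for n
    using f g by (auto simp: lp_fun_def)
  have "(\<lambda>n. \<integral>t. g n t / (of_real t - z) \<partial>lborel) \<longlonglongrightarrow> (\<integral>t. f t / (of_real t - z) \<partial>lborel)"
  proof (rule integral_dominated_convergence[where w = "\<lambda>t. norm (f t / (of_real t - z))"])
    show "integrable lborel (\<lambda>t. norm (f t / (of_real t - z)))"
      using cauchy_integrable_im[OF p f z] by (rule integrable_norm)
    show "AE t in lborel. (\<lambda>n. g n t / (of_real t - z)) \<longlonglongrightarrow> f t / (of_real t - z)"
      using z by (intro AE_I2 tendsto_intros lim) (auto simp: complex_eq_iff)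
    show "AE t in lborel. norm (g n t / (of_real t - z)) \<le> norm (f t / (of_real t - z))" for n
      using le[of n] by (intro AE_I2) (simp add: norm_divide divide_right_mono)
  qed measurable
  then show ?thesis unfolding cauchy_def by (intro tendsto_intros)
qed

text \<open>
  Densities that are bounded and have bounded support increase to the general nonnegative
  density; Fatou's lemma preserves the bound.
\<close>

lemma riesz_positive:
  fixes g :: "real \<Rightarrow> real"
  assumes p: "1 < p" and A: "A \<ge> 0" and B: "B \<ge> 0"
    and ineq: "\<And>z. 0 < Re z \<Longrightarrow> cmod z powr p \<le> A * Re z powr p - B * Re (z powr of_real p)"
    and f: "lp_fun p (\<lambda>t. of_real (g t))" and g0: "\<And>t. 0 \<le> g t" and y: "y > 0"
  shows "lp_mass p (\<lambda>x. cauchy (\<lambda>t. of_real (g t)) (Complex x y)) \<le> ennreal A * lp_mass p (\<lambda>t. of_real (g t))"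
proof -
  define h where "h = (\<lambda>n t. if \<bar>t\<bar> \<le> real n then min (g t) (real n) else 0)"
  have "(\<lambda>t. complex_of_real (g t)) \<in> borel_measurable borel" using f by (simp add: lp_fun_def)
  then have [measurable]: "g \<in> borel_measurable borel" by (simp add: borel_measurable_complex_iff)
  have [measurable]: "h n \<in> borel_measurable borel" for n unfolding h_def by measurable
  have h0: "0 \<le> h n t" and hg: "h n t \<le> g t" and hn: "h n t \<le> real n" and hs: "real n < \<bar>t\<bar> \<Longrightarrow> h n t = 0" for n t
    using g0[of t] by (auto simp: h_def)
  have hlim: "(\<lambda>n. h n t) \<longlonglongrightarrow> g t" for t
  proof (rule tendsto_eventually)
    obtain N :: nat where N: "max \<bar>t\<bar> (g t) \<le> N" using real_arch_simple by blast
    show "eventually (\<lambda>n. h n t = g t) sequentially"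
      using eventually_ge_at_top[of N] by eventually_elim (use N in \<open>auto simp: h_def\<close>)
  qed
  show ?thesis
  proof (rule lp_mass_fatou_bound)
    show "(\<lambda>x. cauchy (\<lambda>t. of_real (h n t)) (Complex x y)) \<in> borel_measurable borel" for n
      by (rule cauchy_measurable_line) measurable
    show "AE x in lborel. (\<lambda>n. cauchy (\<lambda>t. of_real (h n t)) (Complex x y)) \<longlonglongrightarrow> cauchy (\<lambda>t. of_real (g t)) (Complex x y)"
      using y h0 hg g0 by (intro AE_I2 cauchy_tendsto[OF p f] tendsto_of_real hlim) auto
    fix n
    have "lp_mass p (\<lambda>x. cauchy (\<lambda>t. of_real (h n t)) (Complex x y)) \<le> lp_mass p (\<lambda>x. 2 * cauchy (\<lambda>t. of_real (h n t)) (Complex x y))"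
      using p by (intro lp_mass_mono) (auto simp: norm_mult)
    also have "\<dots> \<le> ennreal A * lp_mass p (\<lambda>t. of_real (h n t))"
      using hs by (intro riesz_bounded_positive[OF p A B ineq _ h0 hn _ y]) auto
    also have "\<dots> \<le> ennreal A * lp_mass p (\<lambda>t. of_real (g t))"
      using h0 hg g0 p by (intro mult_left_mono lp_mass_mono) auto
    finally show "lp_mass p (\<lambda>x. cauchy (\<lambda>t. of_real (h n t)) (Complex x y)) \<le> ennreal A * lp_mass p (\<lambda>t. of_real (g t))" .
  qed (use p in auto)
qed

lemma borel_measurable_cnj:
  assumes "f \<in> borel_measurable M"
  shows "(\<lambda>x. cnj (f x)) \<in> borel_measurable M"
  using measurable_compose[OF assms borel_measurable_continuous_onI[of cnj]] by (simp add: continuous_on_cnj)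

lemma lp_fun_cnj: "lp_fun p (\<lambda>t. cnj (f t)) \<longleftrightarrow> lp_fun p f"
proof -
  have "f \<in> borel_measurable borel" if "(\<lambda>t. cnj (f t)) \<in> borel_measurable borel"
    using borel_measurable_cnj[OF that] by simp
  then show ?thesis by (auto simp: lp_fun_def lp_mass_def intro: borel_measurable_cnj)
qed

lemma cauchy_lower:
  "norm (cauchy f (Complex x (- y))) = norm (cauchy (\<lambda>t. cnj (f t)) (Complex x y))"
proof -
  have "cnj (Complex x y) = Complex x (- y)" by (simp add: complex_eq_iff)
  then have "cnj (cauchy (\<lambda>t. cnj (f t)) (Complex x y)) = - cauchy f (Complex x (- y))"
    using cauchy_cnj[of "\<lambda>t. cnj (f t)" "Complex x y"] by simp
  then show ?thesis by (metis complex_mod_cnj norm_minus_cancel)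
qed

lemma riesz_both_sides:
  assumes A: "\<And>f y. lp_fun p f \<Longrightarrow> y > 0 \<Longrightarrow> lp_mass p (\<lambda>x. cauchy f (Complex x y)) \<le> ennreal A * lp_mass p f"
    and f: "lp_fun p f" and y: "y \<noteq> 0"
  shows "lp_mass p (\<lambda>x. cauchy f (Complex x y)) \<le> ennreal A * lp_mass p f"
proof (cases "y > 0")
  case True then show ?thesis by (rule A[OF f])
next
  case False
  have "lp_mass p (\<lambda>x. cauchy f (Complex x y)) = lp_mass p (\<lambda>x. cauchy (\<lambda>t. cnj (f t)) (Complex x (- y)))"
    using cauchy_lower[of f _ "- y"] by (simp add: lp_mass_def)
  also have "\<dots> \<le> ennreal A * lp_mass p (\<lambda>t. cnj (f t))"
    using f y False by (intro A) (auto simp: lp_fun_cnj)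
  finally show ?thesis by (simp add: lp_mass_def)
qed

text \<open>
  A complex density is a combination of the positive and negative parts of its real and
  imaginary parts, and each of these four is dominated by the norm of f.
\<close>

lemma riesz_exponent_le_2:
  assumes p: "1 < p" "p \<le> 2"
  shows "\<exists>A\<ge>0. \<forall>f y. lp_fun p f \<longrightarrow> y \<noteq> 0 \<longrightarrow> lp_mass p (\<lambda>x. cauchy f (Complex x y)) \<le> ennreal A * lp_mass p f"
proof -
  obtain A B where A: "A \<ge> 0" and B: "B \<ge> 0"
    and ineq: "\<And>z. 0 < Re z \<Longrightarrow> cmod z powr p \<le> A * Re z powr p - B * Re (z powr of_real p)"
    using right_half_plane_inequality[OF p] by blast
  \<comment> \<open>k a b is the constant of a sum whose terms have the constants a and b\<close>
  define k where "k = (\<lambda>a b. 2 powr p * (a + b))"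
  define A' where "A' = k A (k A (k A A))"
  have k0: "k a b \<ge> 0" if "a \<ge> 0" "b \<ge> 0" for a b using that by (simp add: k_def)
  have "lp_mass p (\<lambda>x. cauchy f (Complex x y)) \<le> ennreal A' * lp_mass p f" if f: "lp_fun p f" and y: "y > 0" for f y
  proof -
    have [measurable]: "f \<in> borel_measurable borel" using f by (simp add: lp_fun_def)
    let ?m = "lp_mass p f"
    define Q where "Q = (\<lambda>a g. lp_fun p g \<and> lp_mass p (\<lambda>x. cauchy g (Complex x y)) \<le> ennreal a * ?m)"
    have pos: "Q A (\<lambda>t. c * of_real (max 0 (v t)))" if [measurable]: "v \<in> borel_measurable borel" and v: "\<And>t. \<bar>v t\<bar> \<le> norm (f t)" and c: "cmod c = 1" for v c
    proof -
      have nle: "norm (complex_of_real (max 0 (v t))) \<le> norm (f t)" for t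
        using v[of t] by (auto simp: max_def)
      have l: "lp_fun p (\<lambda>t. of_real (max 0 (v t)))"
        using p nle by (intro lp_fun_bound[OF f]) auto
      have "lp_mass p (\<lambda>x. cauchy (\<lambda>t. of_real (max 0 (v t))) (Complex x y)) \<le> ennreal A * lp_mass p (\<lambda>t. of_real (max 0 (v t)))"
        using l y by (intro riesz_positive[OF p(1) A B ineq]) auto
      also have "\<dots> \<le> ennreal A * ?m"
        using p nle by (intro mult_left_mono lp_mass_mono) auto
      finally have "lp_mass p (\<lambda>x. cauchy (\<lambda>t. of_real (max 0 (v t))) (Complex x y)) \<le> ennreal A * ?m" .
      moreover have "lp_mass p (\<lambda>x. cauchy (\<lambda>t. c * of_real (max 0 (v t))) (Complex x y)) =
          lp_mass p (\<lambda>x. cauchy (\<lambda>t. of_real (max 0 (v t))) (Complex x y))"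
        unfolding lp_mass_def by (simp add: cauchy_cmult norm_mult c)
      ultimately show ?thesis unfolding Q_def using lp_fun_cmult[OF l] by simp
    qed
    have add: "Q (k a b) (\<lambda>t. g t + h t)" if g: "Q a g" and h: "Q b h" and ab: "a \<ge> 0" "b \<ge> 0" for a b g h
    proof -
      have l: "lp_fun p g" "lp_fun p h" using g h by (auto simp: Q_def)
      have [measurable]: "g \<in> borel_measurable borel" "h \<in> borel_measurable borel" using l by (auto simp: lp_fun_def)
      have "lp_mass p (\<lambda>x. cauchy (\<lambda>t. g t + h t) (Complex x y)) = lp_mass p (\<lambda>x. cauchy g (Complex x y) + cauchy h (Complex x y))"
        using cauchy_add[OF p(1) l] y by simp
      also have "\<dots> \<le> ennreal (2 powr p) * (lp_mass p (\<lambda>x. cauchy g (Complex x y)) + lp_mass p (\<lambda>x. cauchy h (Complex x y)))"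
        using p by (intro lp_mass_add cauchy_measurable_line) auto
      also have "\<dots> \<le> ennreal (2 powr p) * (ennreal a * ?m + ennreal b * ?m)"
        using g h by (intro mult_left_mono add_mono) (auto simp: Q_def)
      also have "\<dots> = ennreal (k a b) * ?m"
        using ab by (simp add: k_def ennreal_mult'' ennreal_plus distrib_right mult.assoc)
      finally show ?thesis unfolding Q_def using l p lp_fun_add[of p g h] by simp
    qed
    have "Q A' (\<lambda>t. 1 * of_real (max 0 (Re (f t))) + ((-1) * of_real (max 0 (- Re (f t))) +
        (\<i> * of_real (max 0 (Im (f t))) + (- \<i>) * of_real (max 0 (- Im (f t))))))"
      unfolding A'_def
      by (intro add pos A k0) (auto simp: abs_Re_le_cmod abs_Im_le_cmod)
    moreover have "(\<lambda>t. 1 * of_real (max 0 (Re (f t))) + ((-1) * of_real (max 0 (- Re (f t))) +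
        (\<i> * of_real (max 0 (Im (f t))) + (- \<i>) * of_real (max 0 (- Im (f t)))))) = f"
      by (auto simp: fun_eq_iff complex_eq_iff max_def)
    ultimately show ?thesis by (simp add: Q_def)
  qed
  then have "lp_mass p (\<lambda>x. cauchy f (Complex x y)) \<le> ennreal A' * lp_mass p f" if "lp_fun p f" "y \<noteq> 0" for f y
    using riesz_both_sides[of p A' f y] that by blast
  moreover have "A' \<ge> 0" unfolding A'_def using A k0 by simp
  ultimately show ?thesis by blast
qed

text \<open>
  Duality. Let T be the Cauchy integral on a horizontal line, I the integral of |T|^p over
  [-N, N], and test T against g = cnj T |T|^(p-2), cut to [-N, N]; the result is I, and also
  the p-th power of the q-norm of g is I. Fubini's theorem moves the Cauchy integral to g,
  where the bound for the dual exponent q \<le> 2 applies. Young's inequality with a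
  suitable scale l leaves I/2 on the right, and I, being finite, can be absorbed.
\<close>

lemma riesz_exponent_gt_2:
  assumes p: "2 < p"
  shows "\<exists>A\<ge>0. \<forall>f y. lp_fun p f \<longrightarrow> y \<noteq> 0 \<longrightarrow> lp_mass p (\<lambda>x. cauchy f (Complex x y)) \<le> ennreal A * lp_mass p f"
proof -
  define q where "q = p / (p - 1)"
  have q: "1 < q" "q \<le> 2" "1 / p + 1 / q = 1" "(p - 1) * q = p"
    using p by (auto simp: q_def field_simps)
  have p1: "1 < p" using p by simp
  obtain A where A: "A \<ge> 0" and rA: "\<And>f y. lp_fun q f \<Longrightarrow> y \<noteq> 0 \<Longrightarrow> lp_mass q (\<lambda>x. cauchy f (Complex x y)) \<le> ennreal A * lp_mass q f"
    using riesz_exponent_le_2[OF q(1,2)] by blast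
  \<comment> \<open>this scale makes A / (l powr q * q) at most 1/2\<close>
  define l where "l = (2 * A + 1) powr (1 / q)"
  have l: "l > 0" using A by (simp add: l_def)
  have lq: "l powr q = 2 * A + 1" using A q by (simp add: l_def powr_powr)
  define A' where "A' = 2 * l powr p"
  have "lp_mass p (\<lambda>x. cauchy f (Complex x y)) \<le> ennreal A' * lp_mass p f" if f: "lp_fun p f" and y: "y \<noteq> 0" for f y
  proof -
    have [measurable]: "f \<in> borel_measurable borel" using f by (simp add: lp_fun_def)
    define T where "T = (\<lambda>x. cauchy f (Complex x y))"
    have [measurable]: "T \<in> borel_measurable borel" unfolding T_def by (rule cauchy_measurable_line) simp
    have [measurable]: "(\<lambda>x. cnj (T x)) \<in> borel_measurable borel" by (intro borel_measurable_cnj) simp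
    obtain B where B: "\<And>x. (\<integral>t. norm (f t / (of_real t - Complex x y)) \<partial>lborel) \<le> B"
      using cauchy_abs_bound[OF p1 f y] by blast
    have TB: "norm (T x) \<le> B" for x
    proof -
      have "norm (T x) = norm (\<integral>t. f t / (of_real t - Complex x y) \<partial>lborel) / (2 * pi)"
        by (simp add: T_def cauchy_def norm_mult norm_divide)
      also have "\<dots> \<le> norm (\<integral>t. f t / (of_real t - Complex x y) \<partial>lborel) / 1"
        using pi_gt3 by (intro divide_left_mono) auto
      also have "\<dots> \<le> B" by (simp only: div_by_1) (rule order.trans[OF integral_norm_bound B])
      finally show ?thesis .
    qed
    have B0: "B \<ge> 0" using TB[of 0] norm_ge_zero order_trans by blast
    have main: "(\<integral>\<^sup>+x. ennreal (norm (T x) powr p) * indicator {-N..N} x \<partial>lborel) \<le> ennreal A' * lp_mass p f" for N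
    proof -
      define g where "g = (\<lambda>x. indicator {-N..N} x * (cnj (T x) * of_real (norm (T x) powr (p - 2))))"
      have [measurable]: "g \<in> borel_measurable borel" unfolding g_def by measurable
      define I where "I = (\<integral>x. norm (g x) powr q \<partial>lborel)"
      have gn: "norm (g x) = indicator {-N..N} x * norm (T x) powr (p - 1)" for x
      proof -
        have "norm (T x) * norm (T x) powr (p - 2) = norm (T x) powr (p - 1)"
          using p powr_add[of "norm (T x)" 1 "p - 2"] by (cases "T x = 0") auto
        then show ?thesis by (simp add: g_def norm_mult indicator_def)
      qed
      have gb: "norm (g x) \<le> B powr (p - 1)" for x
        unfolding gn using TB[of x] p by (auto simp: indicator_def intro!: powr_mono2)
      have gs: "g x = 0" if "N < \<bar>x\<bar>" for x using that by (auto simp: g_def indicator_def)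
      have lg: "lp_fun r g" if "r > 0" for r
        using gb gs that by (intro lp_fun_bounded_support[where b' = N]) auto
      have gq: "norm (g x) powr q = norm (T x) powr p * indicator {-N..N} x" for x
        unfolding gn using q p by (simp add: indicator_def powr_powr)
      have lgq: "lp_fun q g" using lg q by simp
      have mg: "lp_mass q g = ennreal I"
        unfolding lp_mass_def I_def using lp_integrable[OF lgq] by (intro nn_integral_eq_integral) auto
      have I0: "I \<ge> 0" unfolding I_def by simp
      define H where "H = (\<lambda>t. cauchy g (Complex t (- y)))"
      have [measurable]: "H \<in> borel_measurable borel" unfolding H_def by (rule cauchy_measurable_line) simp
      have mH: "lp_mass q H \<le> ennreal (A * I)"
        using rA[OF lgq, of "- y"] y A unfolding H_def mg by (simp add: ennreal_mult')
      have lH: "lp_fun q H" using mH by (auto simp: lp_fun_def intro: le_less_trans)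
      let ?c = "1 / (2 * of_real pi * \<i>)"
      let ?k = "\<lambda>x t. g x * (f t / (of_real t - Complex x y))"
      have iprod: "integrable (lborel \<Otimes>\<^sub>M lborel) (case_prod ?k)"
      proof (rule lborel_pair.Fubini_integrable)
        have eq: "Complex x y = of_real x + \<i> * of_real y" for x by (simp add: complex_eq_iff)
        show "case_prod ?k \<in> borel_measurable (lborel \<Otimes>\<^sub>M lborel)" unfolding eq by measurable
        have e: "(\<integral>t. norm (case_prod ?k (x, t)) \<partial>lborel) = norm (g x) * (\<integral>t. norm (f t / (of_real t - Complex x y)) \<partial>lborel)" for x
          unfolding prod.case norm_mult by (rule integral_mult_right_zero)
        show "integrable lborel (\<lambda>x. \<integral>t. norm (case_prod ?k (x, t)) \<partial>lborel)"
          unfolding e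
        proof (rule Bochner_Integration.integrable_bound)
          show "integrable lborel (\<lambda>x. norm (g x) * B)"
            using lp_integrable[OF lg[of 1]] by simp
          show "(\<lambda>x. norm (g x) * (\<integral>t. norm (f t / (of_real t - Complex x y)) \<partial>lborel)) \<in> borel_measurable lborel"
            unfolding eq by measurable
          show "AE x in lborel. norm (norm (g x) * (\<integral>t. norm (f t / (of_real t - Complex x y)) \<partial>lborel)) \<le> norm (norm (g x) * B)"
          proof (intro AE_I2)
            fix x
            have "0 \<le> (\<integral>t. norm (f t / (of_real t - Complex x y)) \<partial>lborel)" by simp
            then show "norm (norm (g x) * (\<integral>t. norm (f t / (of_real t - Complex x y)) \<partial>lborel)) \<le> norm (norm (g x) * B)"
              using B[of x] by (simp add: abs_mult mult_left_mono)
          qed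
        qed
        show "AE x in lborel. integrable lborel (\<lambda>t. case_prod ?k (x, t))"
          unfolding prod.case using cauchy_integrable_im[OF p1 f] y by (intro AE_I2 integrable_mult_right) auto
      qed
      have "complex_of_real I = (\<integral>x. of_real (norm (g x) powr q) \<partial>lborel)"
        by (simp add: I_def)
      also have "\<dots> = (\<integral>x. g x * T x \<partial>lborel)"
      proof (intro Bochner_Integration.integral_cong refl)
        fix x
        have "norm (T x) powr p = norm (T x) * (norm (T x) * norm (T x) powr (p - 2))"
        proof (cases "T x = 0")
          case False
          have "p = 1 + (1 + (p - 2))" by simp
          then have "norm (T x) powr p = norm (T x) powr (1 + (1 + (p - 2)))" by simp
          also have "\<dots> = norm (T x) * (norm (T x) * norm (T x) powr (p - 2))"
            using False by (simp only: powr_add powr_one norm_ge_zero)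
          finally show ?thesis .
        qed (use p in simp)
        moreover have "cnj (T x) * T x = of_real (norm (T x) * norm (T x))"
          using complex_norm_square[of "T x"] by (simp add: power2_eq_square mult.commute)
        moreover have "g x * T x = indicator {-N..N} x * ((cnj (T x) * T x) * of_real (norm (T x) powr (p - 2)))"
          by (simp add: g_def mult_ac)
        ultimately have "complex_of_real (norm (T x) powr p * indicator {-N..N} x) = g x * T x"
          by (simp only:) (simp add: indicator_def)
        then show "complex_of_real (norm (g x) powr q) = g x * T x" by (simp only: gq)
      qed
      also have "\<dots> = (\<integral>x. ?c * (\<integral>t. ?k x t \<partial>lborel) \<partial>lborel)"
        unfolding T_def cauchy_def
        by (intro Bochner_Integration.integral_cong refl) (simp only: integral_mult_right_zero mult.left_commute)
      also have "\<dots> = ?c * (\<integral>t. (\<integral>x. ?k x t \<partial>lborel) \<partial>lborel)"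
        by (simp only: integral_mult_right_zero lborel_pair.Fubini_integral[OF iprod])
      also have "\<dots> = (\<integral>t. ?c * (\<integral>x. ?k x t \<partial>lborel) \<partial>lborel)"
        by (simp only: integral_mult_right_zero)
      also have "\<dots> = (\<integral>t. - (f t * H t) \<partial>lborel)"
      proof (intro Bochner_Integration.integral_cong refl)
        fix t
        have "?k x t = - f t * (g x / (of_real x - Complex t (- y)))" for x
        proof -
          have "of_real t - Complex x y = - (of_real x - Complex t (- y))" by (simp add: complex_eq_iff)
          moreover have "a * (b / - v) = - b * (a / v)" for a b v :: complex by simp
          ultimately show ?thesis by (simp only:)
        qed
        then have "(\<integral>x. ?k x t \<partial>lborel) = - f t * (\<integral>x. g x / (of_real x - Complex t (- y)) \<partial>lborel)"
          by (simp only: integral_mult_right_zero)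
        then show "?c * (\<integral>x. ?k x t \<partial>lborel) = - (f t * H t)"
          unfolding H_def cauchy_def by (simp only:) simp
      qed
      finally have IH: "complex_of_real I = (\<integral>t. - (f t * H t) \<partial>lborel)" .
      have "I = norm (complex_of_real I)" using I0 by simp
      also have "\<dots> \<le> (\<integral>t. norm (- (f t * H t)) \<partial>lborel)" unfolding IH by (rule integral_norm_bound)
      also have "\<dots> \<le> (\<integral>t. l powr p / p * norm (f t) powr p + 1 / (l powr q * q) * norm (H t) powr q \<partial>lborel)"
      proof (rule integral_mono)
        show "integrable lborel (\<lambda>t. norm (- (f t * H t)))"
          using lp_integrable_mult[OF p1 f] lH unfolding q_def by (intro integrable_norm Bochner_Integration.integrable_minus) auto
        show "integrable lborel (\<lambda>t. l powr p / p * norm (f t) powr p + 1 / (l powr q * q) * norm (H t) powr q)"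
          using lp_integrable[OF f] lp_integrable[OF lH] by (intro Bochner_Integration.integrable_add integrable_mult_right)
        fix t
        have "(l * norm (f t)) * (norm (H t) / l) \<le> (l * norm (f t)) powr p / p + (norm (H t) / l) powr q / q"
          using p q l by (intro Youngs_inequality) auto
        then show "norm (- (f t * H t)) \<le> l powr p / p * norm (f t) powr p + 1 / (l powr q * q) * norm (H t) powr q"
          using l by (simp add: norm_mult powr_mult powr_divide)
      qed
      also have "\<dots> = l powr p / p * (\<integral>t. norm (f t) powr p \<partial>lborel) + 1 / (l powr q * q) * (\<integral>t. norm (H t) powr q \<partial>lborel)"
        using lp_integrable[OF f] lp_integrable[OF lH] by (subst Bochner_Integration.integral_add) (auto intro!: integrable_mult_right)
      also have "\<dots> \<le> l powr p / p * (\<integral>t. norm (f t) powr p \<partial>lborel) + 1 / (l powr q * q) * (A * I)"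
      proof -
        have "ennreal (\<integral>t. norm (H t) powr q \<partial>lborel) = lp_mass q H"
          unfolding lp_mass_def using lp_integrable[OF lH] by (intro nn_integral_eq_integral[symmetric]) auto
        then have "(\<integral>t. norm (H t) powr q \<partial>lborel) \<le> A * I" using mH A I0 ennreal_le_iff[of "A * I" "\<integral>t. norm (H t) powr q \<partial>lborel"] by simp
        then show ?thesis using q l by (intro add_left_mono mult_left_mono) auto
      qed
      also have "\<dots> \<le> l powr p / p * (\<integral>t. norm (f t) powr p \<partial>lborel) + I / 2"
      proof -
        have "1 / (l powr q * q) * (A * I) = (A / ((2 * A + 1) * q)) * I" by (simp add: lq)
        also have "A / ((2 * A + 1) * q) \<le> A / ((2 * A + 1) * 1)"
          using A q by (intro divide_left_mono mult_left_mono mult_pos_pos) auto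
        also have "\<dots> \<le> 1 / 2" using A by (simp add: field_simps)
        finally have "1 / (l powr q * q) * (A * I) \<le> 1 / 2 * I" using I0 by (simp add: mult_right_mono)
        then show ?thesis by simp
      qed
      finally have I1: "I \<le> l powr p / p * (\<integral>t. norm (f t) powr p \<partial>lborel) + I / 2" .
      have "l powr p / p * (\<integral>t. norm (f t) powr p \<partial>lborel) \<le> l powr p / 1 * (\<integral>t. norm (f t) powr p \<partial>lborel)"
        using p by (intro mult_right_mono divide_left_mono) auto
      with I1 have "I \<le> A' * (\<integral>t. norm (f t) powr p \<partial>lborel)" by (simp add: A'_def)
      then have "ennreal I \<le> ennreal (A' * (\<integral>t. norm (f t) powr p \<partial>lborel))" by (rule ennreal_leI)
      also have "\<dots> = ennreal A' * lp_mass p f"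
        unfolding lp_mass_def using lp_integrable[OF f] by (simp add: nn_integral_eq_integral ennreal_mult'')
      also have "ennreal I = (\<integral>\<^sup>+x. ennreal (norm (T x) powr p) * indicator {-N..N} x \<partial>lborel)"
        unfolding mg[symmetric] lp_mass_def gq by (intro nn_integral_cong) (auto simp: indicator_def)
      finally show ?thesis .
    qed
    have "lp_mass p T \<le> ennreal A' * lp_mass p f"
      by (rule lp_mass_le_truncations[OF _ _ main tendsto_const]) (use p in auto)
    then show ?thesis by (simp add: T_def)
  qed
  moreover have "A' \<ge> 0" by (simp add: A'_def)
  ultimately show ?thesis by blast
qed

theorem riesz_cauchy:
  assumes "1 < p"
  shows "\<exists>A\<ge>0. \<forall>f y. lp_fun p f \<longrightarrow> y \<noteq> 0 \<longrightarrow> lp_mass p (\<lambda>x. cauchy f (Complex x y)) \<le> ennreal A * lp_mass p f"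
  using riesz_exponent_le_2 riesz_exponent_gt_2 assms by (cases "p \<le> 2") auto

section \<open>Lebesgue points\<close>

text \<open>
  Not divided by the length of the interval: estimates then have the form of a bound by a
  multiple of r, without division in the extended reals.
\<close>

definition mean_dev :: "(real \<Rightarrow> complex) \<Rightarrow> complex \<Rightarrow> real \<Rightarrow> real \<Rightarrow> ennreal" where
  "mean_dev f c x r = (\<integral>\<^sup>+t. ennreal (norm (f t - c)) * indicator {x - r..x + r} t \<partial>lborel)"

definition lebesgue_point :: "(real \<Rightarrow> complex) \<Rightarrow> real \<Rightarrow> bool" where
  "lebesgue_point f x \<longleftrightarrow> (\<forall>e>0. \<exists>d>0. \<forall>r. 0 < r \<longrightarrow> r < d \<longrightarrow> mean_dev f (f x) x r \<le> ennreal (e * r))"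

lemma emeasure_UN_le_count_space:
  assumes X [measurable]: "\<And>i. i \<in> C \<Longrightarrow> X i \<in> sets M" and C: "countable C"
  shows "emeasure M (\<Union>i\<in>C. X i) \<le> (\<integral>\<^sup>+i. emeasure M (X i) \<partial>count_space C)"
proof -
  have U: "(\<Union>i\<in>C. X i) \<in> sets M" using X C by (intro sets.countable_UN') auto
  have "emeasure M (\<Union>i\<in>C. X i) = (\<integral>\<^sup>+t. indicator (\<Union>i\<in>C. X i) t \<partial>M)" using U by simp
  also have "\<dots> \<le> (\<integral>\<^sup>+t. (\<integral>\<^sup>+i. indicator (X i) t \<partial>count_space C) \<partial>M)"
  proof (intro nn_integral_mono)
    fix t
    show "indicator (\<Union>i\<in>C. X i) t \<le> (\<integral>\<^sup>+i. indicator (X i) t \<partial>count_space C)"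
    proof (cases "t \<in> (\<Union>i\<in>C. X i)")
      case True
      then obtain i where i: "i \<in> C" "t \<in> X i" by auto
      then show ?thesis using nn_integral_ge_point[OF i(1), of "\<lambda>i. indicator (X i) t"] True by simp
    qed simp
  qed
  also have "\<dots> = (\<integral>\<^sup>+i. (\<integral>\<^sup>+t. indicator (X i) t \<partial>M) \<partial>count_space C)"
    using X C by (intro nn_integral_count_space_nn_integral) auto
  also have "\<dots> = (\<integral>\<^sup>+i. emeasure M (X i) \<partial>count_space C)"
    using X by (intro nn_integral_cong) auto
  finally show ?thesis .
qed

text \<open>
  The weak type inequality of Hardy and Littlewood. The intervals on which the mean of the
  norm of b is too large contain, by Vitali's covering lemma, a disjoint countable family
  whose fivefold enlargements cover them all; disjointness bounds the sum of the lengths.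
\<close>

lemma maximal_inequality:
  fixes b :: "real \<Rightarrow> complex"
  assumes [measurable]: "b \<in> borel_measurable borel"
    and fin: "(\<integral>\<^sup>+t. ennreal (norm (b t)) \<partial>lborel) < \<infinity>" and l: "l > 0"
  shows "\<exists>V\<in>sets borel. emeasure lborel V \<le> ennreal (10 / l) * (\<integral>\<^sup>+t. ennreal (norm (b t)) \<partial>lborel) \<and>
    (\<forall>x. x \<notin> V \<longrightarrow> (\<forall>r>0. mean_dev b 0 x r \<le> ennreal (l * r)))"
proof -
  let ?N = "\<integral>\<^sup>+t. ennreal (norm (b t)) \<partial>lborel"
  obtain N where N: "?N = ennreal N" "N \<ge> 0" using fin by (cases ?N) auto
  define K where "K = {(x, r). 0 < r \<and> ennreal (l * r) < mean_dev b 0 x r}"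
  have mdN: "mean_dev b 0 x r \<le> ennreal N" for x r
    unfolding mean_dev_def N(1)[symmetric] by (intro nn_integral_mono) (auto simp: indicator_def)
  \<comment> \<open>the radii are bounded, as the covering lemma requires\<close>
  have rK: "0 < snd i \<and> snd i \<le> N / l" if "i \<in> K" for i
  proof -
    have "ennreal (l * snd i) < ennreal N" using that mdN by (auto simp: K_def intro: less_le_trans)
    moreover have "0 < snd i" using that by (auto simp: K_def)
    ultimately have "l * snd i < N" using l by (simp add: ennreal_less_iff)
    then show ?thesis using that l by (auto simp: K_def field_simps)
  qed
  obtain C where C: "countable C" "C \<subseteq> K"
     "pairwise (\<lambda>i j. disjnt (cball (fst i) (snd i)) (cball (fst j) (snd j))) C"
     "(\<Union>i\<in>K. cball (fst i) (snd i)) \<subseteq> (\<Union>i\<in>C. cball (fst i) (5 * snd i))"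
    by (rule Vitali_covering_lemma_cballs[OF order_refl rK])
  define V where "V = (\<Union>i\<in>C. cball (fst i) (5 * snd i))"
  have V: "V \<in> sets borel" unfolding V_def using C(1) by (intro sets.countable_UN') auto
  have cb: "cball x r = {x - r..x + r}" for x r :: real by (rule cball_eq_atLeastAtMost)
  have "emeasure lborel V \<le> (\<integral>\<^sup>+i. emeasure lborel (cball (fst i) (5 * snd i)) \<partial>count_space C)"
    unfolding V_def using C(1) by (intro emeasure_UN_le_count_space) auto
  also have "\<dots> \<le> (\<integral>\<^sup>+i. ennreal (10 / l) * (\<integral>\<^sup>+t. ennreal (norm (b t)) * indicator (cball (fst i) (snd i)) t \<partial>lborel) \<partial>count_space C)"
  proof (intro nn_integral_mono)
    fix i assume "i \<in> space (count_space C)"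
    then have iK: "i \<in> K" using C(2) by auto
    then have r: "0 < snd i" using rK by auto
    have "emeasure lborel (cball (fst i) (5 * snd i)) = ennreal (10 / l * (l * snd i))"
      unfolding cb using r l by simp
    also have "\<dots> = ennreal (10 / l) * ennreal (l * snd i)"
      using r l by (intro ennreal_mult) auto
    also have "ennreal (l * snd i) \<le> (\<integral>\<^sup>+t. ennreal (norm (b t)) * indicator (cball (fst i) (snd i)) t \<partial>lborel)"
      using iK by (auto simp: K_def mean_dev_def cb)
    finally show "emeasure lborel (cball (fst i) (5 * snd i)) \<le> ennreal (10 / l) * (\<integral>\<^sup>+t. ennreal (norm (b t)) * indicator (cball (fst i) (snd i)) t \<partial>lborel)"
      by (simp add: mult_left_mono)
  qed
  also have "\<dots> = ennreal (10 / l) * (\<integral>\<^sup>+i. (\<integral>\<^sup>+t. ennreal (norm (b t)) * indicator (cball (fst i) (snd i)) t \<partial>lborel) \<partial>count_space C)"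
    by (intro nn_integral_cmult) auto
  also have "(\<integral>\<^sup>+i. (\<integral>\<^sup>+t. ennreal (norm (b t)) * indicator (cball (fst i) (snd i)) t \<partial>lborel) \<partial>count_space C) \<le> ?N"
  proof -
    let ?\<mu> = "density lborel (\<lambda>t. ennreal (norm (b t)))"
    have "(\<integral>\<^sup>+i. (\<integral>\<^sup>+t. ennreal (norm (b t)) * indicator (cball (fst i) (snd i)) t \<partial>lborel) \<partial>count_space C)
       = (\<integral>\<^sup>+i. emeasure ?\<mu> (cball (fst i) (snd i)) \<partial>count_space C)"
      by (intro nn_integral_cong) (simp add: emeasure_density)
    also have "\<dots> = emeasure ?\<mu> (\<Union>i\<in>C. cball (fst i) (snd i))"
    proof (rule emeasure_UN_countable[symmetric])
      show "disjoint_family_on (\<lambda>i. cball (fst i) (snd i)) C"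
        using C(3) by (auto simp: disjoint_family_on_def pairwise_def disjnt_def)
    qed (use C(1) in auto)
    also have "\<dots> \<le> emeasure ?\<mu> (space ?\<mu>)" by (rule emeasure_space)
    also have "\<dots> = ?N" by (simp add: emeasure_density)
    finally show ?thesis .
  qed
  finally have "emeasure lborel V \<le> ennreal (10 / l) * ?N" by (simp add: mult_left_mono)
  moreover have "mean_dev b 0 x r \<le> ennreal (l * r)" if "x \<notin> V" "r > 0" for x r
  proof (rule ccontr)
    assume "\<not> ?thesis"
    then have "(x, r) \<in> K" using that by (auto simp: K_def)
    then have "x \<in> (\<Union>i\<in>K. cball (fst i) (snd i))" using that by force
    then have "x \<in> V" unfolding V_def by (rule subsetD[OF C(4)])
    then show False using that(1) by contradiction
  qed
  ultimately show ?thesis using V by blast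
qed

text \<open>
  The functions for which almost every point is a Lebesgue point are closed under
  approximation in \<open>L\<^sup>1\<close>. Write f = g + b with b small: outside a set of
  small measure the maximal inequality controls the means of b, and Markov's inequality
  controls b at the point itself.
\<close>

lemma lebesgue_point_closure:
  assumes [measurable]: "f \<in> borel_measurable borel"
    and appr: "\<And>e. e > 0 \<Longrightarrow> \<exists>g. g \<in> borel_measurable borel \<and>
      (\<integral>\<^sup>+t. ennreal (norm (f t - g t)) \<partial>lborel) \<le> ennreal e \<and> (AE x in lborel. lebesgue_point g x)"
  shows "AE x in lborel. lebesgue_point f x"
proof -
  have step: "AE x in lborel. \<exists>d>0. \<forall>r. 0 < r \<longrightarrow> r < d \<longrightarrow> mean_dev f (f x) x r \<le> ennreal (4 * l * r)" if l: "l > 0" for l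
  proof -
    let ?P = "\<lambda>x. \<exists>d>0. \<forall>r. 0 < r \<longrightarrow> r < d \<longrightarrow> mean_dev f (f x) x r \<le> ennreal (4 * l * r)"
    have cover: "\<exists>X\<in>sets lborel. emeasure lborel X \<le> ennreal (11 / l * e) \<and> {x. \<not> ?P x} \<subseteq> X" if e: "e > 0" for e
    proof -
      obtain g where [measurable]: "g \<in> borel_measurable borel"
        and ge: "(\<integral>\<^sup>+t. ennreal (norm (f t - g t)) \<partial>lborel) \<le> ennreal e" and gl: "AE x in lborel. lebesgue_point g x"
        using appr[OF e] by blast
      define b where "b = (\<lambda>t. f t - g t)"
      have [measurable]: "b \<in> borel_measurable borel" unfolding b_def by measurable
      have be: "(\<integral>\<^sup>+t. ennreal (norm (b t)) \<partial>lborel) \<le> ennreal e" using ge by (simp add: b_def)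
      then have bfin: "(\<integral>\<^sup>+t. ennreal (norm (b t)) \<partial>lborel) < \<infinity>" by (rule le_less_trans) simp
      obtain V where V: "V \<in> sets borel" "emeasure lborel V \<le> ennreal (10 / l) * (\<integral>\<^sup>+t. ennreal (norm (b t)) \<partial>lborel)"
        and Vm: "\<And>x r. x \<notin> V \<Longrightarrow> r > 0 \<Longrightarrow> mean_dev b 0 x r \<le> ennreal (l * r)"
        using maximal_inequality[OF _ bfin l] by auto
      define W where "W = {x \<in> space lborel. 1 \<le> ennreal (1 / l) * ennreal (norm (b x))}"
      have W: "W \<in> sets lborel" unfolding W_def by measurable
      have "emeasure lborel W = emeasure lborel ({x \<in> space lborel. 1 \<le> ennreal (1 / l) * (ennreal (norm (b x)))} )"
        by (simp add: W_def)
      also have "\<dots> \<le> ennreal (1 / l) * (\<integral>\<^sup>+x. ennreal (norm (b x)) * indicator (space lborel) x \<partial>lborel)"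
        using nn_integral_Markov_inequality[where u = "\<lambda>x. ennreal (norm (b x))" and M = lborel and A = "space lborel" and c = "ennreal (1 / l)"] by simp
      finally have We: "emeasure lborel W \<le> ennreal (1 / l) * (\<integral>\<^sup>+x. ennreal (norm (b x)) \<partial>lborel)" by simp
      obtain Z where Z: "Z \<in> null_sets lborel" "{x. \<not> lebesgue_point g x} \<subseteq> Z"
        using gl by (auto simp: eventually_ae_filter)
      have "emeasure lborel (V \<union> W \<union> Z) \<le> emeasure lborel V + emeasure lborel W + emeasure lborel Z"
        using V W Z by (intro order.trans[OF emeasure_subadditive] add_mono emeasure_subadditive) auto
      also have "\<dots> \<le> ennreal (10 / l) * ennreal e + ennreal (1 / l) * ennreal e + 0"
        using V(2) We be Z by (intro add_mono) (auto intro: order.trans[OF _ mult_left_mono[OF be]])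
      also have "\<dots> = ennreal (11 / l * e)"
        using l e by (simp add: add_divide_distrib algebra_simps flip: ennreal_mult ennreal_plus)
      finally have m: "emeasure lborel (V \<union> W \<union> Z) \<le> ennreal (11 / l * e)" .
      have "?P x" if x: "x \<notin> V \<union> W \<union> Z" for x
      proof -
        have "lebesgue_point g x" using x Z by auto
        then obtain d where d: "d > 0" "\<And>r. 0 < r \<Longrightarrow> r < d \<Longrightarrow> mean_dev g (g x) x r \<le> ennreal (l * r)"
          using l unfolding lebesgue_point_def by blast
        have "\<not> 1 \<le> ennreal (1 / l) * ennreal (norm (b x))" using x by (auto simp: W_def)
        then have bx: "norm (b x) < l"
          using l by (simp add: not_le field_simps flip: ennreal_mult' ennreal_1)
        \<comment> \<open>l r from the means of b, l r from g, and 2 l r from the value b x on an interval of length 2 r\<close>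
        have "mean_dev f (f x) x r \<le> ennreal (4 * l * r)" if r: "0 < r" "r < d" for r
        proof -
          have "mean_dev f (f x) x r \<le> (\<integral>\<^sup>+t. (ennreal (norm (b t - 0)) * indicator {x - r..x + r} t +
              (ennreal (norm (g t - g x)) * indicator {x - r..x + r} t + ennreal l * indicator {x - r..x + r} t)) \<partial>lborel)"
            unfolding mean_dev_def
          proof (intro nn_integral_mono)
            fix t
            have "norm (f t - f x) \<le> norm (b t) + norm (g t - g x) + norm (b x)"
            proof -
              have "f t - f x = b t + (g t - g x) - b x" by (simp add: b_def)
              then show ?thesis using norm_triangle_ineq4[of "b t + (g t - g x)" "b x"] norm_triangle_ineq[of "b t" "g t - g x"] by simp
            qed
            then have "norm (f t - f x) \<le> norm (b t) + (norm (g t - g x) + l)" using bx by linarith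
            then have "ennreal (norm (f t - f x)) \<le> ennreal (norm (b t)) + (ennreal (norm (g t - g x)) + ennreal l)"
              using l by (simp add: ennreal_leI flip: ennreal_plus)
            then show "ennreal (norm (f t - f x)) * indicator {x - r..x + r} t \<le> ennreal (norm (b t - 0)) * indicator {x - r..x + r} t +
              (ennreal (norm (g t - g x)) * indicator {x - r..x + r} t + ennreal l * indicator {x - r..x + r} t)"
              by (auto simp: indicator_def)
          qed
          also have "\<dots> = mean_dev b 0 x r + (mean_dev g (g x) x r + (\<integral>\<^sup>+t. ennreal l * indicator {x - r..x + r} t \<partial>lborel))"
            unfolding mean_dev_def by (simp add: nn_integral_add)
          also have "(\<integral>\<^sup>+t. ennreal l * indicator {x - r..x + r} t \<partial>lborel) = ennreal (l * (2 * r))"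
            using r l by (simp add: nn_integral_cmult ennreal_mult')
          also have "mean_dev b 0 x r + (mean_dev g (g x) x r + ennreal (l * (2 * r))) \<le> ennreal (l * r) + (ennreal (l * r) + ennreal (l * (2 * r)))"
            using Vm[of x r] d(2)[OF r] x r by (intro add_mono) auto
          also have "\<dots> = ennreal (4 * l * r)"
            using l r by (simp flip: ennreal_plus)
          finally show ?thesis .
        qed
        then show ?thesis using d(1) by blast
      qed
      then have "{x. \<not> ?P x} \<subseteq> V \<union> W \<union> Z" by blast
      then show ?thesis using m V W Z by (intro bexI[of _ "V \<union> W \<union> Z"]) auto
    qed
    have "\<forall>n::nat. \<exists>X. X \<in> sets lborel \<and> emeasure lborel X \<le> ennreal (11 / l * (1 / 2 ^ n)) \<and> {x. \<not> ?P x} \<subseteq> X"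
    proof
      fix n :: nat
      show "\<exists>X. X \<in> sets lborel \<and> emeasure lborel X \<le> ennreal (11 / l * (1 / 2 ^ n)) \<and> {x. \<not> ?P x} \<subseteq> X"
        using cover[of "1 / 2 ^ n"] by auto
    qed
    from choice[OF this] obtain X where X: "\<And>n::nat. X n \<in> sets lborel" "\<And>n. emeasure lborel (X n) \<le> ennreal (11 / l * (1 / 2 ^ n))" "\<And>n. {x. \<not> ?P x} \<subseteq> X n"
      by blast
    have "emeasure lborel (\<Inter>n. X n) \<le> ennreal (11 / l * (1 / 2 ^ n))" for n
      using X(1,2) by (intro order.trans[OF emeasure_mono X(2)[of n]]) auto
    moreover have "(\<lambda>n. ennreal (11 / l * (1 / 2 ^ n))) \<longlonglongrightarrow> ennreal (11 / l * 0)"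
      by (intro tendsto_ennrealI tendsto_intros) (auto intro: LIMSEQ_divide_realpow_zero)
    ultimately have "emeasure lborel (\<Inter>n. X n) \<le> ennreal (11 / l * 0)"
      by (intro LIMSEQ_le_const) auto
    then have "(\<Inter>n. X n) \<in> null_sets lborel" using X(1) by (auto simp: null_sets_def)
    then show ?thesis by (rule AE_I') (use X(3) in auto)
  qed
  have "AE x in lborel. \<forall>n::nat. \<exists>d>0. \<forall>r. 0 < r \<longrightarrow> r < d \<longrightarrow> mean_dev f (f x) x r \<le> ennreal (4 * (1 / Suc n) * r)"
    unfolding AE_all_countable by (intro allI step) auto
  then show ?thesis
  proof eventually_elim
    case (elim x)
    show ?case unfolding lebesgue_point_def
    proof (intro allI impI)
      fix e :: real assume e: "e > 0"
      obtain n :: nat where n: "1 / Suc n < e / 4" using e nat_approx_posE[of "e / 4"] by auto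
      obtain d where d: "d > 0" "\<And>r. 0 < r \<Longrightarrow> r < d \<Longrightarrow> mean_dev f (f x) x r \<le> ennreal (4 * (1 / Suc n) * r)"
        using elim by blast
      have "mean_dev f (f x) x r \<le> ennreal (e * r)" if r: "0 < r" "r < d" for r
      proof -
        have "4 * (1 / Suc n) * r \<le> e * r" using n r by (intro mult_right_mono) auto
        then show ?thesis using d(2)[OF r] by (meson ennreal_leI order_trans)
      qed
      then show "\<exists>d>0. \<forall>r. 0 < r \<longrightarrow> r < d \<longrightarrow> mean_dev f (f x) x r \<le> ennreal (e * r)" using d(1) by blast
    qed
  qed
qed

lemma lebesgue_point_continuous:
  assumes "continuous_on UNIV f"
  shows "lebesgue_point f x"
  unfolding lebesgue_point_def
proof (intro allI impI)
  fix e :: real assume e: "e > 0"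
  have "isCont f x" using assms by (simp add: continuous_on_eq_continuous_at)
  then obtain d where d: "d > 0" "\<And>t. \<bar>t - x\<bar> < d \<Longrightarrow> norm (f t - f x) < e / 2"
    using e unfolding continuous_at_eps_delta dist_norm real_norm_def by (metis half_gt_zero)
  have "mean_dev f (f x) x r \<le> ennreal (e * r)" if r: "0 < r" "r < d" for r
  proof -
    have "mean_dev f (f x) x r \<le> (\<integral>\<^sup>+t. ennreal (e / 2) * indicator {x - r..x + r} t \<partial>lborel)"
      unfolding mean_dev_def
    proof (intro nn_integral_mono)
      fix t
      show "ennreal (norm (f t - f x)) * indicator {x - r..x + r} t \<le> ennreal (e / 2) * indicator {x - r..x + r} t"
      proof (cases "t \<in> {x - r..x + r}")
        case True
        then have "norm (f t - f x) \<le> e / 2" using d(2)[of t] r by (auto simp: abs_le_iff less_imp_le)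
        then show ?thesis using True by (simp add: ennreal_leI)
      qed simp
    qed
    also have "\<dots> = ennreal (e * r)"
      using r e by (simp add: nn_integral_cmult flip: ennreal_mult)
    finally show ?thesis .
  qed
  then show "\<exists>d>0. \<forall>r. 0 < r \<longrightarrow> r < d \<longrightarrow> mean_dev f (f x) x r \<le> ennreal (e * r)" using d(1) by blast
qed

text \<open>
  A measurable function is almost everywhere a limit of continuous functions. Clamping their
  values to a disc and cutting them off outside an interval makes the convergence dominated,
  hence a convergence in \<open>L\<^sup>1\<close>.
\<close>

lemma lebesgue_point_bounded:
  fixes f :: "real \<Rightarrow> complex"
  assumes [measurable]: "f \<in> borel_measurable borel" and fM: "\<And>t. norm (f t) \<le> M" and fN: "\<And>t. N < \<bar>t\<bar> \<Longrightarrow> f t = 0"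
  shows "AE x in lborel. lebesgue_point f x"
proof (rule lebesgue_point_closure)
  fix e :: real assume e: "e > 0"
  define M' where "M' = max M 1"
  have M': "M' > 0" "\<And>t. norm (f t) \<le> M'" using fM by (auto simp: M'_def max.coboundedI1)
  have "f \<in> borel_measurable lebesgue" by (rule measurable_completion) simp
  then have "f measurable_on UNIV" by (intro lebesgue_measurable_imp_measurable_on) auto
  then obtain S g where S: "negligible S" and g: "\<And>n. continuous_on UNIV (g n)" and lim: "\<And>x. x \<notin> S \<Longrightarrow> (\<lambda>n. g n x) \<longlonglongrightarrow> f x"
    unfolding measurable_on_def by auto
  \<comment> \<open>the radial projection to the disc of radius M', and a cut-off function that is 1 on [-N, N]\<close>
  define cl where "cl = (\<lambda>z::complex. of_real (M' / max M' (norm z)) * z)"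
  define ph where "ph = (\<lambda>x::real. max 0 (min 1 (N + 1 - \<bar>x\<bar>)))"
  define h where "h = (\<lambda>n x. of_real (ph x) * cl (g n x))"
  have clc: "continuous_on UNIV cl" unfolding cl_def using M' by (intro continuous_intros) (auto simp: max_def)
  have clb: "norm (cl z) \<le> M'" for z
  proof (cases "norm z \<le> M'")
    case True then show ?thesis using M' by (simp add: cl_def max_def)
  next
    case False then show ?thesis using M' by (simp add: cl_def max_def norm_mult norm_divide)
  qed
  have cli: "cl z = z" if "norm z \<le> M'" for z using that M' by (simp add: cl_def max_def)
  have hc: "continuous_on UNIV (h n)" for n
  proof -
    have "continuous_on UNIV (\<lambda>x. cl (g n x))"
      by (rule continuous_on_compose2[OF clc g]) auto
    then show ?thesis unfolding h_def ph_def by (intro continuous_intros)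
  qed
  have hm [measurable]: "h n \<in> borel_measurable borel" for n by (rule borel_measurable_continuous_onI[OF hc])
  have hlim: "(\<lambda>n. h n x) \<longlonglongrightarrow> f x" if "x \<notin> S" for x
  proof -
    have "isCont cl (f x)" using clc by (simp add: continuous_on_eq_continuous_at)
    then have "(\<lambda>n. cl (g n x)) \<longlonglongrightarrow> cl (f x)" using lim[OF that] by (rule isCont_tendsto_compose)
    then have "(\<lambda>n. h n x) \<longlonglongrightarrow> of_real (ph x) * cl (f x)" unfolding h_def by (intro tendsto_intros)
    moreover have "of_real (ph x) * cl (f x) = f x"
      using M'(2)[of x] fN[of x] by (cases "N < \<bar>x\<bar>") (auto simp: cli ph_def min_def)
    ultimately show ?thesis by simp
  qed
  have hb: "norm (h n x) \<le> M' * indicator {- (\<bar>N\<bar> + 1)..\<bar>N\<bar> + 1} x" for n x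
  proof (cases "\<bar>x\<bar> \<le> \<bar>N\<bar> + 1")
    case True
    have "norm (h n x) = ph x * norm (cl (g n x))" by (simp add: h_def norm_mult ph_def)
    also have "\<dots> \<le> 1 * M'" using clb by (intro mult_mono) (auto simp: ph_def)
    finally show ?thesis using True by (simp add: indicator_def abs_le_iff)
  next
    case False
    then have "ph x = 0" by (simp add: ph_def min_def)
    then show ?thesis using M' by (simp add: h_def)
  qed
  have "(\<lambda>n. \<integral>\<^sup>+t. ennreal (norm (f t - h n t)) \<partial>lborel) \<longlonglongrightarrow> 0"
  proof (rule nn_integral_dominated_convergence_norm[where w = "\<lambda>t. M' * indicator {- (\<bar>N\<bar> + 1)..\<bar>N\<bar> + 1} t"])
    have "(\<integral>\<^sup>+t. ennreal (M' * indicator {- (\<bar>N\<bar> + 1)..\<bar>N\<bar> + 1} t) \<partial>lborel) = (\<integral>\<^sup>+t. ennreal M' * indicator {- (\<bar>N\<bar> + 1)..\<bar>N\<bar> + 1} t \<partial>lborel)"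
      by (intro nn_integral_cong) (auto simp: indicator_def)
    also have "\<dots> < \<infinity>" by (simp add: nn_integral_cmult ennreal_mult_less_top)
    finally show "(\<integral>\<^sup>+t. ennreal (M' * indicator {- (\<bar>N\<bar> + 1)..\<bar>N\<bar> + 1} t) \<partial>lborel) < \<infinity>" .
    have "AE x in lborel. x \<notin> S"
    proof -
      have "S \<in> null_sets lebesgue" using S by (simp add: negligible_iff_null_sets)
      then have "AE x in lebesgue. x \<notin> S" by (rule AE_not_in)
      then show ?thesis by (simp add: AE_completion_iff)
    qed
    then show "AE t in lborel. (\<lambda>n. h n t) \<longlonglongrightarrow> f t"
      by eventually_elim (rule hlim)
  qed (use hb in \<open>auto\<close>)
  then have "eventually (\<lambda>n. (\<integral>\<^sup>+t. ennreal (norm (f t - h n t)) \<partial>lborel) < ennreal e) sequentially"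
    using e by (intro order_tendstoD(2)) auto
  then obtain n where "(\<integral>\<^sup>+t. ennreal (norm (f t - h n t)) \<partial>lborel) < ennreal e"
    by (auto simp: eventually_sequentially)
  then show "\<exists>g. g \<in> borel_measurable borel \<and> (\<integral>\<^sup>+t. ennreal (norm (f t - g t)) \<partial>lborel) \<le> ennreal e \<and> (AE x in lborel. lebesgue_point g x)"
    using lebesgue_point_continuous[OF hc] hm by (intro exI[of _ "h n"]) auto
qed simp

lemma lebesgue_point_integrable:
  fixes f :: "real \<Rightarrow> complex"
  assumes [measurable]: "f \<in> borel_measurable borel" and fin: "(\<integral>\<^sup>+t. ennreal (norm (f t)) \<partial>lborel) < \<infinity>"
  shows "AE x in lborel. lebesgue_point f x"
proof (rule lebesgue_point_closure)
  fix e :: real assume e: "e > 0"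
  define h where "h = (\<lambda>n t. if \<bar>t\<bar> \<le> real n \<and> norm (f t) \<le> real n then f t else 0)"
  have hm [measurable]: "h n \<in> borel_measurable borel" for n unfolding h_def by measurable
  have "(\<lambda>n. \<integral>\<^sup>+t. ennreal (norm (f t - h n t)) \<partial>lborel) \<longlonglongrightarrow> 0"
  proof (rule nn_integral_dominated_convergence_norm[where w = "\<lambda>t. norm (f t)"])
    show "AE t in lborel. (\<lambda>n. h n t) \<longlonglongrightarrow> f t"
    proof (intro AE_I2 tendsto_eventually)
      fix t
      obtain N :: nat where N: "max \<bar>t\<bar> (norm (f t)) \<le> N" using real_arch_simple by blast
      show "eventually (\<lambda>n. h n t = f t) sequentially"
        using eventually_ge_at_top[of N] by eventually_elim (use N in \<open>auto simp: h_def\<close>)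
    qed
  qed (use fin in \<open>auto simp: h_def\<close>)
  then have "eventually (\<lambda>n. (\<integral>\<^sup>+t. ennreal (norm (f t - h n t)) \<partial>lborel) < ennreal e) sequentially"
    using e by (intro order_tendstoD(2)) auto
  then obtain n where "(\<integral>\<^sup>+t. ennreal (norm (f t - h n t)) \<partial>lborel) < ennreal e"
    by (auto simp: eventually_sequentially)
  moreover have "AE x in lborel. lebesgue_point (h n) x"
    by (rule lebesgue_point_bounded[where M = n and N = n]) (auto simp: h_def)
  ultimately show "\<exists>g. g \<in> borel_measurable borel \<and> (\<integral>\<^sup>+t. ennreal (norm (f t - g t)) \<partial>lborel) \<le> ennreal e \<and> (AE x in lborel. lebesgue_point g x)"
    using hm by (intro exI[of _ "h n"]) auto
qed simp

lemma norm_le_1_plus_powr: "1 < p \<Longrightarrow> 0 \<le> a \<Longrightarrow> a \<le> 1 + a powr p" for a :: real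
proof (cases "a \<le> 1")
  case False
  assume "1 < p"
  then have "a powr 1 \<le> a powr p" using False by (intro powr_mono) auto
  then show ?thesis using False by simp
qed (simp add: add_increasing2)

text \<open>
  Being a Lebesgue point is a local property, and on bounded intervals functions of class
  \<open>L\<^sup>p\<close> are integrable.
\<close>

theorem lebesgue_differentiation:
  assumes p: "1 < p" and f: "lp_fun p f"
  shows "AE x in lborel. lebesgue_point f x"
proof -
  have [measurable]: "f \<in> borel_measurable borel" using f by (simp add: lp_fun_def)
  define h where "h = (\<lambda>(n::nat) t. f t * indicator {-real n..real n} t)"
  have [measurable]: "h n \<in> borel_measurable borel" for n unfolding h_def by measurable
  have "AE x in lborel. lebesgue_point (h n) x" for n
  proof (rule lebesgue_point_integrable)
    have "(\<integral>\<^sup>+t. ennreal (norm (h n t)) \<partial>lborel) \<le> (\<integral>\<^sup>+t. (indicator {-real n..real n} t + ennreal (norm (f t) powr p)) \<partial>lborel)"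
    proof (intro nn_integral_mono)
      fix t
      have "ennreal (norm (f t)) \<le> ennreal (1 + norm (f t) powr p)" using norm_le_1_plus_powr[OF p] by (intro ennreal_leI) auto
      then show "ennreal (norm (h n t)) \<le> indicator {-real n..real n} t + ennreal (norm (f t) powr p)"
        by (auto simp: h_def indicator_def)
    qed
    also have "\<dots> = emeasure lborel {-real n..real n} + lp_mass p f"
      unfolding lp_mass_def by (subst nn_integral_add) auto
    also have "\<dots> < \<infinity>" using f by (auto simp: lp_fun_def)
    finally show "(\<integral>\<^sup>+t. ennreal (norm (h n t)) \<partial>lborel) < \<infinity>" .
  qed simp
  then have "AE x in lborel. \<forall>n. lebesgue_point (h n) x" by (simp add: AE_all_countable)
  then show ?thesis
  proof eventually_elim
    case (elim x)
    obtain n :: nat where n: "\<bar>x\<bar> + 1 \<le> n" using real_arch_simple by blast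
    have hx: "h n t = f t" if "\<bar>t - x\<bar> \<le> 1" for t using that n by (auto simp: h_def indicator_def)
    show ?case unfolding lebesgue_point_def
    proof (intro allI impI)
      fix e :: real assume "e > 0"
      then obtain d where d: "d > 0" "\<And>r. 0 < r \<Longrightarrow> r < d \<Longrightarrow> mean_dev (h n) (h n x) x r \<le> ennreal (e * r)"
        using elim unfolding lebesgue_point_def by blast
      have "mean_dev f (f x) x r \<le> ennreal (e * r)" if r: "0 < r" "r < min d 1" for r
      proof -
        have "mean_dev f (f x) x r = mean_dev (h n) (h n x) x r"
          unfolding mean_dev_def using r hx by (intro nn_integral_cong) (auto simp: indicator_def)
        then show ?thesis using d(2)[of r] r by simp
      qed
      then show "\<exists>d>0. \<forall>r. 0 < r \<longrightarrow> r < d \<longrightarrow> mean_dev f (f x) x r \<le> ennreal (e * r)"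
        using d(1) by (intro exI[of _ "min d 1"]) auto
    qed
  qed
qed

section \<open>Nontangential limits of Poisson integrals\<close>

text \<open>
  The derivative of the Poisson kernel with the sign reversed.
\<close>

definition pkern_slope :: "real \<Rightarrow> real" where
  "pkern_slope r = 2 * r / (pi * (1 + r\<^sup>2)\<^sup>2)"

lemma pkern_slope_measurable [measurable]: "pkern_slope \<in> borel_measurable borel"
  unfolding pkern_slope_def[abs_def] by measurable

text \<open>
  The Poisson kernel as a superposition of indicator functions of the intervals [-r, r]; it
  turns means over intervals into Poisson means.
\<close>

lemma pkern_layer_cake:
  "ennreal (pkern u) = (\<integral>\<^sup>+r. ennreal (pkern_slope r) * indicator {\<bar>u\<bar>..} r \<partial>lborel)"
proof -
  have "(\<integral>\<^sup>+r. ennreal (pkern_slope r) * indicator {\<bar>u\<bar>..} r \<partial>lborel) = ennreal (0 - (- pkern \<bar>u\<bar>))"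
  proof (rule nn_integral_FTC_atLeast)
    fix r :: real assume r: "\<bar>u\<bar> \<le> r"
    have pos: "1 + r\<^sup>2 > 0" by (simp add: add_pos_nonneg)
    have "((\<lambda>r. - (1 / pi) * inverse (1 + r\<^sup>2)) has_real_derivative - (1 / pi) * (- (inverse (1 + r\<^sup>2) * (2 * r) * inverse (1 + r\<^sup>2)))) (at r)"
      using pos by (auto intro!: derivative_eq_intros)
    moreover have "- (1 / pi) * (- (inverse (1 + r\<^sup>2) * (2 * r) * inverse (1 + r\<^sup>2))) = pkern_slope r"
      using pos by (simp add: pkern_slope_def power2_eq_square divide_inverse)
    moreover have "(\<lambda>r. - (1 / pi) * inverse (1 + r\<^sup>2)) = (\<lambda>r. - pkern r)"
      by (simp add: pkern_def divide_inverse)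
    ultimately show "((\<lambda>r. - pkern r) has_real_derivative pkern_slope r) (at r)" by simp
    show "0 \<le> pkern_slope r" using r by (simp add: pkern_slope_def)
  next
    have "((\<lambda>r. - (1 / pi) * inverse (1 + r\<^sup>2)) \<longlongrightarrow> - (1 / pi) * 0) at_top"
      by (intro tendsto_intros tendsto_inverse_0_at_top filterlim_tendsto_add_at_top[OF tendsto_const] filterlim_pow_at_top filterlim_ident) auto
    moreover have "(\<lambda>r. - (1 / pi) * inverse (1 + r\<^sup>2)) = (\<lambda>r. - pkern r)"
      by (simp add: pkern_def divide_inverse)
    ultimately show "((\<lambda>r. - pkern r) \<longlongrightarrow> 0) at_top" by simp
  qed simp
  then show ?thesis by (simp add: pkern_def)
qed

lemma pkern_tail:
  assumes R: "R > 0"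
  shows "(\<integral>\<^sup>+r. ennreal (pkern r) * indicator {R..} r \<partial>lborel) \<le> ennreal (1 / R)"
proof -
  have "(\<integral>\<^sup>+r. ennreal (pkern r) * indicator {R..} r \<partial>lborel) \<le> (\<integral>\<^sup>+r. ennreal (1 / r\<^sup>2) * indicator {R..} r \<partial>lborel)"
  proof (intro nn_integral_mono)
    fix r
    show "ennreal (pkern r) * indicator {R..} r \<le> ennreal (1 / r\<^sup>2) * indicator {R..} r"
    proof (cases "r \<ge> R")
      case True
      have "1 * r\<^sup>2 \<le> pi * (1 + r\<^sup>2)" using pi_gt3 by (intro mult_mono) auto
      then have "pkern r \<le> 1 / r\<^sup>2" unfolding pkern_def using True R by (intro divide_left_mono) (auto intro!: mult_pos_pos add_pos_nonneg)
      then show ?thesis by (intro mult_right_mono ennreal_leI) auto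
    qed simp
  qed
  also have "\<dots> = ennreal (0 - (- 1 / R))"
  proof (rule nn_integral_FTC_atLeast)
    fix r :: real assume r: "R \<le> r"
    show "((\<lambda>r. - 1 / r) has_real_derivative 1 / r\<^sup>2) (at r)"
      using r R by (auto intro!: derivative_eq_intros simp: power2_eq_square)
    show "0 \<le> 1 / r\<^sup>2" by simp
  next
    show "((\<lambda>r::real. - 1 / r) \<longlongrightarrow> 0) at_top"
      by (intro tendsto_divide_0[OF tendsto_const] filterlim_at_top_imp_at_infinity filterlim_ident)
  qed simp
  finally show ?thesis by simp
qed

lemma pkern_slope_le: "0 \<le> r \<Longrightarrow> pkern_slope r * r \<le> 2 * pkern r"
proof -
  assume r: "0 \<le> r"
  have pos: "1 + r\<^sup>2 > 0" by (simp add: add_pos_nonneg)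
  have "pkern_slope r * r = 2 * (r\<^sup>2 / (pi * (1 + r\<^sup>2)\<^sup>2))"
    by (simp add: pkern_slope_def power2_eq_square)
  also have "r\<^sup>2 / (pi * (1 + r\<^sup>2)\<^sup>2) \<le> (1 + r\<^sup>2) / (pi * (1 + r\<^sup>2)\<^sup>2)"
    by (intro divide_right_mono) auto
  also have "(1 + r\<^sup>2) / (pi * (1 + r\<^sup>2)\<^sup>2) = pkern r"
    using pos by (simp add: pkern_def power2_eq_square)
  finally show ?thesis by simp
qed

definition poisson_dev :: "(real \<Rightarrow> complex) \<Rightarrow> real \<Rightarrow> real \<Rightarrow> ennreal" where
  "poisson_dev h x y = (\<integral>\<^sup>+u. ennreal (pkern u) * ennreal (norm (h (x + y * u) - h x)) \<partial>lborel)"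

lemma mean_dev_measurable [measurable]:
  assumes [measurable]: "f \<in> borel_measurable borel"
  shows "(\<lambda>r. mean_dev f c x (y * r)) \<in> borel_measurable borel"
proof -
  have eq: "(\<lambda>r. mean_dev f c x (y * r)) = (\<lambda>r. \<integral>\<^sup>+t. ennreal (norm (f t - c)) * (if x - y * r \<le> t \<and> t \<le> x + y * r then 1 else 0) \<partial>lborel)"
    unfolding mean_dev_def by (intro ext nn_integral_cong) (auto simp: indicator_def)
  show ?thesis unfolding eq by measurable
qed

lemma poisson_dev_eq:
  assumes [measurable]: "h \<in> borel_measurable borel" and y: "y > 0"
  shows "poisson_dev h x y = (\<integral>\<^sup>+r. ennreal (pkern_slope r) * (ennreal (1 / y) * mean_dev h (h x) x (y * r)) * indicator {0..} r \<partial>lborel)"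
proof -
  have inner: "(\<integral>\<^sup>+u. ennreal (norm (h (x + y * u) - h x)) * indicator {-r..r} u \<partial>lborel) = ennreal (1 / y) * mean_dev h (h x) x (y * r)" for r
  proof -
    have "mean_dev h (h x) x (y * r) = ennreal y * (\<integral>\<^sup>+u. ennreal (norm (h (x + y * u) - h x)) * indicator {x - y * r..x + y * r} (x + y * u) \<partial>lborel)"
      unfolding mean_dev_def using y by (subst nn_integral_real_affine[where c = y and t = x]) auto
    also have "(\<integral>\<^sup>+u. ennreal (norm (h (x + y * u) - h x)) * indicator {x - y * r..x + y * r} (x + y * u) \<partial>lborel)
       = (\<integral>\<^sup>+u. ennreal (norm (h (x + y * u) - h x)) * indicator {-r..r} u \<partial>lborel)"
    proof (intro nn_integral_cong arg_cong2[where f = "(*)"] refl)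
      fix u
      have "- (y * r) \<le> y * u \<longleftrightarrow> - r \<le> u" using y mult_le_cancel_left_pos[of y "-r" u] by simp
      then show "indicator {x - y * r..x + y * r} (x + y * u) = (indicator {-r..r} u :: ennreal)"
        using y by (auto simp: indicator_def)
    qed
    finally show ?thesis using y by (simp flip: mult.assoc ennreal_mult'')
  qed
  have "poisson_dev h x y = (\<integral>\<^sup>+u. (\<integral>\<^sup>+r. ennreal (pkern_slope r) * indicator {\<bar>u\<bar>..} r \<partial>lborel) * ennreal (norm (h (x + y * u) - h x)) \<partial>lborel)"
    unfolding poisson_dev_def pkern_layer_cake ..
  also have "\<dots> = (\<integral>\<^sup>+u. (\<integral>\<^sup>+r. ennreal (pkern_slope r) * (if \<bar>u\<bar> \<le> r then 1 else 0) * ennreal (norm (h (x + y * u) - h x)) \<partial>lborel) \<partial>lborel)"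
  proof (intro nn_integral_cong)
    fix u
    have "(\<lambda>r. ennreal (pkern_slope r) * indicator {\<bar>u\<bar>..} r) = (\<lambda>r. ennreal (pkern_slope r) * (if \<bar>u\<bar> \<le> r then 1 else 0))"
      by (auto simp: indicator_def)
    then show "(\<integral>\<^sup>+r. ennreal (pkern_slope r) * indicator {\<bar>u\<bar>..} r \<partial>lborel) * ennreal (norm (h (x + y * u) - h x)) =
      (\<integral>\<^sup>+r. ennreal (pkern_slope r) * (if \<bar>u\<bar> \<le> r then 1 else 0) * ennreal (norm (h (x + y * u) - h x)) \<partial>lborel)"
      by (simp only:) (rule nn_integral_multc[symmetric], measurable)
  qed
  also have "\<dots> = (\<integral>\<^sup>+r. (\<integral>\<^sup>+u. ennreal (pkern_slope r) * (if \<bar>u\<bar> \<le> r then 1 else 0) * ennreal (norm (h (x + y * u) - h x)) \<partial>lborel) \<partial>lborel)"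
    by (rule lborel_pair.Fubini') measurable
  also have "\<dots> = (\<integral>\<^sup>+r. ennreal (pkern_slope r) * (ennreal (1 / y) * mean_dev h (h x) x (y * r)) * indicator {0..} r \<partial>lborel)"
  proof (intro nn_integral_cong)
    fix r
    have "(\<integral>\<^sup>+u. ennreal (pkern_slope r) * (if \<bar>u\<bar> \<le> r then 1 else 0) * ennreal (norm (h (x + y * u) - h x)) \<partial>lborel)
      = (\<integral>\<^sup>+u. ennreal (pkern_slope r) * (ennreal (norm (h (x + y * u) - h x)) * indicator {-r..r} u) \<partial>lborel)"
      by (intro nn_integral_cong) (auto simp: indicator_def abs_le_iff)
    also have "\<dots> = ennreal (pkern_slope r) * (ennreal (1 / y) * mean_dev h (h x) x (y * r))"
      unfolding inner[symmetric] by (intro nn_integral_cmult) measurable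
    also have "\<dots> = ennreal (pkern_slope r) * (ennreal (1 / y) * mean_dev h (h x) x (y * r)) * indicator {0..} r"
    proof (cases "r \<ge> 0")
      case False
      then have "pkern_slope r \<le> 0" by (auto simp: pkern_slope_def intro!: divide_nonpos_nonneg)
      then show ?thesis by (simp add: ennreal_neg)
    qed simp
    finally show "(\<integral>\<^sup>+u. ennreal (pkern_slope r) * (if \<bar>u\<bar> \<le> r then 1 else 0) * ennreal (norm (h (x + y * u) - h x)) \<partial>lborel)
      = ennreal (pkern_slope r) * (ennreal (1 / y) * mean_dev h (h x) x (y * r)) * indicator {0..} r" .
  qed
  finally show ?thesis .
qed

text \<open>
  For radii bounded below the deviation grows at most linearly, because the p-th power of h
  has a finite integral.
\<close>

lemma mean_dev_large:
  assumes p: "1 < p" and h: "lp_fun p h" and d: "d > 0"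
  shows "\<exists>M\<ge>0. \<forall>r\<ge>d. mean_dev h c x r \<le> ennreal (M * r)"
proof -
  have [measurable]: "h \<in> borel_measurable borel" using h by (simp add: lp_fun_def)
  obtain m where m: "lp_mass p h = ennreal m" "m \<ge> 0"
    using h by (cases "lp_mass p h") (auto simp: lp_fun_def)
  let ?C = "1 + norm c"
  show ?thesis
  proof (intro exI conjI allI impI)
    show "0 \<le> 2 * ?C + m / d" using m d by auto
    fix r assume r: "d \<le> r"
    have "mean_dev h c x r \<le> (\<integral>\<^sup>+t. (ennreal ?C * indicator {x - r..x + r} t + ennreal (norm (h t) powr p)) \<partial>lborel)"
      unfolding mean_dev_def
    proof (intro nn_integral_mono)
      fix t
      have "norm (h t - c) \<le> norm (h t) + norm c" by (rule norm_triangle_ineq4)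
      also have "norm (h t) \<le> 1 + norm (h t) powr p" by (rule norm_le_1_plus_powr[OF p]) simp
      finally have "norm (h t - c) \<le> ?C + norm (h t) powr p" by simp
      then have "ennreal (norm (h t - c)) \<le> ennreal (?C + norm (h t) powr p)" by (rule ennreal_leI)
      also have "\<dots> = ennreal ?C + ennreal (norm (h t) powr p)" by (rule ennreal_plus) auto
      finally have "ennreal (norm (h t - c)) \<le> ennreal ?C + ennreal (norm (h t) powr p)" .
      then show "ennreal (norm (h t - c)) * indicator {x - r..x + r} t \<le> ennreal ?C * indicator {x - r..x + r} t + ennreal (norm (h t) powr p)"
        by (auto simp: indicator_def)
    qed
    also have "\<dots> = ennreal ?C * ennreal (2 * r) + ennreal m"
      unfolding m(1)[symmetric] lp_mass_def using r d by (subst nn_integral_add) (auto simp: nn_integral_cmult)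
    also have "\<dots> = ennreal (?C * (2 * r) + m)"
      using r d m by (subst ennreal_mult''[symmetric], simp, subst ennreal_plus[symmetric]) auto
    also have "\<dots> \<le> ennreal ((2 * ?C + m / d) * r)"
    proof (rule ennreal_leI)
      have "m * 1 \<le> m * (r / d)" using r d m by (intro mult_left_mono) auto
      then show "?C * (2 * r) + m \<le> (2 * ?C + m / d) * r" by (simp add: algebra_simps)
    qed
    finally show "mean_dev h c x r \<le> ennreal ((2 * ?C + m / d) * r)" .
  qed
qed

text \<open>
  In the superposition of intervals, those of radius below d are small because x is a
  Lebesgue point. The others have deviation at most M times the radius, and the tail of the
  kernel gives them a total weight of order y/d.
\<close>

lemma poisson_dev_small:
  assumes p: "1 < p" and h: "lp_fun p h" and x: "lebesgue_point h x" and e: "e > 0"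
  shows "\<exists>d>0. \<forall>y. 0 < y \<longrightarrow> y < d \<longrightarrow> poisson_dev h x y \<le> ennreal e"
proof -
  have [measurable]: "h \<in> borel_measurable borel" using h by (simp add: lp_fun_def)
  have "e / 4 > 0" using e by simp
  from x[unfolded lebesgue_point_def, rule_format, OF this]
  obtain d where d: "d > 0" "\<And>r. 0 < r \<Longrightarrow> r < d \<Longrightarrow> mean_dev h (h x) x r \<le> ennreal (e / 4 * r)"
    by blast
  obtain M where M: "M \<ge> 0" "\<And>r. r \<ge> d \<Longrightarrow> mean_dev h (h x) x r \<le> ennreal (M * r)"
    using mean_dev_large[OF p h d(1)] by blast
  have md: "mean_dev h (h x) x r \<le> ennreal (e / 4 * r) + ennreal (M * r) * indicator {d..} r" if "r > 0" for r
    using d(2)[of r] M(2)[of r] that by (cases "r < d") (auto simp: add_increasing)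
  show ?thesis
  proof (intro exI conjI allI impI)
    \<comment> \<open>M + 1 instead of M because M may be 0\<close>
    show "0 < d * e / (4 * (M + 1))" using d e M by auto
    fix y assume y: "0 < y" "y < d * e / (4 * (M + 1))"
    have "poisson_dev h x y \<le> (\<integral>\<^sup>+r. (ennreal (e / 2) * ennreal (pkern r) + ennreal (2 * M) * (ennreal (pkern r) * indicator {d / y..} r)) \<partial>lborel)"
      unfolding poisson_dev_eq[OF \<open>h \<in> borel_measurable borel\<close> y(1)]
    proof (rule nn_integral_mono_AE)
      have "AE r in lborel. r \<noteq> (0::real)" by (rule AE_lborel_singleton)
      then show "AE r in lborel. ennreal (pkern_slope r) * (ennreal (1 / y) * mean_dev h (h x) x (y * r)) * indicator {0..} r
        \<le> ennreal (e / 2) * ennreal (pkern r) + ennreal (2 * M) * (ennreal (pkern r) * indicator {d / y..} r)"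
      proof eventually_elim
        case (elim r)
        show ?case
        proof (cases "r > 0")
          case True
          have sl: "0 \<le> pkern_slope r" using True by (simp add: pkern_slope_def)
          have ind: "indicator {d..} (y * r) = (indicator {d / y..} r :: ennreal)"
            using y True by (auto simp: indicator_def field_simps)
          have "ennreal (pkern_slope r) * (ennreal (1 / y) * mean_dev h (h x) x (y * r))
            \<le> ennreal (pkern_slope r) * (ennreal (1 / y) * (ennreal (e / 4 * (y * r)) + ennreal (M * (y * r)) * indicator {d..} (y * r)))"
            using y True by (intro mult_left_mono md) auto
          also have "\<dots> = ennreal (pkern_slope r) * ennreal (1 / y) * ennreal (e / 4 * (y * r)) + ennreal (pkern_slope r) * ennreal (1 / y) * ennreal (M * (y * r)) * indicator {d / y..} r"
            by (simp add: ind distrib_left mult.assoc)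
          also have "ennreal (pkern_slope r) * ennreal (1 / y) * ennreal (e / 4 * (y * r)) = ennreal (e / 4 * (pkern_slope r * r))"
            using y True e sl by (simp add: field_simps flip: ennreal_mult)
          also have "ennreal (pkern_slope r) * ennreal (1 / y) * ennreal (M * (y * r)) = ennreal (M * (pkern_slope r * r))"
            using y True M sl by (simp add: field_simps flip: ennreal_mult)
          also have "ennreal (e / 4 * (pkern_slope r * r)) \<le> ennreal (e / 2 * pkern r)"
            using mult_left_mono[OF pkern_slope_le[of r], of "e / 4"] True e by (intro ennreal_leI) auto
          also have "ennreal (M * (pkern_slope r * r)) \<le> ennreal (2 * M * pkern r)"
            using mult_left_mono[OF pkern_slope_le[of r], of M] True M by (intro ennreal_leI) auto
          finally have "ennreal (pkern_slope r) * (ennreal (1 / y) * mean_dev h (h x) x (y * r)) \<le>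
              ennreal (e / 2 * pkern r) + ennreal (2 * M * pkern r) * indicator {d / y..} r"
            by (simp add: mult_right_mono add_mono)
          moreover have "ennreal (e / 2 * pkern r) = ennreal (e / 2) * ennreal (pkern r)"
            "ennreal (2 * M * pkern r) = ennreal (2 * M) * ennreal (pkern r)"
            using e M pkern_pos[of r] by (intro ennreal_mult; simp)+
          moreover have "indicator {0..} r = (1::ennreal)" using True by simp
          ultimately show ?thesis by (simp only: mult.assoc mult_1_right)
        next
          case False
          then show ?thesis using elim by simp
        qed
      qed
    qed
    also have "\<dots> = ennreal (e / 2) * (\<integral>\<^sup>+r. ennreal (pkern r) \<partial>lborel) + ennreal (2 * M) * (\<integral>\<^sup>+r. ennreal (pkern r) * indicator {d / y..} r \<partial>lborel)"
      by (simp add: nn_integral_add nn_integral_cmult)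
    also have "\<dots> \<le> ennreal (e / 2) * 1 + ennreal (2 * M) * ennreal (1 / (d / y))"
      using d y by (intro add_mono mult_left_mono pkern_tail) (auto simp: nn_integral_pkern)
    also have "\<dots> = ennreal (e / 2 + 2 * M * y / d)"
      using e M d y by (simp flip: ennreal_mult ennreal_plus)
    also have "\<dots> \<le> ennreal e"
    proof (rule ennreal_leI)
      have "y * (4 * (M + 1)) \<le> d * e" using y M by (simp add: field_simps)
      then have "2 * M * y \<le> e / 2 * d" using y M by (simp add: algebra_simps)
      then have "2 * M * y / d \<le> e / 2" using d by (simp add: field_simps)
      then show "e / 2 + 2 * M * y / d \<le> e" by simp
    qed
    finally show "poisson_dev h x y \<le> ennreal e" .
  qed
qed

text \<open>
  In a cone of aperture a, moving the point from x to x' changes the Poisson kernel by a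
  factor of at most 2 + 2 a^2. So nontangential convergence follows from the estimate on the
  normal.
\<close>

lemma poisson_diff_le_dev:
  assumes p: "1 < p" and h: "lp_fun p h" and y: "y > 0" and a: "\<bar>x' - x\<bar> \<le> a * y"
  shows "ennreal (norm (poisson y h x' - h x)) \<le> ennreal (2 + 2 * a\<^sup>2) * poisson_dev h x y"
proof -
  have [measurable]: "h \<in> borel_measurable borel" using h by (simp add: lp_fun_def)
  define b where "b = (x' - x) / y"
  have b: "\<bar>b\<bar> \<le> a" using a y by (simp add: b_def abs_divide field_simps)
  have xb: "x' = x + y * b" using y by (simp add: b_def)
  have k: "pkern (u - b) \<le> (2 + 2 * a\<^sup>2) * pkern u" for u
  proof -
    have bb: "b\<^sup>2 \<le> a\<^sup>2" using b by (metis abs_ge_zero power2_abs power_mono)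
    have sq: "0 \<le> (u - 2 * b)\<^sup>2" by simp
    have prod0: "0 \<le> a\<^sup>2 * (u - b)\<^sup>2" by simp
    have "1 + u\<^sup>2 \<le> (2 + 2 * a\<^sup>2) * (1 + (u - b)\<^sup>2)"
      using bb sq prod0 by (simp add: power2_eq_square algebra_simps)
    moreover have "1 + u\<^sup>2 > 0" "1 + (u - b)\<^sup>2 > 0" by (simp_all add: add_pos_nonneg)
    moreover have "1 / (pi * P) \<le> C * (1 / (pi * Q))" if "Q \<le> C * P" "Q > 0" "P > 0" for C P Q :: real
      using that by (simp add: field_simps)
    ultimately show ?thesis unfolding pkern_def by blast
  qed
  have eq: "poisson y h x' - h x = (\<integral>u. of_real (pkern u) * (h (x' + y * u) - h x) \<partial>lborel)"
  proof -
    have "(\<integral>u. of_real (pkern u) * (h (x' + y * u) - h x) \<partial>lborel) = (\<integral>u. of_real (pkern u) * h (x' + y * u) - of_real (pkern u) * h x \<partial>lborel)"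
      by (simp add: right_diff_distrib)
    also have "\<dots> = poisson y h x' - (\<integral>u. of_real (pkern u) * h x \<partial>lborel)"
      unfolding poisson_def using poisson_integrable[OF p h, of y x'] y integrable_pkern
      by (intro Bochner_Integration.integral_diff) auto
    also have "(\<integral>u. of_real (pkern u) * h x \<partial>lborel) = h x"
      using integral_pkern by (simp only: integral_mult_left_zero integral_complex_of_real) simp
    finally show ?thesis by simp
  qed
  have "integrable lborel (\<lambda>u. of_real (pkern u) * h (x' + y * u) - of_real (pkern u) * h x)"
    using poisson_integrable[OF p h, of y x'] y integrable_pkern by (intro Bochner_Integration.integrable_diff) auto
  then have int: "integrable lborel (\<lambda>u. of_real (pkern u) * (h (x' + y * u) - h x))"
    by (simp only: right_diff_distrib)
  have "ennreal (norm (poisson y h x' - h x)) \<le> (\<integral>\<^sup>+u. ennreal (norm (of_real (pkern u) * (h (x' + y * u) - h x))) \<partial>lborel)"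
    unfolding eq by (rule integral_norm_bound_ennreal[OF int])
  also have "\<dots> = (\<integral>\<^sup>+u. ennreal (norm (of_real (pkern (- b + 1 * u)) * (h (x' + y * (- b + 1 * u)) - h x))) \<partial>lborel)"
    using nn_integral_real_affine[of "\<lambda>u. ennreal (norm (of_real (pkern u) * (h (x' + y * u) - h x)))" 1 "- b"] by simp
  also have "\<dots> \<le> (\<integral>\<^sup>+u. ennreal (2 + 2 * a\<^sup>2) * (ennreal (pkern u) * ennreal (norm (h (x + y * u) - h x))) \<partial>lborel)"
  proof (intro nn_integral_mono)
    fix u
    have "x' + y * (- b + 1 * u) = x + y * u" by (simp add: xb algebra_simps)
    then have "norm (of_real (pkern (- b + 1 * u)) * (h (x' + y * (- b + 1 * u)) - h x)) = pkern (u - b) * norm (h (x + y * u) - h x)"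
      using pkern_pos[of "u - b"] by (simp only: norm_mult norm_of_real) simp
    also have "\<dots> \<le> (2 + 2 * a\<^sup>2) * pkern u * norm (h (x + y * u) - h x)"
      using k by (intro mult_right_mono) auto
    finally have "ennreal (norm (of_real (pkern (- b + 1 * u)) * (h (x' + y * (- b + 1 * u)) - h x))) \<le> ennreal ((2 + 2 * a\<^sup>2) * pkern u * norm (h (x + y * u) - h x))"
      by (rule ennreal_leI)
    also have "\<dots> = ennreal (2 + 2 * a\<^sup>2) * (ennreal (pkern u) * ennreal (norm (h (x + y * u) - h x)))"
      using pkern_pos[of u] by (simp add: ennreal_mult less_imp_le mult.assoc)
    finally show "ennreal (norm (of_real (pkern (- b + 1 * u)) * (h (x' + y * (- b + 1 * u)) - h x))) \<le> ennreal (2 + 2 * a\<^sup>2) * (ennreal (pkern u) * ennreal (norm (h (x + y * u) - h x)))" .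
  qed
  also have "\<dots> = ennreal (2 + 2 * a\<^sup>2) * poisson_dev h x y"
    unfolding poisson_dev_def by (intro nn_integral_cmult) measurable
  finally show ?thesis .
qed

lemma poisson_nontangential:
  assumes p: "1 < p" and h: "lp_fun p h" and x: "lebesgue_point h x" and e: "e > 0"
  shows "\<exists>d>0. \<forall>y x'. 0 < y \<longrightarrow> y < d \<longrightarrow> \<bar>x' - x\<bar> \<le> a * y \<longrightarrow> norm (poisson y h x' - h x) \<le> e"
proof -
  have K: "2 + 2 * a\<^sup>2 > 0" by (simp add: add_pos_nonneg)
  then have "e / (2 + 2 * a\<^sup>2) > 0" using e by simp
  from poisson_dev_small[OF p h x this] obtain d where d: "d > 0"
    "\<And>y. 0 < y \<Longrightarrow> y < d \<Longrightarrow> poisson_dev h x y \<le> ennreal (e / (2 + 2 * a\<^sup>2))" by blast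
  show ?thesis
  proof (intro exI conjI allI impI)
    show "d > 0" by fact
    fix y x' assume y: "0 < y" "y < d" "\<bar>x' - x\<bar> \<le> a * y"
    have "ennreal (norm (poisson y h x' - h x)) \<le> ennreal (2 + 2 * a\<^sup>2) * poisson_dev h x y"
      by (rule poisson_diff_le_dev[OF p h y(1,3)])
    also have "\<dots> \<le> ennreal (2 + 2 * a\<^sup>2) * ennreal (e / (2 + 2 * a\<^sup>2))"
      by (intro mult_left_mono d(2) y) auto
    also have "\<dots> = ennreal e" using K e by (subst ennreal_mult[symmetric]) auto
    finally show "norm (poisson y h x' - h x) \<le> e" using e by (simp add: ennreal_le_iff)
  qed
qed

section \<open>Boundary values of Cauchy integrals\<close>

text \<open>
  The Poisson integrals converge almost everywhere and their norms do not exceed that of f.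
  Fatou's lemma for the nonnegative functions 2^p (|P f|^p + |f|^p) - |P f - f|^p turns this
  into convergence in norm.
\<close>

lemma poisson_lp_mass_tendsto:
  assumes p: "1 < p" and f: "lp_fun p f" and dpos: "\<And>n::nat. d n > 0" and d0: "d \<longlonglongrightarrow> 0"
  shows "(\<lambda>n. lp_mass p (\<lambda>x. poisson (d n) f x - f x)) \<longlonglongrightarrow> 0"
proof -
  have fm [measurable]: "f \<in> borel_measurable borel" using f by (simp add: lp_fun_def)
  let ?P = "\<lambda>n x. poisson (d n) f x"
  define c where "c = (2::real) powr p"
  have c: "c > 0" by (simp add: c_def)
  define I where "I = (\<lambda>n. \<integral>x. norm (?P n x - f x) powr p \<partial>lborel)"
  define m where "m = (\<integral>x. norm (f x) powr p \<partial>lborel)"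
  have lP: "lp_fun p (?P n)" for n by (rule poisson_lp_fun[OF p f])
  have lD: "lp_fun p (\<lambda>x. ?P n x - f x)" for n
    using lp_fun_add[of p "?P n" "\<lambda>x. (-1) * f x"] p lP lp_fun_cmult[OF f, of "-1"] by simp
  have mI: "lp_mass p (\<lambda>x. ?P n x - f x) = ennreal (I n)" for n
    unfolding lp_mass_def I_def using lp_integrable[OF lD] by (intro nn_integral_eq_integral) auto
  have mm: "lp_mass p f = ennreal m"
    unfolding lp_mass_def m_def using lp_integrable[OF f] by (intro nn_integral_eq_integral) auto
  have m0: "m \<ge> 0" and I0: "I n \<ge> 0" for n by (simp_all add: m_def I_def)
  have Pm: "(\<integral>x. norm (?P n x) powr p \<partial>lborel) \<le> m" for n
  proof -
    have "ennreal (\<integral>x. norm (?P n x) powr p \<partial>lborel) = lp_mass p (?P n)"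
      unfolding lp_mass_def using lp_integrable[OF lP] by (intro nn_integral_eq_integral[symmetric]) auto
    also have "\<dots> \<le> ennreal m" using poisson_contraction[OF p f] mm by simp
    finally show ?thesis using m0 by (simp add: ennreal_le_iff)
  qed
  define g where "g = (\<lambda>n x. c * (norm (?P n x) powr p + norm (f x) powr p) - norm (?P n x - f x) powr p)"
  have g0: "g n x \<ge> 0" for n x
  proof -
    have "norm (?P n x - f x) powr p \<le> (norm (?P n x) + norm (f x)) powr p"
      using p by (intro powr_mono2 norm_triangle_ineq4) auto
    also have "\<dots> \<le> c * (norm (?P n x) powr p + norm (f x) powr p)"
      unfolding c_def using p by (intro powr_add_bound) auto
    finally show ?thesis by (simp add: g_def)
  qed
  have ig: "integrable lborel (g n)" for n
    unfolding g_def using lp_integrable[OF lP] lp_integrable[OF f] lp_integrable[OF lD]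
    by (intro Bochner_Integration.integrable_diff integrable_mult_right Bochner_Integration.integrable_add)
  have gint: "(\<integral>x. g n x \<partial>lborel) \<le> 2 * c * m - I n" for n
  proof -
    have "(\<integral>x. g n x \<partial>lborel) = c * ((\<integral>x. norm (?P n x) powr p \<partial>lborel) + m) - I n"
      unfolding g_def I_def m_def using lp_integrable[OF lP] lp_integrable[OF f] lp_integrable[OF lD]
      by (subst Bochner_Integration.integral_diff) (auto simp: distrib_left)
    also have "\<dots> \<le> 2 * c * m - I n" using mult_left_mono[OF Pm[of n], of c] c by (simp add: algebra_simps)
    finally show ?thesis .
  qed
  have gI: "(\<integral>\<^sup>+x. ennreal (g n x) \<partial>lborel) \<le> ennreal (2 * c * m - I n)" for n
  proof -
    have "(\<integral>\<^sup>+x. ennreal (g n x) \<partial>lborel) = ennreal (\<integral>x. g n x \<partial>lborel)"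
      using ig g0 by (intro nn_integral_eq_integral) auto
    then show ?thesis using gint[of n] by (simp add: ennreal_leI)
  qed
  have gm [measurable]: "g n \<in> borel_measurable borel" for n using ig[of n] by auto
  have "ennreal (2 * c * m) = (\<integral>\<^sup>+x. ennreal (2 * c) * ennreal (norm (f x) powr p) \<partial>lborel)"
    using mm c m0 unfolding lp_mass_def by (simp add: nn_integral_cmult ennreal_mult)
  also have "\<dots> = (\<integral>\<^sup>+x. liminf (\<lambda>n. ennreal (g n x)) \<partial>lborel)"
  proof (rule nn_integral_cong_AE)
    show "AE x in lborel. ennreal (2 * c) * ennreal (norm (f x) powr p) = liminf (\<lambda>n. ennreal (g n x))"
      using lebesgue_differentiation[OF p f]
    proof eventually_elim
      case (elim x)
      have "(\<lambda>n. ?P n x) \<longlonglongrightarrow> f x"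
      proof (rule LIMSEQ_I)
        fix r :: real assume r: "0 < r"
        obtain s where s: "s > 0" "\<And>y x'. 0 < y \<Longrightarrow> y < s \<Longrightarrow> \<bar>x' - x\<bar> \<le> 0 * y \<Longrightarrow> norm (poisson y f x' - f x) \<le> r / 2"
          using poisson_nontangential[OF p f elim, of "r / 2" 0] r by auto
        obtain N where N: "\<And>n. n \<ge> N \<Longrightarrow> norm (d n - 0) < s"
          using LIMSEQ_D[OF d0 s(1)] by blast
        have "norm (?P n x - f x) < r" if "n \<ge> N" for n
        proof -
          have "norm (?P n x - f x) \<le> r / 2" using s(2)[of "d n" x] N[OF that] dpos[of n] by simp
          then show ?thesis using r by linarith
        qed
        then show "\<exists>N. \<forall>n\<ge>N. norm (?P n x - f x) < r" by blast
      qed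
      then have "(\<lambda>n. c * (norm (?P n x) powr p + norm (f x) powr p) - norm (?P n x - f x) powr p) \<longlonglongrightarrow>
          c * (norm (f x) powr p + norm (f x) powr p) - norm (f x - f x) powr p"
        using p by (intro tendsto_intros tendsto_powr') auto
      then have "(\<lambda>n. g n x) \<longlonglongrightarrow> 2 * c * norm (f x) powr p"
        unfolding g_def using p by (simp add: mult_ac)
      then have "(\<lambda>n. ennreal (g n x)) \<longlonglongrightarrow> ennreal (2 * c * norm (f x) powr p)" by (rule tendsto_ennrealI)
      then have "liminf (\<lambda>n. ennreal (g n x)) = ennreal (2 * c * norm (f x) powr p)" by (intro lim_imp_Liminf) auto
      then show ?case using c by (simp add: ennreal_mult)
    qed
  qed
  also have "\<dots> \<le> liminf (\<lambda>n. \<integral>\<^sup>+x. ennreal (g n x) \<partial>lborel)"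
    by (intro nn_integral_liminf) auto
  also have "\<dots> \<le> liminf (\<lambda>n. ennreal (2 * c * m - I n))"
    by (intro Liminf_mono always_eventually allI gI)
  finally have key: "ennreal (2 * c * m) \<le> liminf (\<lambda>n. ennreal (2 * c * m - I n))" .
  have Ile: "I n \<le> 2 * c * m" for n
  proof -
    have "0 \<le> (\<integral>x. g n x \<partial>lborel)" using g0 by simp
    then show ?thesis using gint[of n] by simp
  qed
  have "I \<longlonglongrightarrow> 0"
  proof (cases "m = 0")
    case True
    have "I n = 0" for n using Ile[of n] I0[of n] True by simp
    then have "I = (\<lambda>n. 0)" by (simp add: fun_eq_iff)
    then show ?thesis by simp
  next
    case False
    then have cm: "2 * c * m > 0" using c m0 by simp
    show ?thesis
    proof (rule order_tendstoI)
      fix a :: real assume "a < 0"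
      then show "eventually (\<lambda>n. a < I n) sequentially" using I0 by (intro always_eventually allI) (metis less_le_trans)
    next
      fix a :: real assume a: "0 < a"
      have "ennreal (2 * c * m - a) < ennreal (2 * c * m)" using a cm by (intro ennreal_lessI) auto
      also note key
      finally have "eventually (\<lambda>n. ennreal (2 * c * m - a) < ennreal (2 * c * m - I n)) sequentially"
        by (rule less_LiminfD)
      then show "eventually (\<lambda>n. I n < a) sequentially"
      proof eventually_elim
        case (elim n)
        show ?case
        proof (rule ccontr)
          assume "\<not> I n < a"
          then have "ennreal (2 * c * m - I n) \<le> ennreal (2 * c * m - a)" by (intro ennreal_leI) simp
          with elim show False by simp
        qed
      qed
    qed
  qed
  then have "(\<lambda>n. ennreal (I n)) \<longlonglongrightarrow> ennreal 0" by (rule tendsto_ennrealI)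
  then show ?thesis by (simp add: mI)
qed

lemma poisson_lp_mass_small:
  assumes p: "1 < p" and f: "lp_fun p f" and e: "(e::real) > 0"
  shows "\<exists>d>0. \<forall>y. 0 < y \<longrightarrow> y < d \<longrightarrow> lp_mass p (\<lambda>x. poisson y f x - f x) \<le> ennreal e"
proof (rule ccontr)
  assume "\<not> ?thesis"
  then have "\<forall>n::nat. \<exists>y. 0 < y \<and> y < 1 / Suc n \<and> \<not> lp_mass p (\<lambda>x. poisson y f x - f x) \<le> ennreal e"
    by (metis zero_less_divide_1_iff of_nat_0_less_iff zero_less_Suc)
  then obtain d where d: "\<And>n::nat. 0 < d n \<and> d n < 1 / Suc n \<and> \<not> lp_mass p (\<lambda>x. poisson (d n) f x - f x) \<le> ennreal e"
    by metis
  have "d \<longlonglongrightarrow> 0"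
  proof (rule tendsto_sandwich)
    show "eventually (\<lambda>n. 0 \<le> d n) sequentially" "eventually (\<lambda>n. d n \<le> 1 / real (Suc n)) sequentially"
      using d by (auto intro!: always_eventually less_imp_le)
    show "(\<lambda>n. 1 / real (Suc n)) \<longlonglongrightarrow> 0" by (rule LIMSEQ_Suc[OF lim_1_over_n])
  qed simp
  from poisson_lp_mass_tendsto[OF p f _ this] have "(\<lambda>n. lp_mass p (\<lambda>x. poisson (d n) f x - f x)) \<longlonglongrightarrow> 0" using d by blast
  then have "eventually (\<lambda>n. lp_mass p (\<lambda>x. poisson (d n) f x - f x) < ennreal e) sequentially"
    using e by (intro order_tendstoD(2)) auto
  then obtain n where "lp_mass p (\<lambda>x. poisson (d n) f x - f x) < ennreal e" by (auto simp: eventually_sequentially)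
  then show False using d[of n] less_imp_le by blast
qed

text \<open>
  The completeness argument of Riesz and Fischer. The rate of the sequence makes the series
  of 2^(n p) |h(n+1) - h(n)|^p converge almost everywhere, so that the differences decay
  geometrically there.
\<close>

lemma lp_fast_cauchy_converges:
  fixes h :: "nat \<Rightarrow> real \<Rightarrow> complex"
  assumes p: "1 < p" and hm [measurable]: "\<And>n. h n \<in> borel_measurable borel"
    and fast: "\<And>n m. n \<le> m \<Longrightarrow> lp_mass p (\<lambda>x. h m x - h n x) \<le> ennreal ((1 / 4 ^ n) powr p)"
  shows "\<exists>k. k \<in> borel_measurable borel \<and> (AE x in lborel. (\<lambda>n. h n x) \<longlonglongrightarrow> k x) \<and>
    (\<forall>n. lp_mass p (\<lambda>x. h n x - k x) \<le> ennreal ((1 / 4 ^ n) powr p))"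
proof -
  define D where "D = (\<lambda>n x. h (Suc n) x - h n x)"
  have [measurable]: "D n \<in> borel_measurable borel" for n unfolding D_def by measurable
  \<comment> \<open>the factor 2^n leaves a convergent geometric series and still forces geometric decay\<close>
  define S where "S = (\<lambda>x. \<Sum>n. ennreal ((2 ^ n) powr p) * ennreal (norm (D n x) powr p))"
  have [measurable]: "S \<in> borel_measurable borel" unfolding S_def by measurable
  define r where "r = (1 / 2 :: real) powr p"
  have "(1 / 2 :: real) powr p \<le> (1 / 2) powr 1" using p by (intro powr_mono') auto
  then have r: "0 < r" "r < 1" by (auto simp: r_def)
  have "(\<integral>\<^sup>+x. S x \<partial>lborel) = (\<Sum>n. ennreal ((2 ^ n) powr p) * lp_mass p (D n))"
    unfolding S_def lp_mass_def by (subst nn_integral_suminf) (auto simp: nn_integral_cmult)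
  also have "\<dots> \<le> (\<Sum>n. ennreal (r ^ n))"
  proof (intro suminf_le)
    fix n
    have "ennreal ((2 ^ n) powr p) * lp_mass p (D n) \<le> ennreal ((2 ^ n) powr p) * ennreal ((1 / 4 ^ n) powr p)"
      unfolding D_def by (intro mult_left_mono fast) auto
    also have "\<dots> = ennreal ((2 ^ n) powr p * (1 / 4 ^ n) powr p)" by (simp add: ennreal_mult)
    also have "(2 ^ n) powr p * (1 / 4 ^ n) powr p = ((2 ^ n) * (1 / 4 ^ n)) powr p" by (rule powr_mult[symmetric]; simp)
    also have "(2::real) ^ n * (1 / 4 ^ n) = (1/2) ^ n"
      by (simp add: power_one_over power_divide[symmetric] flip: power_mult_distrib)
    also have "((1/2::real) ^ n) powr p = r ^ n"
      unfolding r_def by (simp add: powr_power powr_powr mult.commute flip: powr_realpow)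
    finally show "ennreal ((2 ^ n) powr p) * lp_mass p (D n) \<le> ennreal (r ^ n)" .
  qed auto
  also have "\<dots> = ennreal (\<Sum>n. r ^ n)" using r by (intro suminf_ennreal2 summable_geometric) auto
  also have "\<dots> < \<infinity>" by simp
  finally have "AE x in lborel. S x \<noteq> \<infinity>" by (intro nn_integral_PInf_AE) auto
  then have conv: "AE x in lborel. convergent (\<lambda>n. h n x)"
  proof eventually_elim
    case (elim x)
    then obtain s where s: "S x = ennreal s" "s \<ge> 0" by (cases "S x") auto
    define C where "C = s powr (1 / p)"
    have "norm (D n x) \<le> C * (1/2) ^ n" for n
    proof -
      have "ennreal ((2 ^ n) powr p) * ennreal (norm (D n x) powr p) \<le> S x"
        unfolding S_def using sum_le_suminf[of "\<lambda>n. ennreal ((2 ^ n) powr p) * ennreal (norm (D n x) powr p)" "{n}"] by simp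
      then have "ennreal ((2 ^ n * norm (D n x)) powr p) \<le> ennreal s"
        unfolding s(1) by (simp add: powr_mult ennreal_mult)
      then have "(2 ^ n * norm (D n x)) powr p \<le> s" using s(2) by (simp add: ennreal_le_iff)
      then have "((2 ^ n * norm (D n x)) powr p) powr (1 / p) \<le> C" unfolding C_def using p by (intro powr_mono2) auto
      then have "2 ^ n * norm (D n x) \<le> C" using p by (simp add: powr_powr)
      then show ?thesis by (simp add: field_simps power_divide)
    qed
    note bd = this
    have sg: "summable (\<lambda>n. C * (1/2) ^ n)" by (intro summable_mult summable_geometric) simp
    have "summable (\<lambda>n. D n x)"
      by (rule summable_comparison_test'[OF sg, of 0]) (rule bd)
    then have "summable (\<lambda>n. h (Suc n) x - h n x)" by (simp add: D_def)
    then have "convergent (\<lambda>n. \<Sum>i<n. h (Suc i) x - h i x)" by (simp add: summable_iff_convergent)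
    then have "convergent (\<lambda>n. h n x - h 0 x)" by (simp only: sum_lessThan_telescope[of "\<lambda>i. h i x"])
    then show ?case using convergent_diff_const_right_iff[of "\<lambda>n. h n x" "h 0 x"] by simp
  qed
  define k where "k = (\<lambda>x. lim (\<lambda>n. h n x))"
  have km [measurable]: "k \<in> borel_measurable borel"
    unfolding k_def by (rule borel_measurable_lim_metric) simp
  have klim: "AE x in lborel. (\<lambda>n. h n x) \<longlonglongrightarrow> k x"
    using conv by eventually_elim (simp add: k_def convergent_LIMSEQ_iff)
  have "lp_mass p (\<lambda>x. h n x - k x) \<le> ennreal ((1 / 4 ^ n) powr p)" for n
  proof (rule lp_mass_fatou_bound[where g = "\<lambda>j x. h n x - h (j + n) x"])
    show "AE x in lborel. (\<lambda>j. h n x - h (j + n) x) \<longlonglongrightarrow> h n x - k x"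
      using klim by eventually_elim (intro tendsto_intros LIMSEQ_ignore_initial_segment)
    show "lp_mass p (\<lambda>x. h n x - h (j + n) x) \<le> ennreal ((1 / 4 ^ n) powr p)" for j
      using fast[of n "j + n"] by (simp add: lp_mass_def norm_minus_commute)
  qed (use p in auto)
  then show ?thesis using km klim by blast
qed

text \<open>
  Write H y for the Cauchy integral on the line of height y. The difference of H (y + s) and
  H y is the Cauchy integral of the Poisson integral of f at height s minus f, which is
  small in \<open>L\<^sup>p\<close> uniformly in y by the theorem of Riesz. So a sequence of
  heights tending to 0 gives a limit h of the functions H in \<open>L\<^sup>p\<close>. Since
  averaging with the Poisson kernel at height y raises the point by y, passing to the limit
  in it gives the assertion.
\<close>

lemma cauchy_is_poisson:
  assumes p: "1 < p" and f: "lp_fun p f"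
  shows "\<exists>h. lp_fun p h \<and> (\<forall>x. \<forall>y>0. cauchy f (Complex x y) = poisson y h x)"
proof -
  have fm [measurable]: "f \<in> borel_measurable borel" using f by (simp add: lp_fun_def)
  obtain A where A: "A \<ge> 0" and riesz: "\<And>f y. lp_fun p f \<Longrightarrow> y \<noteq> 0 \<Longrightarrow> lp_mass p (\<lambda>x. cauchy f (Complex x y)) \<le> ennreal A * lp_mass p f"
    using riesz_cauchy[OF p] by blast
  define H where "H = (\<lambda>y x. cauchy f (Complex x y))"
  have Hm [measurable]: "H y \<in> borel_measurable borel" for y unfolding H_def by (rule cauchy_measurable_line) simp
  have lH: "lp_fun p (H y)" if "y \<noteq> 0" for y
  proof -
    have "lp_mass p (H y) \<le> ennreal A * lp_mass p f" unfolding H_def by (rule riesz[OF f that])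
    also have "\<dots> < \<infinity>" using f by (simp add: lp_fun_def ennreal_mult_less_top)
    finally show ?thesis by (simp add: lp_fun_def)
  qed
  have diff: "lp_mass p (\<lambda>x. H (y + s) x - H y x) \<le> ennreal A * lp_mass p (\<lambda>x. poisson s f x - f x)" if "y > 0" "s > 0" for y s
  proof -
    have l: "lp_fun p (poisson s f)" "lp_fun p (\<lambda>x. (-1) * f x)" by (rule poisson_lp_fun[OF p f]) (rule lp_fun_cmult[OF f])
    have l2: "lp_fun p (\<lambda>x. poisson s f x + (-1) * f x)" using lp_fun_add[of p, OF _ l] p by simp
    have "H (y + s) x - H y x = cauchy (\<lambda>t. poisson s f t + (-1) * f t) (Complex x y)" for x
      unfolding H_def using cauchy_average(2)[OF p f that] cauchy_add[OF p l, of "Complex x y"] cauchy_cmult[of "-1" f "Complex x y"] that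
      by simp
    then have "lp_mass p (\<lambda>x. H (y + s) x - H y x) = lp_mass p (\<lambda>x. cauchy (\<lambda>t. poisson s f t + (-1) * f t) (Complex x y))"
      by simp
    also have "\<dots> \<le> ennreal A * lp_mass p (\<lambda>t. poisson s f t + (-1) * f t)" using l2 that by (intro riesz) auto
    finally show ?thesis by simp
  qed
  have "\<exists>d>0. \<forall>s. 0 < s \<longrightarrow> s < d \<longrightarrow> ennreal A * lp_mass p (\<lambda>x. poisson s f x - f x) \<le> ennreal ((1 / 4 ^ n) powr p)" for n :: nat
  proof -
    have "(1 / 4 ^ n) powr p / (A + 1) > 0" using A by simp
    from poisson_lp_mass_small[OF p f this] obtain d where d: "d > 0"
      "\<And>s. 0 < s \<Longrightarrow> s < d \<Longrightarrow> lp_mass p (\<lambda>x. poisson s f x - f x) \<le> ennreal ((1 / 4 ^ n) powr p / (A + 1))" by blast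
    have "ennreal A * lp_mass p (\<lambda>x. poisson s f x - f x) \<le> ennreal ((1 / 4 ^ n) powr p)" if "0 < s" "s < d" for s
    proof -
      have "ennreal A * lp_mass p (\<lambda>x. poisson s f x - f x) \<le> ennreal A * ennreal ((1 / 4 ^ n) powr p / (A + 1))"
        using d(2)[OF that] by (intro mult_left_mono) auto
      also have "\<dots> = ennreal (A * ((1 / 4 ^ n) powr p / (A + 1)))" using A by (intro ennreal_mult[symmetric]) auto
      also have "\<dots> \<le> ennreal ((1 / 4 ^ n) powr p)"
        using A by (intro ennreal_leI) (simp add: field_simps)
      finally show ?thesis .
    qed
    then show ?thesis using d(1) by blast
  qed
  then obtain d where d: "\<And>n::nat. d n > 0"
    "\<And>n s. 0 < s \<Longrightarrow> s < d n \<Longrightarrow> ennreal A * lp_mass p (\<lambda>x. poisson s f x - f x) \<le> ennreal ((1 / 4 ^ n) powr p)"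
    by metis
  \<comment> \<open>dividing by n + 2 makes the heights tend to 0 and stay strictly below d n\<close>
  define \<epsilon> where "\<epsilon> = (\<lambda>n::nat. Min (d ` {..n}) / (n + 2))"
  have Mpos: "Min (d ` {..n}) > 0" for n using d(1) by (subst Min_gr_iff) auto
  have epos: "\<epsilon> n > 0" for n using Mpos[of n] by (simp add: \<epsilon>_def)
  have eless: "\<epsilon> n < d n" for n
  proof -
    have "\<epsilon> n < Min (d ` {..n})" unfolding \<epsilon>_def using Mpos[of n] by (simp add: divide_less_eq)
    also have "\<dots> \<le> d n" by (intro Min_le) auto
    finally show ?thesis .
  qed
  have edec: "\<epsilon> m \<le> \<epsilon> n" if "n \<le> m" for n m
    unfolding \<epsilon>_def using that Mpos[of n] Mpos[of m]
    by (intro frac_le Min_antimono) (auto intro: less_imp_le[OF d(1)])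
  have e0: "\<epsilon> \<longlonglongrightarrow> 0"
  proof (rule tendsto_sandwich)
    show "eventually (\<lambda>n. 0 \<le> \<epsilon> n) sequentially" using epos by (auto intro!: always_eventually less_imp_le)
    show "eventually (\<lambda>n. \<epsilon> n \<le> d 0 / real n) sequentially"
      using eventually_gt_at_top[of 0]
    proof eventually_elim
      case (elim n)
      have "Min (d ` {..n}) \<le> d 0" by (intro Min_le) auto
      then show ?case unfolding \<epsilon>_def using elim Mpos[of n] by (intro frac_le) (auto intro: less_imp_le[OF d(1)])
    qed
    show "(\<lambda>n. d 0 / real n) \<longlonglongrightarrow> 0" by (rule lim_const_over_n)
  qed simp
  have fast: "lp_mass p (\<lambda>x. H (\<epsilon> m) x - H (\<epsilon> n) x) \<le> ennreal ((1 / 4 ^ n) powr p)" if nm: "n \<le> m" for n m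
  proof (cases "\<epsilon> m = \<epsilon> n")
    case True
    then show ?thesis using p by (simp add: lp_mass_def)
  next
    case False
    define s where "s = \<epsilon> n - \<epsilon> m"
    have s: "0 < s" "s < d n" using False edec[OF nm] epos[of m] eless[of n] by (auto simp: s_def)
    have "lp_mass p (\<lambda>x. H (\<epsilon> m) x - H (\<epsilon> n) x) = lp_mass p (\<lambda>x. H (\<epsilon> m + s) x - H (\<epsilon> m) x)"
      unfolding lp_mass_def by (simp add: s_def norm_minus_commute)
    also have "\<dots> \<le> ennreal A * lp_mass p (\<lambda>x. poisson s f x - f x)" by (rule diff[OF epos s(1)])
    also have "\<dots> \<le> ennreal ((1 / 4 ^ n) powr p)" by (rule d(2)[OF s])
    finally show ?thesis .
  qed
  obtain h where hm [measurable]: "h \<in> borel_measurable borel" and hlim: "AE x in lborel. (\<lambda>n. H (\<epsilon> n) x) \<longlonglongrightarrow> h x"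
    and hfast: "\<And>n. lp_mass p (\<lambda>x. H (\<epsilon> n) x - h x) \<le> ennreal ((1 / 4 ^ n) powr p)"
    using lp_fast_cauchy_converges[OF p _ fast] by auto
  have lh: "lp_fun p h"
  proof -
    have "lp_mass p h \<le> ennreal A * lp_mass p f"
    proof (rule lp_mass_fatou_bound[OF _ _ hlim])
      show "lp_mass p (H (\<epsilon> n)) \<le> ennreal A * lp_mass p f" for n
        unfolding H_def using epos[of n] by (intro riesz[OF f]) auto
    qed (use p in auto)
    also have "\<dots> < \<infinity>" using f by (simp add: lp_fun_def ennreal_mult_less_top)
    finally show ?thesis by (simp add: lp_fun_def)
  qed
  have "cauchy f (Complex x y) = poisson y h x" if y: "y > 0" for x y
  proof -
    have lim1: "(\<lambda>n. cauchy f (Complex x (y + \<epsilon> n))) \<longlonglongrightarrow> cauchy f (Complex x y)"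
    proof -
      have "isCont (cauchy f) (Complex x y)" using y by (intro cauchy_isCont_nonreal[OF p f]) simp
      note isCont_tendsto_compose[OF this, of "\<lambda>n. Complex x (y + \<epsilon> n)" sequentially]
      moreover have "(\<lambda>n. Complex x (y + \<epsilon> n)) \<longlonglongrightarrow> Complex x (y + 0)" by (intro tendsto_intros e0)
      ultimately show ?thesis by simp
    qed
    have "(\<lambda>n. poisson y (H (\<epsilon> n)) x - poisson y h x) \<longlonglongrightarrow> 0"
    proof -
      have bound: "norm (poisson y (H (\<epsilon> n)) x - poisson y h x) \<le> (1 / y) powr (1 / p) * (1 / 4) ^ n" for n
      proof -
        have ln: "lp_fun p (H (\<epsilon> n))" using epos[of n] by (intro lH) auto
        have eq: "poisson y (H (\<epsilon> n)) x - poisson y h x = (\<integral>u. of_real (pkern u) * (H (\<epsilon> n) (x + y * u) - h (x + y * u)) \<partial>lborel)"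
          unfolding poisson_def right_diff_distrib using poisson_integrable[OF p ln] poisson_integrable[OF p lh] y
          by (intro Bochner_Integration.integral_diff[symmetric]) auto
        have "ennreal (norm (poisson y (H (\<epsilon> n)) x - poisson y h x) powr p) \<le> ennreal ((\<integral>u. pkern u \<partial>lborel) powr (p - 1)) *
           (\<integral>\<^sup>+u. ennreal (pkern u) * ennreal (norm (H (\<epsilon> n) (x + y * u) - h (x + y * u)) powr p) \<partial>lborel)"
          unfolding eq using pkern_pos integrable_pkern by (intro jensen_powr[OF p]) (auto simp: less_imp_le)
        also have "\<dots> \<le> (\<integral>\<^sup>+u. 1 * ennreal (norm (H (\<epsilon> n) (x + y * u) - h (x + y * u)) powr p) \<partial>lborel)"
        proof -
          have k1: "ennreal (pkern u) \<le> 1" for u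
          proof -
            have "1 * 1 \<le> pi * (1 + u\<^sup>2)" using pi_gt3 by (intro mult_mono) auto
            then have "1 / (pi * (1 + u\<^sup>2)) \<le> 1 / 1" by (intro divide_left_mono) auto
            then have "pkern u \<le> 1" unfolding pkern_def by simp
            then have "ennreal (pkern u) \<le> ennreal 1" by (rule ennreal_leI)
            then show ?thesis by simp
          qed
          have "(\<integral>\<^sup>+u. ennreal (pkern u) * ennreal (norm (H (\<epsilon> n) (x + y * u) - h (x + y * u)) powr p) \<partial>lborel)
            \<le> (\<integral>\<^sup>+u. 1 * ennreal (norm (H (\<epsilon> n) (x + y * u) - h (x + y * u)) powr p) \<partial>lborel)"
            by (intro nn_integral_mono mult_right_mono k1) simp
          then show ?thesis by (simp only: integral_pkern powr_one_eq_one ennreal_1 mult_1)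
        qed
        also have "\<dots> = lp_mass p (\<lambda>u. (\<lambda>t. H (\<epsilon> n) t - h t) (x + y * u))" by (simp add: lp_mass_def)
        also have "\<dots> = ennreal (1 / \<bar>y\<bar>) * lp_mass p (\<lambda>t. H (\<epsilon> n) t - h t)" using y by (intro lp_mass_affine) auto
        also have "\<dots> \<le> ennreal (1 / y) * ennreal ((1 / 4 ^ n) powr p)" using y hfast by (intro mult_mono) auto
        also have "\<dots> = ennreal (1 / y * (1 / 4 ^ n) powr p)" using y by (intro ennreal_mult[symmetric]) auto
        finally have "norm (poisson y (H (\<epsilon> n)) x - poisson y h x) powr p \<le> 1 / y * (1 / 4 ^ n) powr p"
          using y by (simp add: ennreal_le_iff)
        then have "(norm (poisson y (H (\<epsilon> n)) x - poisson y h x) powr p) powr (1 / p) \<le> (1 / y * (1 / 4 ^ n) powr p) powr (1 / p)"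
          using p by (intro powr_mono2) auto
        also have "(1 / y * (1 / 4 ^ n) powr p) powr (1 / p) = (1 / y) powr (1 / p) * (1 / 4 ^ n)"
          using y p by (subst powr_mult) (simp_all add: powr_powr)
        finally show ?thesis using p by (simp add: powr_powr power_one_over)
      qed
      have "(\<lambda>n. (1 / y) powr (1 / p) * (1 / 4) ^ n) \<longlonglongrightarrow> (1 / y) powr (1 / p) * 0"
        by (intro tendsto_intros LIMSEQ_power_zero) auto
      then have z: "(\<lambda>n. (1 / y) powr (1 / p) * (1 / 4) ^ n) \<longlonglongrightarrow> 0" by (simp only: mult_zero_right)
      show ?thesis by (rule Lim_null_comparison[OF _ z]) (intro always_eventually allI bound)
    qed
    then have "(\<lambda>n. poisson y (H (\<epsilon> n)) x) \<longlonglongrightarrow> poisson y h x" by (simp add: LIM_zero_iff)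
    moreover have "poisson y (H (\<epsilon> n)) x = cauchy f (Complex x (y + \<epsilon> n))" for n
      using cauchy_average(1)[OF p f epos y, of x n] by (simp add: poisson_def H_def add.commute)
    ultimately show ?thesis using lim1 LIMSEQ_unique by auto
  qed
  then show ?thesis using lh by blast
qed

definition nt_upper :: "(complex \<Rightarrow> complex) \<Rightarrow> real \<Rightarrow> complex \<Rightarrow> bool" where
  "nt_upper G x L \<longleftrightarrow> (\<forall>a>0. (G \<longlongrightarrow> L) (at (of_real x) within {z. 0 < Im z \<and> \<bar>Re z - x\<bar> < a * Im z}))"

definition nt_lower :: "(complex \<Rightarrow> complex) \<Rightarrow> real \<Rightarrow> complex \<Rightarrow> bool" where
  "nt_lower G x L \<longleftrightarrow> (\<forall>a>0. (G \<longlongrightarrow> L) (at (of_real x) within {z. Im z < 0 \<and> \<bar>Re z - x\<bar> < - a * Im z}))"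

lemma cauchy_nt_upper:
  assumes p: "1 < p" and f: "lp_fun p f"
  shows "\<exists>h. AE x in lborel. nt_upper (cauchy f) x (h x)"
proof -
  obtain h where h: "lp_fun p h" and eq: "\<And>x y. y > 0 \<Longrightarrow> cauchy f (Complex x y) = poisson y h x"
    using cauchy_is_poisson[OF p f] by blast
  have "AE x in lborel. nt_upper (cauchy f) x (h x)"
    using lebesgue_differentiation[OF p h]
  proof eventually_elim
    case (elim x)
    show ?case unfolding nt_upper_def
    proof (intro allI impI tendstoI)
      fix a e :: real assume a: "a > 0" and e: "e > 0"
      obtain d where d: "d > 0" "\<And>y x'. 0 < y \<Longrightarrow> y < d \<Longrightarrow> \<bar>x' - x\<bar> \<le> a * y \<Longrightarrow> norm (poisson y h x' - h x) \<le> e / 2"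
        using poisson_nontangential[OF p h elim, of "e / 2" a] e by auto
      show "eventually (\<lambda>z. dist (cauchy f z) (h x) < e) (at (of_real x) within {z. 0 < Im z \<and> \<bar>Re z - x\<bar> < a * Im z})"
        unfolding eventually_at
      proof (intro exI conjI ballI impI)
        show "d > 0" by fact
        fix z assume z: "z \<in> {z. 0 < Im z \<and> \<bar>Re z - x\<bar> < a * Im z}" "z \<noteq> of_real x \<and> dist z (of_real x) < d"
        have "Im z < d" using z abs_Im_le_cmod[of "z - of_real x"] by (simp add: dist_norm)
        then have "norm (poisson (Im z) h (Re z) - h x) \<le> e / 2" using z by (intro d(2)) auto
        then show "dist (cauchy f z) (h x) < e" using eq[of "Im z" "Re z"] z e by (simp add: dist_norm)
      qed
    qed
  qed
  then show ?thesis by blast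
qed

lemma cauchy_nt_lower:
  assumes p: "1 < p" and f: "lp_fun p f"
  shows "\<exists>h. AE x in lborel. nt_lower (cauchy f) x (h x)"
proof -
  obtain h where h: "AE x in lborel. nt_upper (cauchy (\<lambda>t. cnj (f t))) x (h x)"
    using cauchy_nt_upper[OF p, of "\<lambda>t. cnj (f t)"] f by (auto simp: lp_fun_cnj)
  have "AE x in lborel. nt_lower (cauchy f) x (- cnj (h x))"
    using h
  proof eventually_elim
    case (elim x)
    show ?case unfolding nt_lower_def
    proof (intro allI impI)
      fix a :: real assume a: "a > 0"
      let ?U = "{z. 0 < Im z \<and> \<bar>Re z - x\<bar> < a * Im z}"
      let ?L = "{z. Im z < 0 \<and> \<bar>Re z - x\<bar> < - a * Im z}"
      have "(cauchy (\<lambda>t. cnj (f t)) \<longlongrightarrow> h x) (at (of_real x) within ?U)" using elim a by (simp add: nt_upper_def)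
      moreover have "filterlim cnj (at (of_real x) within ?U) (at (of_real x) within ?L)"
        unfolding filterlim_at
      proof
        show "eventually (\<lambda>z. cnj z \<in> ?U \<and> cnj z \<noteq> of_real x) (at (of_real x) within ?L)"
          unfolding eventually_at_filter by (intro always_eventually) (auto simp: complex_eq_iff)
        have "((\<lambda>z. cnj z) \<longlongrightarrow> cnj (of_real x)) (at (of_real x) within ?L)" by (intro tendsto_intros)
        then show "(cnj \<longlongrightarrow> of_real x) (at (of_real x) within ?L)" by simp
      qed
      ultimately have "((\<lambda>z. cauchy (\<lambda>t. cnj (f t)) (cnj z)) \<longlongrightarrow> h x) (at (of_real x) within ?L)"
        by (rule filterlim_compose)
      then have "((\<lambda>z. - cnj (cauchy (\<lambda>t. cnj (f t)) (cnj z))) \<longlongrightarrow> - cnj (h x)) (at (of_real x) within ?L)"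
        by (intro tendsto_intros)
      moreover have "- cnj (cauchy (\<lambda>t. cnj (f t)) (cnj z)) = cauchy f z" for z
        using cauchy_cnj[of "\<lambda>t. cnj (f t)" "cnj z"] by simp
      ultimately show "(cauchy f \<longlongrightarrow> - cnj (h x)) (at (of_real x) within ?L)" by simp
    qed
  qed
  then show ?thesis by (rule exI[of _ "\<lambda>x. - cnj (h x)"])
qed

text \<open>
  The two limits exist by the Poisson representation on either side. Along the normal their
  difference is the limit of the Poisson integral of f.
\<close>

theorem cauchy_boundary_values:
  assumes p: "1 < p" and f: "lp_fun p f"
  shows "\<exists>hp hm. AE x in lborel. nt_upper (cauchy f) x (hp x) \<and> nt_lower (cauchy f) x (hm x) \<and> hp x - hm x = f x"
proof -
  obtain hp hm where hp: "AE x in lborel. nt_upper (cauchy f) x (hp x)" and hm: "AE x in lborel. nt_lower (cauchy f) x (hm x)"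
    using cauchy_nt_upper[OF p f] cauchy_nt_lower[OF p f] by blast
  have "AE x in lborel. nt_upper (cauchy f) x (hp x) \<and> nt_lower (cauchy f) x (hm x) \<and> hp x - hm x = f x"
    using hp hm lebesgue_differentiation[OF p f]
  proof eventually_elim
    case (elim x)
    have up: "((\<lambda>y. cauchy f (Complex x y)) \<longlongrightarrow> hp x) (at_right 0)"
    proof -
      let ?U = "{z. 0 < Im z \<and> \<bar>Re z - x\<bar> < 1 * Im z}"
      have "(cauchy f \<longlongrightarrow> hp x) (at (of_real x) within ?U)" using elim(1) unfolding nt_upper_def by (rule allE[of _ 1]) simp
      moreover have "filterlim (\<lambda>y. Complex x y) (at (of_real x) within ?U) (at_right 0)"
        unfolding filterlim_at
      proof
        show "eventually (\<lambda>y. Complex x y \<in> ?U \<and> Complex x y \<noteq> of_real x) (at_right 0)"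
          unfolding eventually_at_filter by (intro always_eventually) (auto simp: complex_eq_iff)
        have "((\<lambda>y. Complex x y) \<longlongrightarrow> Complex x 0) (at_right 0)" by (intro tendsto_intros)
        then show "((\<lambda>y. Complex x y) \<longlongrightarrow> of_real x) (at_right 0)" by (simp add: complex_of_real_def)
      qed
      ultimately show ?thesis by (rule filterlim_compose)
    qed
    have down: "((\<lambda>y. cauchy f (Complex x (- y))) \<longlongrightarrow> hm x) (at_right 0)"
    proof -
      let ?U = "{z. Im z < 0 \<and> \<bar>Re z - x\<bar> < - 1 * Im z}"
      have "(cauchy f \<longlongrightarrow> hm x) (at (of_real x) within ?U)" using elim(2) unfolding nt_lower_def by (rule allE[of _ 1]) simp
      moreover have "filterlim (\<lambda>y. Complex x (- y)) (at (of_real x) within ?U) (at_right 0)"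
        unfolding filterlim_at
      proof
        show "eventually (\<lambda>y. Complex x (- y) \<in> ?U \<and> Complex x (- y) \<noteq> of_real x) (at_right 0)"
          unfolding eventually_at_filter by (intro always_eventually) (auto simp: complex_eq_iff)
        have "((\<lambda>y. Complex x (- y)) \<longlongrightarrow> Complex x (- 0)) (at_right 0)" by (intro tendsto_intros)
        then show "((\<lambda>y. Complex x (- y)) \<longlongrightarrow> of_real x) (at_right 0)" by (simp add: complex_of_real_def)
      qed
      ultimately show ?thesis by (rule filterlim_compose)
    qed
    have "((\<lambda>y. poisson y f x) \<longlongrightarrow> f x) (at_right 0)"
    proof (rule tendstoI)
      fix e :: real assume e: "e > 0"
      obtain d where d: "d > 0" "\<And>y x'. 0 < y \<Longrightarrow> y < d \<Longrightarrow> \<bar>x' - x\<bar> \<le> 0 * y \<Longrightarrow> norm (poisson y f x' - f x) \<le> e / 2"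
        using poisson_nontangential[OF p f elim(3), of "e / 2" 0] e by auto
      have "eventually (\<lambda>y. y \<in> {0<..<d}) (at_right 0)" using d(1) by (rule eventually_at_right_real)
      then show "eventually (\<lambda>y. dist (poisson y f x) (f x) < e) (at_right 0)"
      proof eventually_elim
        case (elim y)
        then have "norm (poisson y f x - f x) \<le> e / 2" using d(2)[of y x] by simp
        then show ?case using e by (simp add: dist_norm)
      qed
    qed
    moreover have "((\<lambda>y. poisson y f x) \<longlongrightarrow> hp x - hm x) (at_right 0)"
    proof (rule Lim_transform_eventually)
      show "((\<lambda>y. cauchy f (Complex x y) - cauchy f (Complex x (- y))) \<longlongrightarrow> hp x - hm x) (at_right 0)"
        by (intro tendsto_diff up down)
      show "eventually (\<lambda>y. cauchy f (Complex x y) - cauchy f (Complex x (- y)) = poisson y f x) (at_right 0)"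
        using eventually_at_right_less[of 0] by eventually_elim (rule cauchy_jump[OF p f])
    qed
    ultimately have "hp x - hm x = f x" by (intro tendsto_unique[OF trivial_limit_at_right_real])
    then show ?case using elim by blast
  qed
  then show ?thesis by blast
qed

section \<open>Arc length and boundary functions\<close>

text \<open>
  Inverse of the unit-speed parametrisation on the curve, by a formula that is Borel
  measurable on the whole plane.
\<close>

definition arc_coord :: "real \<Rightarrow> complex \<Rightarrow> real" where
  "arc_coord t w = Re w + sgn (Re w) * (Im w - t)"

lemma arc_coord_gpath: "0 < s \<Longrightarrow> arc_coord t (gpath s t x) = x"
  by (auto simp: arc_coord_def gpath_def sgn_if)

lemma arc_coord_measurable [measurable]: "arc_coord t \<in> borel_measurable borel"
  unfolding arc_coord_def[abs_def] by measurable

text \<open>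
  The parametrisation has a measurable inverse, so null sets on the curve are the images of
  null sets on the line.
\<close>

lemma AE_arc_length_iff:
  assumes s: "0 < s"
  shows "(AE \<zeta> in arc_length s t. P \<zeta>) \<longleftrightarrow> (AE x in lborel. P (gpath s t x))"
proof -
  let ?N = "restrict_space borel (Gamma s t)"
  let ?D = "distr lborel ?N (gpath s t)"
  have m: "gpath s t \<in> lborel \<rightarrow>\<^sub>M ?N" by (rule measurable_gpath[OF s])
  have "(AE \<zeta> in ?D. P \<zeta>) \<longleftrightarrow> (AE x in lborel. P (gpath s t x))"
  proof
    assume "AE \<zeta> in ?D. P \<zeta>"
    then show "AE x in lborel. P (gpath s t x)" by (rule AE_distrD[OF m])
  next
    assume "AE x in lborel. P (gpath s t x)"
    then obtain Z where Z: "Z \<in> null_sets lborel" "{x. \<not> P (gpath s t x)} \<subseteq> Z"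
      by (auto simp: eventually_ae_filter)
    have "AE x in lborel. arc_coord t (gpath s t x) \<notin> Z"
      using Z(1) by (simp add: arc_coord_gpath[OF s] AE_not_in)
    moreover have "{x \<in> space ?N. arc_coord t x \<notin> Z} \<in> sets ?N"
    proof -
      have [measurable]: "arc_coord t \<in> ?N \<rightarrow>\<^sub>M borel" by (rule measurable_restrict_space1) simp
      have [measurable]: "Z \<in> sets borel" using Z(1) by auto
      show ?thesis by measurable
    qed
    ultimately have "AE \<zeta> in ?D. arc_coord t \<zeta> \<notin> Z"
      by (subst AE_distr_iff[OF m])
    then show "AE \<zeta> in ?D. P \<zeta>"
    proof (rule AE_mp, intro AE_I2 impI)
      fix \<zeta> assume \<zeta>: "\<zeta> \<in> space ?D" "arc_coord t \<zeta> \<notin> Z"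
      then have "\<zeta> \<in> Gamma s t" by (simp add: space_restrict_space)
      then obtain x where "\<zeta> = gpath s t x" using range_gpath[OF s, of t] by auto
      then show "P \<zeta>" using \<zeta>(2) Z(2) arc_coord_gpath[OF s, of t x] by auto
    qed
  qed
  then show ?thesis unfolding arc_length_def AE_completion_iff .
qed

lemma nn_integral_arc_length:
  assumes s: "0 < s" and g: "g \<in> borel_measurable (restrict_space borel (Gamma s t))"
  shows "(\<integral>\<^sup>+\<zeta>. g \<zeta> \<partial>arc_length s t) = (\<integral>\<^sup>+x. g (gpath s t x) \<partial>lborel)"
  unfolding arc_length_def nn_integral_completion
  by (rule nn_integral_distr[OF measurable_gpath[OF s, of t]]) (simp add: g)

lemma borel_measurable_completion_AE_eq:
  assumes g: "g \<in> borel_measurable M" and eq: "AE x in M. f x = g x"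
  shows "f \<in> borel_measurable (completion M)"
proof (rule measurableI)
  fix A :: "'b set" assume A: "A \<in> sets borel"
  show "f -` A \<inter> space (completion M) \<in> sets (completion M)"
  proof (rule completion.in_sets_AE)
    show "AE x in completion M. x \<in> g -` A \<inter> space (completion M) \<longleftrightarrow> x \<in> f -` A \<inter> space (completion M)"
      using AE_completion[OF eq] by eventually_elim auto
    show "g -` A \<inter> space (completion M) \<in> sets (completion M)"
      using measurable_sets[OF g A] by auto
  qed auto
qed auto

text \<open>
  A function that is measurable for the completed arc length agrees almost everywhere with a
  Borel function; the whole problem thereby moves to Borel functions of the parameter.
\<close>

lemma Lp_arc_length_iff:
  assumes s: "0 < s"
  shows "F \<in> Lp p (arc_length s t) \<longleftrightarrow> (\<exists>G. lp_fun p G \<and> (AE x in lborel. F (gpath s t x) = G x))"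
proof -
  let ?N = "restrict_space borel (Gamma s t)"
  let ?D = "distr lborel ?N (gpath s t)"
  have m [measurable]: "gpath s t \<in> lborel \<rightarrow>\<^sub>M ?N" by (rule measurable_gpath[OF s])
  have mass: "(\<integral>\<^sup>+\<zeta>. ennreal (norm (F \<zeta>) powr p) \<partial>arc_length s t) = lp_mass p G"
    if [measurable]: "G \<in> borel_measurable borel" and eq: "AE x in lborel. F (gpath s t x) = G x" for G
  proof -
    have "AE \<zeta> in arc_length s t. F \<zeta> = G (arc_coord t \<zeta>)"
      unfolding AE_arc_length_iff[OF s] arc_coord_gpath[OF s] by (rule eq)
    then have "(\<integral>\<^sup>+\<zeta>. ennreal (norm (F \<zeta>) powr p) \<partial>arc_length s t) = (\<integral>\<^sup>+\<zeta>. ennreal (norm (G (arc_coord t \<zeta>)) powr p) \<partial>arc_length s t)"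
      by (intro nn_integral_cong_AE) (elim eventually_mono, simp)
    also have "\<dots> = (\<integral>\<^sup>+x. ennreal (norm (G (arc_coord t (gpath s t x))) powr p) \<partial>lborel)"
      by (intro nn_integral_arc_length[OF s] measurable_restrict_space1) measurable
    finally show ?thesis by (simp add: arc_coord_gpath[OF s] lp_mass_def)
  qed
  show ?thesis
  proof
    assume F: "F \<in> Lp p (arc_length s t)"
    then have Fm: "F \<in> borel_measurable (completion ?D)" and Fi: "integrable (arc_length s t) (\<lambda>x. norm (F x) powr p)"
      by (auto simp: Lp_def arc_length_def)
    from completion_ex_borel_measurable_real[of "\<lambda>x. Re (F x)" ?D] Fm
    obtain a where [measurable]: "a \<in> borel_measurable ?D" and a: "AE x in ?D. Re (F x) = a x" by auto
    from completion_ex_borel_measurable_real[of "\<lambda>x. Im (F x)" ?D] Fm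
    obtain b where [measurable]: "b \<in> borel_measurable ?D" and b: "AE x in ?D. Im (F x) = b x" by auto
    have [measurable]: "a \<in> borel_measurable ?N" "b \<in> borel_measurable ?N"
      using \<open>a \<in> borel_measurable ?D\<close> \<open>b \<in> borel_measurable ?D\<close> by simp_all
    define G where "G = (\<lambda>x. of_real (a (gpath s t x)) + \<i> * of_real (b (gpath s t x)))"
    have Gm: "G \<in> borel_measurable lborel" unfolding G_def by measurable
    have eq: "AE x in lborel. F (gpath s t x) = G x"
      using AE_distrD[OF m a] AE_distrD[OF m b] by eventually_elim (simp add: G_def complex_eq_iff)
    have "lp_mass p G < \<infinity>"
      using Fi mass[OF _ eq] Gm by (simp add: integrable_iff_bounded)
    then show "\<exists>G. lp_fun p G \<and> (AE x in lborel. F (gpath s t x) = G x)"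
      using Gm eq by (intro exI[of _ G]) (simp add: lp_fun_def)
  next
    assume "\<exists>G. lp_fun p G \<and> (AE x in lborel. F (gpath s t x) = G x)"
    then obtain G where G: "lp_fun p G" and eq: "AE x in lborel. F (gpath s t x) = G x" by blast
    have Gm [measurable]: "G \<in> borel_measurable borel" using G by (simp add: lp_fun_def)
    have "AE \<zeta> in arc_length s t. F \<zeta> = G (arc_coord t \<zeta>)"
      unfolding AE_arc_length_iff[OF s] arc_coord_gpath[OF s] by (rule eq)
    then have "AE \<zeta> in ?D. F \<zeta> = G (arc_coord t \<zeta>)" unfolding arc_length_def AE_completion_iff .
    then have Fm: "F \<in> borel_measurable (arc_length s t)"
      unfolding arc_length_def
    proof (rule borel_measurable_completion_AE_eq[rotated])
      show "(\<lambda>\<zeta>. G (arc_coord t \<zeta>)) \<in> borel_measurable ?D"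
        by (simp, intro measurable_restrict_space1) measurable
    qed
    have "integrable (arc_length s t) (\<lambda>x. norm (F x) powr p)"
    proof (rule integrableI_nonneg)
      show "(\<lambda>x. norm (F x) powr p) \<in> borel_measurable (arc_length s t)" using Fm by measurable
      show "(\<integral>\<^sup>+x. ennreal (norm (F x) powr p) \<partial>arc_length s t) < \<infinity>"
        using mass[OF Gm eq] G by (simp add: lp_fun_def)
    qed auto
    then show "F \<in> Lp p (arc_length s t)" using Fm by (simp add: Lp_def)
  qed
qed

lemma nn_integral_arc_length_continuous:
  assumes s: "0 < s" and F: "continuous_on S F" and S: "Gamma s t \<subseteq> S"
  shows "(\<integral>\<^sup>+\<zeta>. ennreal (norm (F \<zeta>) powr p) \<partial>arc_length s t) = lp_mass p (\<lambda>x. F (gpath s t x))"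
    and "(\<lambda>x. F (gpath s t x)) \<in> borel_measurable borel"
proof -
  have [measurable]: "F \<in> borel_measurable (restrict_space borel (Gamma s t))"
    by (rule borel_measurable_continuous_on_restrict[OF continuous_on_subset[OF F S]])
  show "(\<integral>\<^sup>+\<zeta>. ennreal (norm (F \<zeta>) powr p) \<partial>arc_length s t) = lp_mass p (\<lambda>x. F (gpath s t x))"
    unfolding lp_mass_def by (intro nn_integral_arc_length[OF s]) measurable
  have "(\<lambda>x. F (gpath s t x)) \<in> borel_measurable lborel"
    by (rule measurable_compose[OF measurable_gpath[OF s]]) simp
  then show "(\<lambda>x. F (gpath s t x)) \<in> borel_measurable borel" by simp
qed

lemma AE_lborel_affine:
  fixes P :: "real \<Rightarrow> bool"
  assumes c: "c \<noteq> 0" and P: "AE x in lborel. P x"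
  shows "AE x in lborel. P (t + c * x)"
proof -
  obtain Z where Z: "Z \<in> null_sets lborel" "{x. \<not> P x} \<subseteq> Z"
    using P by (auto simp: eventually_ae_filter)
  have [measurable]: "Z \<in> sets borel" using Z(1) by auto
  have "AE x in lborel. t + c * x \<notin> Z"
    by (rule AE_borel_affine[OF c _ AE_not_in[OF Z(1)]]) simp
  then show ?thesis by eventually_elim (use Z(2) in auto)
qed

text \<open>
  The unit normal that points into \<open>Omega_plus\<close>, at the point of parameter x.
  The values at the corners are arbitrary.
\<close>

definition normal_in :: "real \<Rightarrow> real \<Rightarrow> complex" where
  "normal_in \<sigma> x = (if x < - \<sigma> then 1 else if x \<le> \<sigma> then \<i> else - 1)"

text \<open>
  Fatou's lemma along the curves with parameters \<open>\<sigma> - \<eta> n\<close> and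
  \<open>\<eta> n\<close>, which lie inside the strip for positive \<open>\<eta> n\<close>
  and outside for negative ones. Moving a point by \<open>\<eta> n\<close> along the normal
  leads to the point of that curve whose parameter is \<open>x + 2 * \<eta> n\<close>,
  \<open>x\<close> or \<open>x - 2 * \<eta> n\<close>, according to the side of the curve;
  near the corners the approximating function is set to 0.
\<close>

lemma boundary_limit_lp:
  assumes \<sigma>: "0 < \<sigma>" and p: "1 < p" and F: "continuous_on S F"
    and \<eta>: "\<And>n::nat. \<bar>\<eta> n\<bar> < \<sigma>" "\<eta> \<longlonglongrightarrow> 0"
    and S: "\<And>n. Gamma (\<sigma> - \<eta> n) (\<eta> n) \<subseteq> S"
    and C: "\<And>n. lp_mass p (\<lambda>x. F (gpath (\<sigma> - \<eta> n) (\<eta> n) x)) \<le> C" "C < \<infinity>"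
    and lim: "AE x in lborel. (\<lambda>n. F (gpath \<sigma> 0 x + of_real (\<eta> n) * normal_in \<sigma> x)) \<longlonglongrightarrow> f (gpath \<sigma> 0 x)"
  shows "\<exists>G. lp_fun p G \<and> (AE x in lborel. f (gpath \<sigma> 0 x) = G x)"
proof -
  define P where "P = (\<lambda>n x. F (gpath (\<sigma> - \<eta> n) (\<eta> n) x))"
  have s: "0 < \<sigma> - \<eta> n" for n using \<eta>(1)[of n] by auto
  have Pm [measurable]: "P n \<in> borel_measurable borel" for n
    unfolding P_def by (rule nn_integral_arc_length_continuous(2)[OF s F S])
  define g where "g = (\<lambda>n x. (if x < - \<sigma> - \<bar>\<eta> n\<bar> then P n (2 * \<eta> n + 1 * x) else 0) +
     ((if \<bar>x\<bar> \<le> \<sigma> - \<bar>\<eta> n\<bar> then P n x else 0) + (if x > \<sigma> + \<bar>\<eta> n\<bar> then P n (- 2 * \<eta> n + 1 * x) else 0)))"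
  have gm [measurable]: "g n \<in> borel_measurable borel" for n unfolding g_def by measurable
  have gl: "AE x in lborel. (\<lambda>n. g n x) \<longlonglongrightarrow> f (gpath \<sigma> 0 x)"
    using lim AE_lborel_singleton[of "\<sigma>"] AE_lborel_singleton[of "- \<sigma>"]
  proof eventually_elim
    case (elim x)
    have "\<bar>\<bar>x\<bar> - \<sigma>\<bar> > 0" using elim by (auto simp: abs_if)
    then have "eventually (\<lambda>n. dist (\<eta> n) 0 < \<bar>\<bar>x\<bar> - \<sigma>\<bar>) sequentially"
      using \<eta>(2) by (simp add: tendsto_iff)
    then have "eventually (\<lambda>n. F (gpath \<sigma> 0 x + of_real (\<eta> n) * normal_in \<sigma> x) = g n x) sequentially"
    proof eventually_elim
      case (elim n)
      then have e: "\<bar>\<eta> n\<bar> < \<bar>\<bar>x\<bar> - \<sigma>\<bar>" by simp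
      then consider "x < - \<sigma> - \<bar>\<eta> n\<bar>" | "\<bar>x\<bar> < \<sigma> - \<bar>\<eta> n\<bar>" | "x > \<sigma> + \<bar>\<eta> n\<bar>" by linarith
      then show ?case
      proof cases
        case 1
        then have "gpath \<sigma> 0 x + of_real (\<eta> n) * normal_in \<sigma> x = gpath (\<sigma> - \<eta> n) (\<eta> n) (2 * \<eta> n + 1 * x)"
          using \<sigma> by (auto simp: gpath_def normal_in_def complex_eq_iff)
        then show ?thesis using 1 \<sigma> by (auto simp: g_def P_def)
      next
        case 2
        then have "gpath \<sigma> 0 x + of_real (\<eta> n) * normal_in \<sigma> x = gpath (\<sigma> - \<eta> n) (\<eta> n) x"
          using \<sigma> by (auto simp: gpath_def normal_in_def complex_eq_iff)
        then show ?thesis using 2 \<sigma> by (auto simp: g_def P_def)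
      next
        case 3
        then have "gpath \<sigma> 0 x + of_real (\<eta> n) * normal_in \<sigma> x = gpath (\<sigma> - \<eta> n) (\<eta> n) (- 2 * \<eta> n + 1 * x)"
          using \<sigma> \<eta>(1)[of n] by (auto simp: gpath_def normal_in_def complex_eq_iff)
        then show ?thesis using 3 \<sigma> by (auto simp: g_def P_def)
      qed
    qed
    then show ?case by (rule Lim_transform_eventually[OF elim(1)])
  qed
  define G where "G = (\<lambda>x. lim (\<lambda>n. g n x))"
  have [measurable]: "G \<in> borel_measurable borel" unfolding G_def by (rule borel_measurable_lim_metric) simp
  have eq: "AE x in lborel. f (gpath \<sigma> 0 x) = G x"
    using gl by eventually_elim (auto simp: G_def dest: limI)
  have "AE x in lborel. (\<lambda>n. g n x) \<longlonglongrightarrow> G x" using gl eq by eventually_elim simp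
  then have "lp_mass p G \<le> ennreal (2 powr p) * (C + ennreal (2 powr p) * (C + C))"
  proof (rule lp_mass_fatou_bound[rotated 2])
    fix n
    have c: "lp_mass p (P n) \<le> C" using C(1) by (simp add: P_def)
    have sh: "lp_mass p (\<lambda>x. P n (a + 1 * x)) \<le> C" for a using lp_mass_affine[OF Pm[of n], of 1 p a] c by simp
    have "lp_mass p (g n) \<le> ennreal (2 powr p) * (lp_mass p (\<lambda>x. if x < - \<sigma> - \<bar>\<eta> n\<bar> then P n (2 * \<eta> n + 1 * x) else 0) +
      lp_mass p (\<lambda>x. (if \<bar>x\<bar> \<le> \<sigma> - \<bar>\<eta> n\<bar> then P n x else 0) + (if x > \<sigma> + \<bar>\<eta> n\<bar> then P n (- 2 * \<eta> n + 1 * x) else 0)))"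
      unfolding g_def using p by (intro lp_mass_add) auto
    also have "\<dots> \<le> ennreal (2 powr p) * (C + ennreal (2 powr p) * (C + C))"
    proof (intro mult_left_mono add_mono)
      show "lp_mass p (\<lambda>x. if x < - \<sigma> - \<bar>\<eta> n\<bar> then P n (2 * \<eta> n + 1 * x) else 0) \<le> C"
        using p by (intro order.trans[OF lp_mass_mono sh[of "2 * \<eta> n"]]) auto
      have "lp_mass p (\<lambda>x. (if \<bar>x\<bar> \<le> \<sigma> - \<bar>\<eta> n\<bar> then P n x else 0) + (if x > \<sigma> + \<bar>\<eta> n\<bar> then P n (- 2 * \<eta> n + 1 * x) else 0))
        \<le> ennreal (2 powr p) * (lp_mass p (\<lambda>x. if \<bar>x\<bar> \<le> \<sigma> - \<bar>\<eta> n\<bar> then P n x else 0) + lp_mass p (\<lambda>x. if x > \<sigma> + \<bar>\<eta> n\<bar> then P n (- 2 * \<eta> n + 1 * x) else 0))"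
        using p by (intro lp_mass_add) auto
      also have "\<dots> \<le> ennreal (2 powr p) * (C + C)"
      proof (intro mult_left_mono add_mono)
        show "lp_mass p (\<lambda>x. if \<bar>x\<bar> \<le> \<sigma> - \<bar>\<eta> n\<bar> then P n x else 0) \<le> C"
          using p by (intro order.trans[OF lp_mass_mono c]) auto
        show "lp_mass p (\<lambda>x. if x > \<sigma> + \<bar>\<eta> n\<bar> then P n (- 2 * \<eta> n + 1 * x) else 0) \<le> C"
          using p by (intro order.trans[OF lp_mass_mono sh[of "- 2 * \<eta> n"]]) auto
      qed auto
      finally show "lp_mass p (\<lambda>x. (if \<bar>x\<bar> \<le> \<sigma> - \<bar>\<eta> n\<bar> then P n x else 0) + (if x > \<sigma> + \<bar>\<eta> n\<bar> then P n (- 2 * \<eta> n + 1 * x) else 0))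
        \<le> ennreal (2 powr p) * (C + C)" .
    qed auto
    finally show "lp_mass p (g n) \<le> ennreal (2 powr p) * (C + ennreal (2 powr p) * (C + C))" .
  qed (use p in auto)
  also have "\<dots> < \<infinity>" using C(2) by (simp add: ennreal_mult_less_top)
  finally have "lp_fun p G" by (simp add: lp_fun_def)
  then show ?thesis using eq by blast
qed

lemma normal_in_cone:
  assumes "0 < \<sigma>" "\<bar>x\<bar> \<noteq> \<sigma>" "0 < d"
  shows "of_real d * normal_in \<sigma> x \<in> inner_cone \<sigma> 1 (gpath \<sigma> 0 x)"
proof -
  consider "x < - \<sigma>" | "\<bar>x\<bar> < \<sigma>" | "x > \<sigma>" using assms by linarith
  then show ?thesis
    using assms by cases (auto simp: gpath_def normal_in_def inner_cone_def Gamma1_def Gamma2_def Gamma3_def complex_eq_iff)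
qed

lemma open_Omega: "open (Omega_plus \<sigma>)" "open (Omega_minus \<sigma>)"
  unfolding Omega_plus_def Omega_minus_def D_def
  by (intro open_Collect_conj open_Collect_less continuous_intros) auto

lemma Omega_minus_eq: "0 < \<sigma> \<Longrightarrow> Omega_minus \<sigma> = {w. \<sigma> < \<bar>Re w\<bar> \<or> Im w < 0}"
  unfolding Omega_minus_def by (subst closure_D) auto

lemma Omega_shift:
  assumes \<sigma>: "0 < \<sigma>" and d: "0 < d" "d < \<sigma>" and x: "d < \<bar>\<bar>x\<bar> - \<sigma>\<bar>"
  shows "gpath \<sigma> 0 x + of_real d * normal_in \<sigma> x \<in> Omega_plus \<sigma>"
    and "gpath \<sigma> 0 x - of_real d * normal_in \<sigma> x \<in> Omega_minus \<sigma>"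
proof -
  consider "x < - \<sigma> - d" | "\<bar>x\<bar> < \<sigma> - d" | "x > \<sigma> + d" using x by linarith
  then show "gpath \<sigma> 0 x + of_real d * normal_in \<sigma> x \<in> Omega_plus \<sigma>" "gpath \<sigma> 0 x - of_real d * normal_in \<sigma> x \<in> Omega_minus \<sigma>"
    using \<sigma> d by (cases; auto simp: gpath_def normal_in_def Omega_plus_def D_def Omega_minus_eq[OF \<sigma>])+
qed

text \<open>
  The sign e is 1 for the domain inside the curve and -1 for the domain outside. Cones
  contain the normal, so that a nontangential limit is in particular the limit along the
  sequence of the preceding lemma.
\<close>

lemma nt_limit_lp:
  assumes \<sigma>: "0 < \<sigma>" and p: "1 < p" and F: "F analytic_on \<Omega>" "open \<Omega>" and e: "\<bar>e\<bar> = (1::real)"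
    and sub: "\<And>d. 0 < d \<Longrightarrow> d < \<sigma> \<Longrightarrow> Gamma (\<sigma> - e * d) (e * d) \<subseteq> \<Omega>"
    and shift: "\<And>d x. 0 < d \<Longrightarrow> d < \<sigma> \<Longrightarrow> d < \<bar>\<bar>x\<bar> - \<sigma>\<bar> \<Longrightarrow> gpath \<sigma> 0 x + of_real (e * d) * normal_in \<sigma> x \<in> \<Omega>"
    and C: "\<And>d. 0 < d \<Longrightarrow> d < \<sigma> \<Longrightarrow> (\<integral>\<^sup>+ w. ennreal (norm (F w) powr p) \<partial>arc_length (\<sigma> - e * d) (e * d)) \<le> C" "C < \<infinity>"
    and lim: "AE x in lborel. (F \<longlongrightarrow> f (gpath \<sigma> 0 x))
      (at (gpath \<sigma> 0 x) within (\<lambda>z. gpath \<sigma> 0 x + of_real e * z) ` inner_cone \<sigma> 1 (gpath \<sigma> 0 x) \<inter> \<Omega>)"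
  shows "\<exists>G. lp_fun p G \<and> (AE x in lborel. f (gpath \<sigma> 0 x) = G x)"
proof -
  \<comment> \<open>n + 2 keeps the distances below \<sigma>\<close>
  define d where "d = (\<lambda>n::nat. \<sigma> / real (n + 2))"
  have pos: "0 < d n" "d n < \<sigma>" for n using \<sigma> by (auto simp: d_def divide_less_eq)
  have d0: "d \<longlonglongrightarrow> 0"
    unfolding d_def by (rule LIMSEQ_ignore_initial_segment[OF lim_const_over_n])
  have "(\<lambda>n. e * d n) \<longlonglongrightarrow> e * 0" by (intro tendsto_intros d0)
  then have e0: "(\<lambda>n. e * d n) \<longlonglongrightarrow> 0" by simp
  have s: "0 < \<sigma> - e * d n" for n using e pos[of n] \<sigma> by (cases "e \<ge> 0") auto
  have cont: "continuous_on \<Omega> F"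
    using F by (intro holomorphic_on_imp_continuous_on) (simp add: analytic_on_open)
  show ?thesis
  proof (rule boundary_limit_lp[OF \<sigma> p cont _ e0 sub[OF pos] _ C(2)])
    show "\<bar>e * d n\<bar> < \<sigma>" for n using pos[of n] e by (simp add: abs_mult)
    show "lp_mass p (\<lambda>x. F (gpath (\<sigma> - e * d n) (e * d n) x)) \<le> C" for n
      using C(1)[OF pos[of n]] nn_integral_arc_length_continuous(1)[OF s[of n] cont sub[OF pos[of n]]] by simp
    show "AE x in lborel. (\<lambda>n. F (gpath \<sigma> 0 x + of_real (e * d n) * normal_in \<sigma> x)) \<longlonglongrightarrow> f (gpath \<sigma> 0 x)"
      using lim AE_lborel_singleton[of "\<sigma>"] AE_lborel_singleton[of "- \<sigma>"]
    proof eventually_elim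
      case (elim x)
      let ?\<zeta> = "gpath \<sigma> 0 x"
      have x: "\<bar>x\<bar> \<noteq> \<sigma>" using elim by (auto simp: abs_if)
      show ?case
      proof (rule filterlim_compose[OF elim(1)], unfold filterlim_at, intro conjI)
        have "eventually (\<lambda>n. dist (d n) 0 < \<bar>\<bar>x\<bar> - \<sigma>\<bar>) sequentially"
          using d0 x by (simp add: tendsto_iff)
        then show "eventually (\<lambda>n. ?\<zeta> + of_real (e * d n) * normal_in \<sigma> x \<in> (\<lambda>z. ?\<zeta> + of_real e * z) ` inner_cone \<sigma> 1 ?\<zeta> \<inter> \<Omega>
            \<and> ?\<zeta> + of_real (e * d n) * normal_in \<sigma> x \<noteq> ?\<zeta>) sequentially"
        proof eventually_elim
          case (elim n)
          have "normal_in \<sigma> x \<noteq> 0" "e \<noteq> 0" using e by (auto simp: normal_in_def)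
          moreover have "?\<zeta> + of_real (e * d n) * normal_in \<sigma> x = ?\<zeta> + of_real e * (of_real (d n) * normal_in \<sigma> x)" by simp
          ultimately show ?case
            using normal_in_cone[OF \<sigma> x pos(1)[of n]] shift[OF pos, of n x] elim pos[of n] by auto
        qed
        have "(\<lambda>n. ?\<zeta> + of_real (e * d n) * normal_in \<sigma> x) \<longlonglongrightarrow> ?\<zeta> + of_real 0 * normal_in \<sigma> x"
          by (intro tendsto_intros e0)
        then show "(\<lambda>n. ?\<zeta> + of_real (e * d n) * normal_in \<sigma> x) \<longlonglongrightarrow> ?\<zeta>" by simp
      qed
    qed
  qed
qed

lemma nt_boundary_plus_lp:
  assumes \<sigma>: "0 < \<sigma>" and p: "1 < p" and F: "F \<in> Hardy_plus p \<sigma>" and f: "nt_boundary_function_plus \<sigma> F f"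
  shows "\<exists>G. lp_fun p G \<and> (AE x in lborel. f (gpath \<sigma> 0 x) = G x)"
proof -
  define C where "C = (SUP (s, t) \<in> {0<..<\<sigma>} \<times> {0<..}. \<integral>\<^sup>+ w. ennreal (norm (F w) powr p) \<partial>arc_length s t)"
  show ?thesis
  proof (rule nt_limit_lp[OF \<sigma> p, where e = 1 and C = C and \<Omega> = "Omega_plus \<sigma>"])
    show "F analytic_on Omega_plus \<sigma>" "C < \<infinity>" using F by (auto simp: Hardy_plus_def C_def)
    fix d assume d: "0 < d" "d < \<sigma>"
    show "Gamma (\<sigma> - 1 * d) (1 * d) \<subseteq> Omega_plus \<sigma>"
      using d by (subst Gamma_eq) (auto simp: Omega_plus_def D_def)
    show "(\<integral>\<^sup>+ w. ennreal (norm (F w) powr p) \<partial>arc_length (\<sigma> - 1 * d) (1 * d)) \<le> C"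
      unfolding C_def using d by (intro SUP_upper2[of "(\<sigma> - d, d)"]) auto
    show "gpath \<sigma> 0 x + of_real (1 * d) * normal_in \<sigma> x \<in> Omega_plus \<sigma>" if "d < \<bar>\<bar>x\<bar> - \<sigma>\<bar>" for x
      using Omega_shift(1)[OF \<sigma> d that] by simp
  next
    show "AE x in lborel. (F \<longlongrightarrow> f (gpath \<sigma> 0 x))
      (at (gpath \<sigma> 0 x) within (\<lambda>z. gpath \<sigma> 0 x + of_real 1 * z) ` inner_cone \<sigma> 1 (gpath \<sigma> 0 x) \<inter> Omega_plus \<sigma>)"
      using f unfolding nt_boundary_function_plus_def AE_arc_length_iff[OF \<sigma>]
      by eventually_elim (simp add: has_nt_limit_plus_def cone_plus_def)
  qed (simp_all add: open_Omega)
qed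

lemma nt_boundary_minus_lp:
  assumes \<sigma>: "0 < \<sigma>" and p: "1 < p" and F: "F \<in> Hardy_minus p \<sigma>" and f: "nt_boundary_function_minus \<sigma> F f"
  shows "\<exists>G. lp_fun p G \<and> (AE x in lborel. f (gpath \<sigma> 0 x) = G x)"
proof -
  define C where "C = (SUP (s, t) \<in> {\<sigma><..} \<times> {..<0}. \<integral>\<^sup>+ w. ennreal (norm (F w) powr p) \<partial>arc_length s t)"
  show ?thesis
  proof (rule nt_limit_lp[OF \<sigma> p, where e = "-1" and C = C and \<Omega> = "Omega_minus \<sigma>"])
    show "F analytic_on Omega_minus \<sigma>" "C < \<infinity>" using F by (auto simp: Hardy_minus_def C_def)
    fix d assume d: "0 < d" "d < \<sigma>"
    show "Gamma (\<sigma> - -1 * d) (-1 * d) \<subseteq> Omega_minus \<sigma>"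
      using d \<sigma> by (subst Gamma_eq) (auto simp: Omega_minus_eq[OF \<sigma>])
    show "(\<integral>\<^sup>+ w. ennreal (norm (F w) powr p) \<partial>arc_length (\<sigma> - -1 * d) (-1 * d)) \<le> C"
      unfolding C_def using d by (intro SUP_upper2[of "(\<sigma> + d, - d)"]) auto
    show "gpath \<sigma> 0 x + of_real (-1 * d) * normal_in \<sigma> x \<in> Omega_minus \<sigma>" if "d < \<bar>\<bar>x\<bar> - \<sigma>\<bar>" for x
      using Omega_shift(2)[OF \<sigma> d that] by simp
  next
    show "AE x in lborel. (F \<longlongrightarrow> f (gpath \<sigma> 0 x))
      (at (gpath \<sigma> 0 x) within (\<lambda>z. gpath \<sigma> 0 x + of_real (-1) * z) ` inner_cone \<sigma> 1 (gpath \<sigma> 0 x) \<inter> Omega_minus \<sigma>)"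
      using f unfolding nt_boundary_function_minus_def AE_arc_length_iff[OF \<sigma>]
      by eventually_elim (simp add: has_nt_limit_minus_def cone_minus_def)
  qed (simp_all add: open_Omega)
qed

section \<open>The Cauchy integral of the strip\<close>

text \<open>
  The coordinate in which the vertical line through a is the real axis; points to the left
  of the line have positive imaginary part.
\<close>

definition line_coord :: "real \<Rightarrow> complex \<Rightarrow> complex" where
  "line_coord a w = - \<i> * (w - of_real a)"

lemma line_coord_eq: "line_coord a w = Complex (Im w) (a - Re w)"
  by (simp add: line_coord_def complex_eq_iff)

text \<open>
  In each of the three line coordinates the jump is the limit from above minus the limit
  from below. The upper side is inside the strip for the bottom and for the right half-line
  but outside for the left half-line, whence the sign of the first term.
\<close>

definition strip_cauchy ::
    "real \<Rightarrow> (real \<Rightarrow> complex) \<Rightarrow> (real \<Rightarrow> complex) \<Rightarrow> (real \<Rightarrow> complex) \<Rightarrow> complex \<Rightarrow> complex" where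
  "strip_cauchy \<sigma> f1 f2 f3 w = - cauchy f1 (line_coord (- \<sigma>) w) + (cauchy f2 w + cauchy f3 (line_coord \<sigma> w))"

lemma lp_mass_uminus: "lp_mass p (\<lambda>x. - f x) = lp_mass p f"
  by (simp add: lp_mass_def)

lemma cauchy_measurable_reflected:
  assumes "f \<in> borel_measurable borel"
  shows "(\<lambda>u. cauchy f (Complex t (a - u))) \<in> borel_measurable borel"
proof -
  have "(\<lambda>u. cauchy f (Complex t (a + (-1) * u))) \<in> borel_measurable borel"
    by (rule measurable_compose[OF _ cauchy_measurable_line(2)[OF assms]]) measurable
  then show ?thesis by simp
qed

text \<open>
  A vertical line is parallel to the lines that carry \<open>f1\<close> and
  \<open>f3\<close> and perpendicular to the real axis, which carries \<open>f2\<close>; for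
  a horizontal line it is the other way round.
\<close>

lemma strip_cauchy_line_bounds:
  assumes p: "1 < p" and \<sigma>: "0 < \<sigma>" and f: "lp_fun p f1" "lp_fun p f2" "lp_fun p f3"
  shows "\<exists>B<\<infinity>. (\<forall>c. \<bar>c\<bar> \<noteq> \<sigma> \<longrightarrow> lp_mass p (\<lambda>v. strip_cauchy \<sigma> f1 f2 f3 (Complex c v)) \<le> B) \<and>
    (\<forall>t. t \<noteq> 0 \<longrightarrow> lp_mass p (\<lambda>u. strip_cauchy \<sigma> f1 f2 f3 (Complex u t)) \<le> B)"
proof -
  obtain A1 where A1: "A1 \<ge> 0" "\<And>f y. lp_fun p f \<Longrightarrow> y \<noteq> 0 \<Longrightarrow> lp_mass p (\<lambda>x. cauchy f (Complex x y)) \<le> ennreal A1 * lp_mass p f"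
    using riesz_cauchy[OF p] by blast
  obtain A2 where A2: "A2 \<ge> 0" "\<And>f x. lp_fun p f \<Longrightarrow> lp_mass p (\<lambda>y. cauchy f (Complex x y)) \<le> ennreal A2 * lp_mass p f"
    using cauchy_perp_bound[OF p] by blast
  define M where "M = lp_mass p f1 + (lp_mass p f2 + lp_mass p f3)"
  define K where "K = ennreal (max A1 A2) * M"
  have M: "M < \<infinity>" using f by (simp add: M_def lp_fun_def)
  have K: "K < \<infinity>" using M by (simp add: K_def ennreal_mult_less_top)
  have par: "lp_mass p (\<lambda>x. cauchy f (Complex x y)) \<le> K" if "f \<in> {f1, f2, f3}" "y \<noteq> 0" for f y
  proof -
    have l: "lp_fun p f" "lp_mass p f \<le> M" using that f by (auto simp: M_def add_increasing add_increasing2)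
    have "lp_mass p (\<lambda>x. cauchy f (Complex x y)) \<le> ennreal A1 * lp_mass p f" using A1(2) l that by blast
    also have "\<dots> \<le> K" unfolding K_def using l by (intro mult_mono ennreal_leI) auto
    finally show ?thesis .
  qed
  have perp: "lp_mass p (\<lambda>y. cauchy f (Complex x y)) \<le> K" if "f \<in> {f1, f2, f3}" for f x
  proof -
    have l: "lp_fun p f" "lp_mass p f \<le> M" using that f by (auto simp: M_def add_increasing add_increasing2)
    have "lp_mass p (\<lambda>y. cauchy f (Complex x y)) \<le> ennreal A2 * lp_mass p f" using A2(2) l that by blast
    also have "\<dots> \<le> K" unfolding K_def using l by (intro mult_mono ennreal_leI) auto
    finally show ?thesis .
  qed
  have fm [measurable]: "f1 \<in> borel_measurable borel" "f2 \<in> borel_measurable borel" "f3 \<in> borel_measurable borel"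
    using f by (auto simp: lp_fun_def)
  define B where "B = ennreal (2 powr p) * (K + ennreal (2 powr p) * (K + K))"
  have B: "B < \<infinity>" using K by (simp add: B_def ennreal_mult_less_top)
  have sum3: "lp_mass p (\<lambda>x. - a x + (b x + c x)) \<le> B"
    if [measurable]: "a \<in> borel_measurable borel" "b \<in> borel_measurable borel" "c \<in> borel_measurable borel"
      and m: "lp_mass p a \<le> K" "lp_mass p b \<le> K" "lp_mass p c \<le> K" for a b c
  proof -
    have "lp_mass p (\<lambda>x. - a x + (b x + c x)) \<le> ennreal (2 powr p) * (lp_mass p (\<lambda>x. - a x) + lp_mass p (\<lambda>x. b x + c x))"
      using p by (intro lp_mass_add) auto
    also have "\<dots> \<le> ennreal (2 powr p) * (K + ennreal (2 powr p) * (lp_mass p b + lp_mass p c))"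
      using p m by (intro mult_left_mono add_mono lp_mass_add) (auto simp: lp_mass_uminus)
    also have "\<dots> \<le> B" unfolding B_def using m by (intro mult_left_mono add_mono) auto
    finally show ?thesis .
  qed
  have refl_b: "lp_mass p (\<lambda>u. cauchy f (Complex t (a - u))) \<le> K" if "f \<in> {f1, f2, f3}" for f t a
  proof -
    have "f \<in> borel_measurable borel" using that fm by auto
    from lp_mass_affine[OF cauchy_measurable_line(2)[OF this], of "-1" p t a]
    have "lp_mass p (\<lambda>u. cauchy f (Complex t (a - u))) = lp_mass p (\<lambda>u. cauchy f (Complex t u))" by simp
    then show ?thesis using perp[OF that] by simp
  qed
  have "lp_mass p (\<lambda>v. strip_cauchy \<sigma> f1 f2 f3 (Complex c v)) \<le> B" if "\<bar>c\<bar> \<noteq> \<sigma>" for c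
    unfolding strip_cauchy_def line_coord_eq complex.sel
    using that \<sigma> by (intro sum3 par perp cauchy_measurable_line) auto
  moreover have "lp_mass p (\<lambda>u. strip_cauchy \<sigma> f1 f2 f3 (Complex u t)) \<le> B" if "t \<noteq> 0" for t
    unfolding strip_cauchy_def line_coord_eq complex.sel
    using that by (intro sum3 par refl_b cauchy_measurable_reflected cauchy_measurable_line) auto
  ultimately show ?thesis using B by blast
qed

lemma strip_cauchy_measurable:
  assumes f: "f1 \<in> borel_measurable borel" "f2 \<in> borel_measurable borel" "f3 \<in> borel_measurable borel"
  shows "(\<lambda>v. strip_cauchy \<sigma> f1 f2 f3 (Complex c v)) \<in> borel_measurable borel"
    and "(\<lambda>u. strip_cauchy \<sigma> f1 f2 f3 (Complex u t)) \<in> borel_measurable borel"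
proof -
  show "(\<lambda>v. strip_cauchy \<sigma> f1 f2 f3 (Complex c v)) \<in> borel_measurable borel"
    unfolding strip_cauchy_def line_coord_eq complex.sel
    by (intro borel_measurable_add borel_measurable_uminus cauchy_measurable_line f)
  show "(\<lambda>u. strip_cauchy \<sigma> f1 f2 f3 (Complex u t)) \<in> borel_measurable borel"
    unfolding strip_cauchy_def line_coord_eq complex.sel
    by (intro borel_measurable_add borel_measurable_uminus cauchy_measurable_line cauchy_measurable_reflected f)
qed

lemma lp_mass_gpath_le:
  assumes p: "1 < p" and m: "\<And>c. (\<lambda>v. S (Complex c v)) \<in> borel_measurable borel" "(\<lambda>u. S (Complex u t)) \<in> borel_measurable borel"
    and b: "lp_mass p (\<lambda>v. S (Complex (- s) v)) \<le> B" "lp_mass p (\<lambda>v. S (Complex s v)) \<le> B" "lp_mass p (\<lambda>u. S (Complex u t)) \<le> B"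
  shows "lp_mass p (\<lambda>x. S (gpath s t x)) \<le> B + (B + B)"
proof -
  note [measurable] = m
  have [measurable]: "(\<lambda>x. S (Complex c (a + b * x))) \<in> borel_measurable borel" for c a b
    by (rule measurable_compose[OF _ m(1)]) measurable
  have "lp_mass p (\<lambda>x. S (gpath s t x)) \<le> (\<integral>\<^sup>+x. ennreal (norm (S (Complex (- s) (t - s + (-1) * x))) powr p) +
     (ennreal (norm (S (Complex s (t - s + 1 * x))) powr p) + ennreal (norm (S (Complex x t)) powr p)) \<partial>lborel)"
    unfolding lp_mass_def
  proof (intro nn_integral_mono)
    fix x
    consider "gpath s t x = Complex (- s) (t - s + (-1) * x)" | "gpath s t x = Complex s (t - s + 1 * x)" | "gpath s t x = Complex x t"
    proof -
      have "gpath s t x = Complex (- s) (t - s + (-1) * x) \<or> gpath s t x = Complex s (t - s + 1 * x) \<or> gpath s t x = Complex x t"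
        by (simp add: gpath_def complex_eq_iff)
      then show thesis using that by blast
    qed
    then show "ennreal (norm (S (gpath s t x)) powr p) \<le> ennreal (norm (S (Complex (- s) (t - s + (-1) * x))) powr p) +
     (ennreal (norm (S (Complex s (t - s + 1 * x))) powr p) + ennreal (norm (S (Complex x t)) powr p))"
      by cases (simp_all only: add_increasing add_increasing2 order_refl zero_le)
  qed
  also have "\<dots> = lp_mass p (\<lambda>x. S (Complex (- s) (t - s + (-1) * x))) + (lp_mass p (\<lambda>x. S (Complex s (t - s + 1 * x))) + lp_mass p (\<lambda>x. S (Complex x t)))"
    unfolding lp_mass_def by (simp add: nn_integral_add)
  also have "\<dots> \<le> B + (B + B)"
    using b lp_mass_affine[OF m(1), of "-1" p "-s" "t - s"] lp_mass_affine[OF m(1), of 1 p s "t - s"]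
    by (intro add_mono) simp_all
  finally show ?thesis .
qed

lemma strip_cauchy_holomorphic:
  assumes p: "1 < p" and \<sigma>: "0 < \<sigma>" and f: "lp_fun p f1" "lp_fun p f2" "lp_fun p f3"
    and supp: "\<And>t. f1 t \<noteq> 0 \<Longrightarrow> 0 \<le> t" "\<And>t. f2 t \<noteq> 0 \<Longrightarrow> t \<in> {-\<sigma>..\<sigma>}" "\<And>t. f3 t \<noteq> 0 \<Longrightarrow> 0 \<le> t"
  shows "strip_cauchy \<sigma> f1 f2 f3 holomorphic_on - Gamma \<sigma> 0"
proof -
  have side: "(\<lambda>w. cauchy f (line_coord a w)) holomorphic_on - Gamma \<sigma> 0"
    if "lp_fun p f" "\<And>t. f t \<noteq> 0 \<Longrightarrow> 0 \<le> t" "\<bar>a\<bar> = \<sigma>" for f a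
  proof -
    have "cauchy f holomorphic_on - (of_real ` {0..})" using that by (intro cauchy_holomorphic[OF p]) auto
    then have "cauchy f holomorphic_on line_coord a ` (- Gamma \<sigma> 0)"
    proof (rule holomorphic_on_subset)
      show "line_coord a ` (- Gamma \<sigma> 0) \<subseteq> - (of_real ` {0..})"
        using that(3) by (auto simp: Gamma_eq[OF \<sigma>] line_coord_eq complex_eq_iff)
    qed
    moreover have "line_coord a holomorphic_on - Gamma \<sigma> 0" unfolding line_coord_def[abs_def] by (intro holomorphic_intros)
    ultimately have "(cauchy f \<circ> line_coord a) holomorphic_on - Gamma \<sigma> 0" by (intro holomorphic_on_compose)
    then show ?thesis by (simp add: o_def)
  qed
  have "cauchy f2 holomorphic_on - (of_real ` {-\<sigma>..\<sigma>})" using f supp by (intro cauchy_holomorphic[OF p]) auto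
  then have "cauchy f2 holomorphic_on - Gamma \<sigma> 0"
    by (rule holomorphic_on_subset) (auto simp: Gamma_eq[OF \<sigma>])
  then show ?thesis unfolding strip_cauchy_def[abs_def]
    using f supp \<sigma> by (intro holomorphic_intros side) auto
qed

text \<open>
  The parallel pieces of the curves never meet the lines that carry the densities, so the
  bounds on lines apply to each of the three sides.
\<close>

lemma strip_cauchy_hardy:
  assumes p: "1 < p" and \<sigma>: "0 < \<sigma>" and f: "lp_fun p f1" "lp_fun p f2" "lp_fun p f3"
    and supp: "\<And>t. f1 t \<noteq> 0 \<Longrightarrow> 0 \<le> t" "\<And>t. f2 t \<noteq> 0 \<Longrightarrow> t \<in> {-\<sigma>..\<sigma>}" "\<And>t. f3 t \<noteq> 0 \<Longrightarrow> 0 \<le> t"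
  shows "strip_cauchy \<sigma> f1 f2 f3 \<in> Hardy_plus p \<sigma>"
    and "(\<lambda>w. - strip_cauchy \<sigma> f1 f2 f3 w) \<in> Hardy_minus p \<sigma>"
proof -
  let ?S = "strip_cauchy \<sigma> f1 f2 f3"
  have fm: "f1 \<in> borel_measurable borel" "f2 \<in> borel_measurable borel" "f3 \<in> borel_measurable borel"
    using f by (auto simp: lp_fun_def)
  have hol: "?S holomorphic_on - Gamma \<sigma> 0" by (rule strip_cauchy_holomorphic[OF assms])
  have sub: "Omega_plus \<sigma> \<subseteq> - Gamma \<sigma> 0" "Omega_minus \<sigma> \<subseteq> - Gamma \<sigma> 0"
    using \<sigma> by (auto simp: Gamma_eq Omega_plus_def D_def Omega_minus_eq)
  have an: "?S analytic_on Omega_plus \<sigma>" "?S analytic_on Omega_minus \<sigma>"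
    using hol sub open_Omega by (auto simp: analytic_on_open intro: holomorphic_on_subset)
  obtain B where B: "B < \<infinity>" "\<And>c. \<bar>c\<bar> \<noteq> \<sigma> \<Longrightarrow> lp_mass p (\<lambda>v. ?S (Complex c v)) \<le> B"
    "\<And>t. t \<noteq> 0 \<Longrightarrow> lp_mass p (\<lambda>u. ?S (Complex u t)) \<le> B"
    using strip_cauchy_line_bounds[OF p \<sigma> f] by blast
  have cont: "continuous_on (- Gamma \<sigma> 0) ?S" using hol by (rule holomorphic_on_imp_continuous_on)
  have curve: "(\<integral>\<^sup>+ w. ennreal (norm (?S w) powr p) \<partial>arc_length s t) \<le> B + (B + B)"
    if "0 < s" "s \<noteq> \<sigma>" "t \<noteq> 0" "Gamma s t \<subseteq> - Gamma \<sigma> 0" for s t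
  proof -
    have "(\<integral>\<^sup>+ w. ennreal (norm (?S w) powr p) \<partial>arc_length s t) = lp_mass p (\<lambda>x. ?S (gpath s t x))"
      by (rule nn_integral_arc_length_continuous(1)[OF that(1) cont that(4)])
    also have "\<dots> \<le> B + (B + B)"
      using that by (intro lp_mass_gpath_le[OF p] strip_cauchy_measurable fm B) auto
    finally show ?thesis .
  qed
  have fin: "B + (B + B) < \<infinity>" using B(1) by simp
  have "(SUP (s, t) \<in> {0<..<\<sigma>} \<times> {0<..}. \<integral>\<^sup>+ w. ennreal (norm (?S w) powr p) \<partial>arc_length s t) \<le> B + (B + B)"
  proof (intro SUP_least, clarsimp)
    fix s t :: real assume st: "0 < s" "s < \<sigma>" "0 < t"
    show "(\<integral>\<^sup>+ w. ennreal (norm (?S w) powr p) \<partial>arc_length s t) \<le> B + (B + B)"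
      using st by (intro curve) (auto simp: Gamma_eq)
  qed
  then show "?S \<in> Hardy_plus p \<sigma>" using an fin by (auto simp: Hardy_plus_def intro: le_less_trans)
  have "(SUP (s, t) \<in> {\<sigma><..} \<times> {..<0}. \<integral>\<^sup>+ w. ennreal (norm (- ?S w) powr p) \<partial>arc_length s t) \<le> B + (B + B)"
  proof (intro SUP_least, clarsimp)
    fix s t :: real assume st: "\<sigma> < s" "t < 0"
    show "(\<integral>\<^sup>+ w. ennreal (norm (?S w) powr p) \<partial>arc_length s t) \<le> B + (B + B)"
      using st \<sigma> by (intro curve) (auto simp: Gamma_eq)
  qed
  then show "(\<lambda>w. - ?S w) \<in> Hardy_minus p \<sigma>"
    using an fin by (auto simp: Hardy_minus_def intro!: analytic_intros intro: le_less_trans)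
qed

lemma inner_cone_gpath:
  assumes "0 < \<sigma>"
  shows "x < - \<sigma> \<Longrightarrow> inner_cone \<sigma> \<alpha> (gpath \<sigma> 0 x) = {z. Re z > 0 \<and> \<bar>Im z\<bar> < \<alpha> * Re z}"
    and "\<bar>x\<bar> < \<sigma> \<Longrightarrow> inner_cone \<sigma> \<alpha> (gpath \<sigma> 0 x) = {z. Im z > 0 \<and> \<bar>Re z\<bar> < \<alpha> * Im z}"
    and "x > \<sigma> \<Longrightarrow> inner_cone \<sigma> \<alpha> (gpath \<sigma> 0 x) = {z. Re z < 0 \<and> \<bar>Im z\<bar> < - \<alpha> * Re z}"
  using assms by (auto simp: gpath_def inner_cone_def Gamma1_def Gamma2_def Gamma3_def complex_eq_iff)

lemma tendsto_within_compose:
  assumes G: "(G \<longlongrightarrow> L) (at a within U)" and c: "isCont \<phi> \<zeta>" and a: "\<phi> \<zeta> = a"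
    and V: "\<And>w. w \<in> V \<Longrightarrow> \<phi> w \<in> U \<and> \<phi> w \<noteq> a"
  shows "((\<lambda>w. G (\<phi> w)) \<longlongrightarrow> L) (at \<zeta> within V)"
proof (rule filterlim_compose[OF G], unfold filterlim_at, intro conjI)
  show "eventually (\<lambda>w. \<phi> w \<in> U \<and> \<phi> w \<noteq> a) (at \<zeta> within V)"
    using V by (simp add: eventually_at_filter)
  show "(\<phi> \<longlongrightarrow> a) (at \<zeta> within V)"
    using c a by (auto simp: isCont_def intro: tendsto_within_subset)
qed

lemma line_coord_isCont: "isCont (line_coord a) w"
  unfolding line_coord_def[abs_def] by (intro continuous_intros)

lemma cauchy_rot_tendsto:
  assumes "1 < p" "lp_fun p f" "Re \<zeta> \<noteq> a"
  shows "((\<lambda>w. cauchy f (line_coord a w)) \<longlongrightarrow> cauchy f (line_coord a \<zeta>)) (at \<zeta> within V)"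
proof -
  have "isCont (cauchy f) (line_coord a \<zeta>)" using assms by (intro cauchy_isCont_nonreal) (auto simp: line_coord_eq)
  then have "isCont (\<lambda>w. cauchy f (line_coord a w)) \<zeta>" by (rule isCont_o2[OF line_coord_isCont])
  then show ?thesis by (auto simp: isCont_def intro: tendsto_within_subset)
qed

lemma cauchy_tendsto_nonreal:
  assumes "1 < p" "lp_fun p f" "Im \<zeta> \<noteq> 0"
  shows "(cauchy f \<longlongrightarrow> cauchy f \<zeta>) (at \<zeta> within V)"
  using cauchy_isCont_nonreal[OF assms] by (auto simp: isCont_def intro: tendsto_within_subset)

text \<open>
  Near a point of one side the other two Cauchy integrals are continuous; their value k
  enters the limits from inside and from outside with opposite signs. The line coordinate
  maps the cones of the strip to cones of the same aperture on the two sides of the real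
  axis.
\<close>

lemma strip_cauchy_boundary:
  assumes p: "1 < p" and \<sigma>: "0 < \<sigma>" and f: "lp_fun p f1" "lp_fun p f2" "lp_fun p f3"
  shows "AE x in lborel. \<exists>L\<^sub>p L\<^sub>m. has_nt_limit_plus \<sigma> (strip_cauchy \<sigma> f1 f2 f3) (gpath \<sigma> 0 x) L\<^sub>p \<and>
    has_nt_limit_minus \<sigma> (\<lambda>w. - strip_cauchy \<sigma> f1 f2 f3 w) (gpath \<sigma> 0 x) L\<^sub>m \<and>
    L\<^sub>p + L\<^sub>m = (if x < - \<sigma> then f1 (- \<sigma> - x) else if x \<le> \<sigma> then f2 x else f3 (x - \<sigma>))"
proof -
  let ?S = "strip_cauchy \<sigma> f1 f2 f3"
  let ?Q = "\<lambda>f v hp hm. nt_upper (cauchy f) v (hp v) \<and> nt_lower (cauchy f) v (hm v) \<and> hp v - hm v = f v"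
  obtain h1p h1m where h1: "AE v in lborel. ?Q f1 v h1p h1m" using cauchy_boundary_values[OF p f(1)] by blast
  obtain h2p h2m where h2: "AE v in lborel. ?Q f2 v h2p h2m" using cauchy_boundary_values[OF p f(2)] by blast
  obtain h3p h3m where h3: "AE v in lborel. ?Q f3 v h3p h3m" using cauchy_boundary_values[OF p f(3)] by blast
  have a1: "AE x in lborel. ?Q f1 (- \<sigma> + (-1) * x) h1p h1m" by (rule AE_lborel_affine[OF _ h1]) simp
  have a3: "AE x in lborel. ?Q f3 (- \<sigma> + 1 * x) h3p h3m" by (rule AE_lborel_affine[OF _ h3]) simp
  show ?thesis
    using a1 h2 a3 AE_lborel_singleton[of "\<sigma>"] AE_lborel_singleton[of "- \<sigma>"]
  proof eventually_elim
    case (elim x)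
    let ?\<zeta> = "gpath \<sigma> 0 x"
    have on: "?\<zeta> \<in> Gamma \<sigma> 0 - {Complex (- \<sigma>) 0, Complex \<sigma> 0}"
      using range_gpath[OF \<sigma>, of 0] elim \<sigma> by (auto simp: gpath_def)
    have plusI: "has_nt_limit_plus \<sigma> ?S ?\<zeta> L"
      if "\<And>\<alpha>. \<alpha> > 0 \<Longrightarrow> (?S \<longlongrightarrow> L) (at ?\<zeta> within (\<lambda>z. ?\<zeta> + z) ` inner_cone \<sigma> \<alpha> ?\<zeta>)" for L
      unfolding has_nt_limit_plus_def cone_plus_def using on that
      by (auto intro: tendsto_within_subset)
    have minusI: "has_nt_limit_minus \<sigma> (\<lambda>w. - ?S w) ?\<zeta> (- L)"
      if "\<And>\<alpha>. \<alpha> > 0 \<Longrightarrow> (?S \<longlongrightarrow> L) (at ?\<zeta> within (\<lambda>z. ?\<zeta> - z) ` inner_cone \<sigma> \<alpha> ?\<zeta>)" for L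
      unfolding has_nt_limit_minus_def cone_minus_def using on that
      by (auto intro!: tendsto_minus intro: tendsto_within_subset)
    consider "x < - \<sigma>" | "\<bar>x\<bar> < \<sigma>" | "x > \<sigma>" using elim by linarith
    then show ?case
    proof cases
      case 1
      define v where "v = - \<sigma> - x"
      have v: "v > 0" using 1 by (simp add: v_def)
      have z: "?\<zeta> = Complex (- \<sigma>) v" using 1 by (simp add: gpath_def v_def)
      have rz: "line_coord (- \<sigma>) ?\<zeta> = of_real v" by (simp add: z line_coord_eq complex_eq_iff)
      have q: "nt_upper (cauchy f1) v (h1p v)" "nt_lower (cauchy f1) v (h1m v)" "h1p v - h1m v = f1 v"
        using elim(1) by (simp_all add: v_def)
      define k where "k = cauchy f2 ?\<zeta> + cauchy f3 (line_coord \<sigma> ?\<zeta>)"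
      have rest: "((\<lambda>w. cauchy f2 w + cauchy f3 (line_coord \<sigma> w)) \<longlongrightarrow> k) (at ?\<zeta> within V)" for V
        unfolding k_def using v \<sigma> by (intro tendsto_add cauchy_tendsto_nonreal[OF p] cauchy_rot_tendsto[OF p] f) (auto simp: z)
      have "(?S \<longlongrightarrow> - h1m v + k) (at ?\<zeta> within (\<lambda>z. ?\<zeta> + z) ` inner_cone \<sigma> \<alpha> ?\<zeta>)" if a: "\<alpha> > 0" for \<alpha>
        unfolding strip_cauchy_def
      proof (intro tendsto_add tendsto_minus rest)
        show "((\<lambda>w. cauchy f1 (line_coord (- \<sigma>) w)) \<longlongrightarrow> h1m v) (at ?\<zeta> within (\<lambda>z. ?\<zeta> + z) ` inner_cone \<sigma> \<alpha> ?\<zeta>)"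
          by (rule tendsto_within_compose[OF q(2)[unfolded nt_lower_def, rule_format, OF a] line_coord_isCont rz])
             (auto simp: inner_cone_gpath(1)[OF \<sigma> 1, unfolded z] z line_coord_eq complex_eq_iff)
      qed
      moreover have "(?S \<longlongrightarrow> - h1p v + k) (at ?\<zeta> within (\<lambda>z. ?\<zeta> - z) ` inner_cone \<sigma> \<alpha> ?\<zeta>)" if a: "\<alpha> > 0" for \<alpha>
        unfolding strip_cauchy_def
      proof (intro tendsto_add tendsto_minus rest)
        show "((\<lambda>w. cauchy f1 (line_coord (- \<sigma>) w)) \<longlongrightarrow> h1p v) (at ?\<zeta> within (\<lambda>z. ?\<zeta> - z) ` inner_cone \<sigma> \<alpha> ?\<zeta>)"
          by (rule tendsto_within_compose[OF q(1)[unfolded nt_upper_def, rule_format, OF a] line_coord_isCont rz])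
             (auto simp: inner_cone_gpath(1)[OF \<sigma> 1, unfolded z] z line_coord_eq complex_eq_iff)
      qed
      ultimately have pl: "has_nt_limit_plus \<sigma> ?S ?\<zeta> (- h1m v + k)" and mi: "has_nt_limit_minus \<sigma> (\<lambda>w. - ?S w) ?\<zeta> (- (- h1p v + k))"
        by (intro plusI minusI; simp)+
      have jump: "(- h1m v + k) + (- (- h1p v + k)) = (if x < - \<sigma> then f1 (- \<sigma> - x) else if x \<le> \<sigma> then f2 x else f3 (x - \<sigma>))"
        using q(3) 1 \<sigma> by (simp add: v_def)
      show ?thesis by (rule exI, rule exI, intro conjI, rule pl, rule mi, rule jump)
    next
      case 2
      have z: "?\<zeta> = of_real x" using 2 by (simp add: gpath_def complex_eq_iff abs_less_iff)
      have q: "nt_upper (cauchy f2) x (h2p x)" "nt_lower (cauchy f2) x (h2m x)" "h2p x - h2m x = f2 x"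
        using elim(2) by simp_all
      define k where "k = - cauchy f1 (line_coord (- \<sigma>) ?\<zeta>) + cauchy f3 (line_coord \<sigma> ?\<zeta>)"
      have S_eq: "?S = (\<lambda>w. cauchy f2 w + (- cauchy f1 (line_coord (- \<sigma>) w) + cauchy f3 (line_coord \<sigma> w)))"
        by (simp add: strip_cauchy_def fun_eq_iff)
      have rest: "((\<lambda>w. - cauchy f1 (line_coord (- \<sigma>) w) + cauchy f3 (line_coord \<sigma> w)) \<longlongrightarrow> k) (at ?\<zeta> within V)" for V
        unfolding k_def using 2 \<sigma> by (intro tendsto_add tendsto_minus cauchy_rot_tendsto[OF p] f) (auto simp: z)
      have "(?S \<longlongrightarrow> h2p x + k) (at ?\<zeta> within (\<lambda>z. ?\<zeta> + z) ` inner_cone \<sigma> \<alpha> ?\<zeta>)" if a: "\<alpha> > 0" for \<alpha>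
        unfolding S_eq
      proof (intro tendsto_add rest)
        show "(cauchy f2 \<longlongrightarrow> h2p x) (at ?\<zeta> within (\<lambda>z. ?\<zeta> + z) ` inner_cone \<sigma> \<alpha> ?\<zeta>)"
          using q(1)[unfolded nt_upper_def, rule_format, OF a] unfolding inner_cone_gpath(2)[OF \<sigma> 2] unfolding z
          by (rule tendsto_within_subset) auto
      qed
      moreover have "(?S \<longlongrightarrow> h2m x + k) (at ?\<zeta> within (\<lambda>z. ?\<zeta> - z) ` inner_cone \<sigma> \<alpha> ?\<zeta>)" if a: "\<alpha> > 0" for \<alpha>
        unfolding S_eq
      proof (intro tendsto_add rest)
        show "(cauchy f2 \<longlongrightarrow> h2m x) (at ?\<zeta> within (\<lambda>z. ?\<zeta> - z) ` inner_cone \<sigma> \<alpha> ?\<zeta>)"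
          using q(2)[unfolded nt_lower_def, rule_format, OF a] unfolding inner_cone_gpath(2)[OF \<sigma> 2] unfolding z
          by (rule tendsto_within_subset) auto
      qed
      ultimately have pl: "has_nt_limit_plus \<sigma> ?S ?\<zeta> (h2p x + k)" and mi: "has_nt_limit_minus \<sigma> (\<lambda>w. - ?S w) ?\<zeta> (- (h2m x + k))"
        by (intro plusI minusI; simp)+
      have jump: "(h2p x + k) + (- (h2m x + k)) = (if x < - \<sigma> then f1 (- \<sigma> - x) else if x \<le> \<sigma> then f2 x else f3 (x - \<sigma>))"
        using q(3) 2 \<sigma> by (auto simp: algebra_simps)
      show ?thesis by (rule exI, rule exI, intro conjI, rule pl, rule mi, rule jump)
    next
      case 3
      define v where "v = x - \<sigma>"
      have v: "v > 0" using 3 by (simp add: v_def)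
      have z: "?\<zeta> = Complex \<sigma> v" using 3 \<sigma> by (simp add: gpath_def v_def)
      have rz: "line_coord \<sigma> ?\<zeta> = of_real v" by (simp add: z line_coord_eq complex_eq_iff)
      have q: "nt_upper (cauchy f3) v (h3p v)" "nt_lower (cauchy f3) v (h3m v)" "h3p v - h3m v = f3 v"
        using elim(3) by (simp_all add: v_def)
      define k where "k = - cauchy f1 (line_coord (- \<sigma>) ?\<zeta>) + cauchy f2 ?\<zeta>"
      have S_eq: "?S = (\<lambda>w. cauchy f3 (line_coord \<sigma> w) + (- cauchy f1 (line_coord (- \<sigma>) w) + cauchy f2 w))"
        by (simp add: strip_cauchy_def fun_eq_iff)
      have rest: "((\<lambda>w. - cauchy f1 (line_coord (- \<sigma>) w) + cauchy f2 w) \<longlongrightarrow> k) (at ?\<zeta> within V)" for V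
        unfolding k_def using v \<sigma> by (intro tendsto_add tendsto_minus cauchy_tendsto_nonreal[OF p] cauchy_rot_tendsto[OF p] f) (auto simp: z)
      have "(?S \<longlongrightarrow> h3p v + k) (at ?\<zeta> within (\<lambda>z. ?\<zeta> + z) ` inner_cone \<sigma> \<alpha> ?\<zeta>)" if a: "\<alpha> > 0" for \<alpha>
        unfolding S_eq
      proof (intro tendsto_add rest)
        show "((\<lambda>w. cauchy f3 (line_coord \<sigma> w)) \<longlongrightarrow> h3p v) (at ?\<zeta> within (\<lambda>z. ?\<zeta> + z) ` inner_cone \<sigma> \<alpha> ?\<zeta>)"
          by (rule tendsto_within_compose[OF q(1)[unfolded nt_upper_def, rule_format, OF a] line_coord_isCont rz])
             (auto simp: inner_cone_gpath(3)[OF \<sigma> 3, unfolded z] z line_coord_eq complex_eq_iff)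
      qed
      moreover have "(?S \<longlongrightarrow> h3m v + k) (at ?\<zeta> within (\<lambda>z. ?\<zeta> - z) ` inner_cone \<sigma> \<alpha> ?\<zeta>)" if a: "\<alpha> > 0" for \<alpha>
        unfolding S_eq
      proof (intro tendsto_add rest)
        show "((\<lambda>w. cauchy f3 (line_coord \<sigma> w)) \<longlongrightarrow> h3m v) (at ?\<zeta> within (\<lambda>z. ?\<zeta> - z) ` inner_cone \<sigma> \<alpha> ?\<zeta>)"
          by (rule tendsto_within_compose[OF q(2)[unfolded nt_lower_def, rule_format, OF a] line_coord_isCont rz])
             (auto simp: inner_cone_gpath(3)[OF \<sigma> 3, unfolded z] z line_coord_eq complex_eq_iff)
      qed
      ultimately have pl: "has_nt_limit_plus \<sigma> ?S ?\<zeta> (h3p v + k)" and mi: "has_nt_limit_minus \<sigma> (\<lambda>w. - ?S w) ?\<zeta> (- (h3m v + k))"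
        by (intro plusI minusI; simp)+
      have jump: "(h3p v + k) + (- (h3m v + k)) = (if x < - \<sigma> then f1 (- \<sigma> - x) else if x \<le> \<sigma> then f2 x else f3 (x - \<sigma>))"
        using q(3) 3 \<sigma> by (simp add: v_def)
      show ?thesis by (rule exI, rule exI, intro conjI, rule pl, rule mi, rule jump)
    qed
  qed
qed

section \<open>The decomposition theorem\<close>

theorem theorem5p10:
  fixes \<sigma> p :: real and F :: "complex \<Rightarrow> complex"
  assumes "0 < \<sigma>" and "1 < p"
  shows "F \<in> Lp p (arc_length \<sigma> 0) \<longleftrightarrow>
    (\<exists>F\<^sub>p F\<^sub>m f\<^sub>p f\<^sub>m.
       F\<^sub>p \<in> Hardy_plus p \<sigma> \<and> F\<^sub>m \<in> Hardy_minus p \<sigma> \<and>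
       nt_boundary_function_plus \<sigma> F\<^sub>p f\<^sub>p \<and> nt_boundary_function_minus \<sigma> F\<^sub>m f\<^sub>m \<and>
       (AE \<zeta> in arc_length \<sigma> 0. F \<zeta> = f\<^sub>p \<zeta> + f\<^sub>m \<zeta>))"
proof
  assume "F \<in> Lp p (arc_length \<sigma> 0)"
  then obtain G where G: "lp_fun p G" and FG: "AE x in lborel. F (gpath \<sigma> 0 x) = G x"
    unfolding Lp_arc_length_iff[OF assms(1)] by blast
  have [measurable]: "G \<in> borel_measurable borel" using G by (simp add: lp_fun_def)
  \<comment> \<open>the parameters of the points at height v on the left and right half-line are - \<sigma> - v and \<sigma> + v\<close>
  define f1 where "f1 = (\<lambda>v. if 0 < v then G (- \<sigma> + (-1) * v) else 0)"
  define f2 where "f2 = (\<lambda>u. if \<bar>u\<bar> \<le> \<sigma> then G u else 0)"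
  define f3 where "f3 = (\<lambda>v. if 0 < v then G (\<sigma> + 1 * v) else 0)"
  have "lp_fun p f1"
    unfolding f1_def using assms by (intro lp_fun_bound[OF lp_fun_affine[OF G, of "-1" "- \<sigma>"]]) auto
  moreover have "lp_fun p f2"
    unfolding f2_def using assms by (intro lp_fun_bound[OF G]) auto
  moreover have "lp_fun p f3"
    unfolding f3_def using assms by (intro lp_fun_bound[OF lp_fun_affine[OF G, of 1 \<sigma>]]) auto
  ultimately have f: "lp_fun p f1" "lp_fun p f2" "lp_fun p f3" by blast+
  have supp: "\<And>t. f1 t \<noteq> 0 \<Longrightarrow> 0 \<le> t" "\<And>t. f2 t \<noteq> 0 \<Longrightarrow> t \<in> {-\<sigma>..\<sigma>}" "\<And>t. f3 t \<noteq> 0 \<Longrightarrow> 0 \<le> t"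
    by (auto simp: f1_def f2_def f3_def abs_le_iff split: if_splits)
  let ?S = "strip_cauchy \<sigma> f1 f2 f3"
  let ?Q = "\<lambda>\<zeta> L\<^sub>p L\<^sub>m. has_nt_limit_plus \<sigma> ?S \<zeta> L\<^sub>p \<and> has_nt_limit_minus \<sigma> (\<lambda>w. - ?S w) \<zeta> L\<^sub>m \<and> F \<zeta> = L\<^sub>p + L\<^sub>m"
  have "AE x in lborel. \<exists>L. ?Q (gpath \<sigma> 0 x) (fst L) (snd L)"
    using strip_cauchy_boundary[OF assms(2,1) f] FG
  proof eventually_elim
    case (elim x)
    have "(if x < - \<sigma> then f1 (- \<sigma> - x) else if x \<le> \<sigma> then f2 x else f3 (x - \<sigma>)) = G x"
      by (auto simp: f1_def f2_def f3_def)
    with elim(1) obtain L\<^sub>p L\<^sub>m where "has_nt_limit_plus \<sigma> ?S (gpath \<sigma> 0 x) L\<^sub>p"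
      "has_nt_limit_minus \<sigma> (\<lambda>w. - ?S w) (gpath \<sigma> 0 x) L\<^sub>m" "L\<^sub>p + L\<^sub>m = G x" by metis
    with elim(2) have "?Q (gpath \<sigma> 0 x) L\<^sub>p L\<^sub>m" by simp
    then show ?case by (intro exI[of _ "(L\<^sub>p, L\<^sub>m)"]) simp
  qed
  then have Q: "AE \<zeta> in arc_length \<sigma> 0. \<exists>L. ?Q \<zeta> (fst L) (snd L)"
    unfolding AE_arc_length_iff[OF assms(1)] .
  define L where "L = (\<lambda>\<zeta>. SOME L. ?Q \<zeta> (fst L) (snd L))"
  have L: "AE \<zeta> in arc_length \<sigma> 0. ?Q \<zeta> (fst (L \<zeta>)) (snd (L \<zeta>))"
    using Q by eventually_elim (unfold L_def, rule someI_ex)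
  show "\<exists>F\<^sub>p F\<^sub>m f\<^sub>p f\<^sub>m.
       F\<^sub>p \<in> Hardy_plus p \<sigma> \<and> F\<^sub>m \<in> Hardy_minus p \<sigma> \<and>
       nt_boundary_function_plus \<sigma> F\<^sub>p f\<^sub>p \<and> nt_boundary_function_minus \<sigma> F\<^sub>m f\<^sub>m \<and>
       (AE \<zeta> in arc_length \<sigma> 0. F \<zeta> = f\<^sub>p \<zeta> + f\<^sub>m \<zeta>)"
  proof (intro exI conjI)
    show "?S \<in> Hardy_plus p \<sigma>" by (rule strip_cauchy_hardy(1)[OF assms(2,1) f supp])
    show "(\<lambda>w. - ?S w) \<in> Hardy_minus p \<sigma>" by (rule strip_cauchy_hardy(2)[OF assms(2,1) f supp])
    show "nt_boundary_function_plus \<sigma> ?S (\<lambda>\<zeta>. fst (L \<zeta>))"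
      unfolding nt_boundary_function_plus_def using L by eventually_elim blast
    show "nt_boundary_function_minus \<sigma> (\<lambda>w. - ?S w) (\<lambda>\<zeta>. snd (L \<zeta>))"
      unfolding nt_boundary_function_minus_def using L by eventually_elim blast
    show "AE \<zeta> in arc_length \<sigma> 0. F \<zeta> = fst (L \<zeta>) + snd (L \<zeta>)"
      using L by eventually_elim blast
  qed
next
  assume "\<exists>F\<^sub>p F\<^sub>m f\<^sub>p f\<^sub>m.
       F\<^sub>p \<in> Hardy_plus p \<sigma> \<and> F\<^sub>m \<in> Hardy_minus p \<sigma> \<and>
       nt_boundary_function_plus \<sigma> F\<^sub>p f\<^sub>p \<and> nt_boundary_function_minus \<sigma> F\<^sub>m f\<^sub>m \<and>
       (AE \<zeta> in arc_length \<sigma> 0. F \<zeta> = f\<^sub>p \<zeta> + f\<^sub>m \<zeta>)"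
  then obtain F\<^sub>p F\<^sub>m f\<^sub>p f\<^sub>m where H: "F\<^sub>p \<in> Hardy_plus p \<sigma>" "F\<^sub>m \<in> Hardy_minus p \<sigma>"
    "nt_boundary_function_plus \<sigma> F\<^sub>p f\<^sub>p" "nt_boundary_function_minus \<sigma> F\<^sub>m f\<^sub>m"
    and F: "AE \<zeta> in arc_length \<sigma> 0. F \<zeta> = f\<^sub>p \<zeta> + f\<^sub>m \<zeta>" by blast
  obtain G where G: "lp_fun p G" "AE x in lborel. f\<^sub>p (gpath \<sigma> 0 x) = G x"
    using nt_boundary_plus_lp[OF assms H(1,3)] by blast
  obtain G' where G': "lp_fun p G'" "AE x in lborel. f\<^sub>m (gpath \<sigma> 0 x) = G' x"
    using nt_boundary_minus_lp[OF assms H(2,4)] by blast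
  have "AE x in lborel. F (gpath \<sigma> 0 x) = G x + G' x"
    using F[unfolded AE_arc_length_iff[OF assms(1)]] G(2) G'(2) by eventually_elim simp
  moreover have "lp_fun p (\<lambda>x. G x + G' x)"
    using assms G(1) G'(1) by (intro lp_fun_add) auto
  ultimately show "F \<in> Lp p (arc_length \<sigma> 0)"
    unfolding Lp_arc_length_iff[OF assms(1)] by blast
qed

end
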